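(* Let $X$ be a dense subset of a metric space $M$ (with the induced metric). (1) The hyperspace $2^X$ is an absolute neighborhood retract if and only if $2^M$ is an absolute neighborhood retract; and $2^X$ is an absolute retract if and only if $2^M$ is an absolute retract. (2) The hyperspace $\mathrm{Bd}(X)$ is an absolute neighborhood retract if and only if $\mathrm{Bd}(M)$ is an absolute neighborhood retract; and $\mathrm{Bd}(X)$ is an absolute retract if and only if $\mathrm{Bd}(M)$ is an absolute retract.
   Context: For a metric space $(Y,d)$, $2^Y$ is the set of all non-empty closed subsets of $Y$ endowed with the metric $\min\{1,d_H\}$, where $d_H(A,B)=\max\{\sup_{x\in B}d(x,A),\sup_{x\in A}d(x,B)\}\in[0,\infty]$, and $\mathrm{Bd}(Y)\subset 2^Y$ is the subspace of all bounded non-empty closed subsets of $Y$, with the Hausdorff metric $d_H$. A metric space $Z$ is an absolute neighborhood retract (resp. absolute retract) if for each metric space $N$ containing $Z$ isometrically as a closed subset there is a (continuous) retraction $r:U\to Z$ from some open neighborhood $U$ of $Z$ in $N$ (resp. from $U=N$). *)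

theory Defs
  imports "HOL-Analysis.Analysis"
begin

definition point_dist :: "'a metric \<Rightarrow> 'a \<Rightarrow> 'a set \<Rightarrow> ennreal" where
  "point_dist m x A = (INF a\<in>A. ennreal (mdist m x a))"

definition hausdorff_dist :: "'a metric \<Rightarrow> 'a set \<Rightarrow> 'a set \<Rightarrow> ennreal" where
  "hausdorff_dist m A B = max (SUP x\<in>B. point_dist m x A) (SUP x\<in>A. point_dist m x B)"

definition closed_nonempty :: "'a metric \<Rightarrow> 'a set set" where
  "closed_nonempty m = {A. closedin (mtopology_of m) A \<and> A \<noteq> {}}"

definition closed_bounded_nonempty :: "'a metric \<Rightarrow> 'a set set" where
  "closed_bounded_nonempty m =
     {A \<in> closed_nonempty m. Metric_space.mbounded (mspace m) (mdist m) A}"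

definition hyperspace :: "'a metric \<Rightarrow> 'a set metric" where
  "hyperspace m = metric (closed_nonempty m, \<lambda>A B. enn2real (min 1 (hausdorff_dist m A B)))"

definition bounded_hyperspace :: "'a metric \<Rightarrow> 'a set metric" where
  "bounded_hyperspace m =
     metric (closed_bounded_nonempty m, \<lambda>A B. enn2real (hausdorff_dist m A B))"

text \<open>
  The type \<^typ>\<open>'a metric\<close> is a typedef, so the two definitions above are only meaningful
  once the distances are known to be metrics on the respective carriers.
\<close>

lemma ennreal_INF_const_add:
  fixes f :: "'i \<Rightarrow> ennreal"
  assumes "I \<noteq> {}"
  shows "(INF i\<in>I. c + f i) = c + (INF i\<in>I. f i)"
proof -
  have "(INF i\<in>I. f i + c) = (INF i\<in>I. f i) + c"
    using assms continuous_at_Inf_mono[of "\<lambda>x. x + c" "f ` I"]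
      continuous_add[of "at_right (Inf (f ` I))", of "\<lambda>x. x" "\<lambda>x. c"]
    by (auto simp: mono_def image_comp)
  then show ?thesis by (simp add: add.commute)
qed

lemma closed_nonemptyD:
  assumes "A \<in> closed_nonempty m"
  shows "closedin (mtopology_of m) A" "A \<subseteq> mspace m" "A \<noteq> {}"
  using assms closedin_subset[of "mtopology_of m" A] by (simp_all add: closed_nonempty_def)

lemma hausdorff_dist_commute: "hausdorff_dist m A B = hausdorff_dist m B A"
  by (simp add: hausdorff_dist_def max.commute)

lemma point_dist_le_hausdorff_dist:
  "x \<in> B \<Longrightarrow> point_dist m x A \<le> hausdorff_dist m A B"
  unfolding hausdorff_dist_def by (meson SUP_upper max.coboundedI1)

lemma point_dist_triangle:
  assumes x: "x \<in> mspace m" and A: "A \<subseteq> mspace m" and B: "B \<subseteq> mspace m" "B \<noteq> {}"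
  shows "point_dist m x A \<le> point_dist m x B + hausdorff_dist m A B"
proof -
  have "point_dist m x A \<le> ennreal (mdist m x b) + hausdorff_dist m A B" if b: "b \<in> B" for b
  proof -
    have "point_dist m x A \<le> (INF a\<in>A. ennreal (mdist m x b) + ennreal (mdist m b a))"
      unfolding point_dist_def
    proof (rule INF_mono)
      fix a assume "a \<in> A"
      then have "mdist m x a \<le> mdist m x b + mdist m b a"
        using x b A B by (meson mdist_triangle subsetD)
      then show "\<exists>a'\<in>A. ennreal (mdist m x a') \<le> ennreal (mdist m x b) + ennreal (mdist m b a)"
        using \<open>a \<in> A\<close> by (metis ennreal_leI ennreal_plus mdist_nonneg)
    qed
    also have "\<dots> \<le> ennreal (mdist m x b) + point_dist m b A"
    proof (cases "A = {}")
      case False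
      then show ?thesis
        by (simp add: point_dist_def ennreal_INF_const_add)
    qed (simp add: point_dist_def)
    also have "\<dots> \<le> ennreal (mdist m x b) + hausdorff_dist m A B"
      using b by (intro add_left_mono point_dist_le_hausdorff_dist)
    finally show ?thesis .
  qed
  then have "point_dist m x A \<le> (INF b\<in>B. hausdorff_dist m A B + ennreal (mdist m x b))"
    by (intro INF_greatest) (simp add: add.commute)
  also have "\<dots> = hausdorff_dist m A B + point_dist m x B"
    using B by (simp add: point_dist_def ennreal_INF_const_add)
  finally show ?thesis by (simp add: add.commute)
qed

lemma hausdorff_dist_triangle:
  assumes A: "A \<subseteq> mspace m" and B: "B \<subseteq> mspace m" "B \<noteq> {}" and C: "C \<subseteq> mspace m"
  shows "hausdorff_dist m A C \<le> hausdorff_dist m A B + hausdorff_dist m B C"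
proof -
  have *: "point_dist m x A \<le> hausdorff_dist m A B + hausdorff_dist m B C"
    if "A \<subseteq> mspace m" "C \<subseteq> mspace m" "x \<in> C" for x A C
  proof -
    have "point_dist m x A \<le> point_dist m x B + hausdorff_dist m A B"
      using that B by (intro point_dist_triangle) auto
    also have "\<dots> \<le> hausdorff_dist m B C + hausdorff_dist m A B"
      using that by (intro add_right_mono point_dist_le_hausdorff_dist)
    finally show ?thesis by (simp add: add.commute)
  qed
  have "point_dist m x C \<le> hausdorff_dist m A B + hausdorff_dist m B C" if "x \<in> A" for x
    using *[of C A x] that A C
    by (simp add: add.commute hausdorff_dist_commute[of m C B] hausdorff_dist_commute[of m B A])
  then show ?thesis
    unfolding hausdorff_dist_def[of m A C] using *[of A C] A C
    by (intro max.boundedI SUP_least) auto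
qed

lemma hausdorff_dist_refl: "A \<subseteq> mspace m \<Longrightarrow> hausdorff_dist m A A = 0"
proof -
  assume A: "A \<subseteq> mspace m"
  have "point_dist m x A = 0" if x: "x \<in> A" for x
  proof -
    have "point_dist m x A \<le> ennreal (mdist m x x)"
      unfolding point_dist_def using x by (rule INF_lower)
    also have "\<dots> = 0" using x A by (simp add: subsetD)
    finally show ?thesis by simp
  qed
  then show ?thesis
    by (cases "A = {}") (simp_all add: hausdorff_dist_def bot_ennreal)
qed

lemma point_dist_eq_0_imp_mem:
  assumes A: "closedin (mtopology_of m) A" and x: "x \<in> mspace m" and 0: "point_dist m x A = 0"
  shows "x \<in> A"
proof (rule ccontr)
  interpret Metric_space "mspace m" "mdist m"
    by (rule Metric_space_mspace_mdist)
  assume "x \<notin> A"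
  then obtain r where r: "r > 0" "disjnt A (mball x r)"
    using A x by (auto simp: mtopology_of_def closedin_metric)
  have "(INF a\<in>A. ennreal (mdist m x a)) < ennreal r"
    using 0 r by (simp add: point_dist_def)
  then obtain a where a: "a \<in> A" "ennreal (mdist m x a) < ennreal r"
    by (auto simp: INF_less_iff)
  then have "a \<in> mball x r"
    using x closedin_subset[OF A] by (auto simp: ennreal_less_iff)
  then show False using r a by (auto simp: disjnt_def)
qed

lemma hausdorff_dist_eq_0_imp_subset:
  assumes A: "closedin (mtopology_of m) A" and B: "B \<subseteq> mspace m"
    and 0: "hausdorff_dist m A B = 0"
  shows "B \<subseteq> A"
proof
  fix x assume x: "x \<in> B"
  then have "point_dist m x A = 0"
    using point_dist_le_hausdorff_dist[of x B m A] 0 by simp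
  with subsetD[OF B x] show "x \<in> A"
    by (rule point_dist_eq_0_imp_mem[OF A])
qed

lemma hausdorff_dist_eq_0_iff:
  assumes "A \<in> closed_nonempty m" "B \<in> closed_nonempty m"
  shows "hausdorff_dist m A B = 0 \<longleftrightarrow> A = B"
proof -
  have A: "closedin (mtopology_of m) A" "A \<subseteq> mspace m"
    and B: "closedin (mtopology_of m) B" "B \<subseteq> mspace m"
    using assms by (simp_all add: closed_nonemptyD)
  show ?thesis
  proof
    assume 0: "hausdorff_dist m A B = 0"
    then have "hausdorff_dist m B A = 0"
      by (simp only: hausdorff_dist_commute[of m B A])
    then have "A \<subseteq> B"
      by (rule hausdorff_dist_eq_0_imp_subset[OF B(1) A(2)])
    moreover have "B \<subseteq> A"
      using 0 by (rule hausdorff_dist_eq_0_imp_subset[OF A(1) B(2)])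
    ultimately show "A = B" ..
  next
    assume "A = B"
    show "hausdorff_dist m A B = 0"
      unfolding \<open>A = B\<close> by (rule hausdorff_dist_refl[OF B(2)])
  qed
qed

lemma hausdorff_dist_finite:
  assumes "A \<in> closed_bounded_nonempty m" "B \<in> closed_bounded_nonempty m"
  shows "hausdorff_dist m A B < top"
proof -
  interpret Metric_space "mspace m" "mdist m"
    by (rule Metric_space_mspace_mdist)
  have "mbounded (A \<union> B)"
    using assms by (simp add: closed_bounded_nonempty_def mbounded_Un)
  then obtain K where K: "\<And>x y. x \<in> A \<union> B \<Longrightarrow> y \<in> A \<union> B \<Longrightarrow> mdist m x y \<le> K"
    unfolding mbounded_alt by blast
  have ne: "A \<noteq> {}" "B \<noteq> {}"
    using assms by (auto simp: closed_bounded_nonempty_def closed_nonempty_def)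
  have *: "point_dist m x C \<le> ennreal K" if "x \<in> A \<union> B" "C \<subseteq> A \<union> B" "C \<noteq> {}" for x C
  proof -
    obtain c where "c \<in> C" using \<open>C \<noteq> {}\<close> by blast
    then have "point_dist m x C \<le> ennreal (mdist m x c)"
      unfolding point_dist_def by (rule INF_lower)
    also have "\<dots> \<le> ennreal K"
      using K[OF that(1) subsetD[OF that(2) \<open>c \<in> C\<close>]] by (rule ennreal_leI)
    finally show ?thesis .
  qed
  have "hausdorff_dist m A B \<le> ennreal K"
    unfolding hausdorff_dist_def by (intro max.boundedI SUP_least *) (simp_all add: ne)
  then show ?thesis
    using ennreal_less_top by (rule order.strict_trans1)
qed

lemma Metric_space_hyperspace:
  "Metric_space (closed_nonempty m) (\<lambda>A B. enn2real (min 1 (hausdorff_dist m A B)))"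
proof
  fix A B C
  show "0 \<le> enn2real (min 1 (hausdorff_dist m A B))" by simp
  show "enn2real (min 1 (hausdorff_dist m A B)) = enn2real (min 1 (hausdorff_dist m B A))"
    by (simp add: hausdorff_dist_commute)
  have fin: "min 1 d < top" for d :: ennreal
    by (simp add: min_less_iff_disj)
  {
    assume "A \<in> closed_nonempty m" "B \<in> closed_nonempty m"
    then have "hausdorff_dist m A B = 0 \<longleftrightarrow> A = B" by (rule hausdorff_dist_eq_0_iff)
    moreover have "enn2real (min 1 (hausdorff_dist m A B)) = 0 \<longleftrightarrow> hausdorff_dist m A B = 0"
      using fin[of "hausdorff_dist m A B"] by (auto simp: enn2real_eq_0_iff min_def split: if_splits)
    ultimately show "enn2real (min 1 (hausdorff_dist m A B)) = 0 \<longleftrightarrow> A = B" by simp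
  next
    assume "A \<in> closed_nonempty m" "B \<in> closed_nonempty m" "C \<in> closed_nonempty m"
    then have t: "hausdorff_dist m A C \<le> hausdorff_dist m A B + hausdorff_dist m B C"
      by (intro hausdorff_dist_triangle) (simp_all add: closed_nonemptyD)
    have mono: "min 1 c \<le> min 1 a + min 1 b" if "c \<le> a + b" for a b c :: ennreal
    proof (cases "1 \<le> a \<or> 1 \<le> b")
      case True
      then have "min 1 a = 1 \<or> min 1 b = 1"
        by (metis min.absorb1)
      then have "1 \<le> min 1 a + min 1 b"
        by (metis add_increasing add_increasing2 order_refl zero_le)
      then show ?thesis by (rule min.coboundedI1)
    next
      case False
      then have "min 1 a = a" "min 1 b = b"
        by (simp_all add: min_def)
      then have "c \<le> min 1 a + min 1 b"
        using that by simp
      then show ?thesis by (rule min.coboundedI2)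
    qed
    have "enn2real (min 1 (hausdorff_dist m A C))
        \<le> enn2real (min 1 (hausdorff_dist m A B) + min 1 (hausdorff_dist m B C))"
      using mono[OF t] fin by (intro enn2real_mono) auto
    also have "\<dots> = enn2real (min 1 (hausdorff_dist m A B)) + enn2real (min 1 (hausdorff_dist m B C))"
      using fin by (intro enn2real_plus) auto
    finally show "enn2real (min 1 (hausdorff_dist m A C))
        \<le> enn2real (min 1 (hausdorff_dist m A B)) + enn2real (min 1 (hausdorff_dist m B C))" .
  }
qed

lemma Metric_space_bounded_hyperspace:
  "Metric_space (closed_bounded_nonempty m) (\<lambda>A B. enn2real (hausdorff_dist m A B))"
proof
  fix A B C
  show "0 \<le> enn2real (hausdorff_dist m A B)" by simp
  show "enn2real (hausdorff_dist m A B) = enn2real (hausdorff_dist m B A)"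
    by (simp add: hausdorff_dist_commute)
  have cn: "A \<in> closed_nonempty m" if "A \<in> closed_bounded_nonempty m" for A
    using that by (simp add: closed_bounded_nonempty_def)
  {
    assume AB: "A \<in> closed_bounded_nonempty m" "B \<in> closed_bounded_nonempty m"
    then show "enn2real (hausdorff_dist m A B) = 0 \<longleftrightarrow> A = B"
      using hausdorff_dist_eq_0_iff[OF cn[OF AB(1)] cn[OF AB(2)]] hausdorff_dist_finite[OF AB]
      by (auto simp: enn2real_eq_0_iff)
  next
    assume A: "A \<in> closed_bounded_nonempty m" and B: "B \<in> closed_bounded_nonempty m"
      and C: "C \<in> closed_bounded_nonempty m"
    have t: "hausdorff_dist m A C \<le> hausdorff_dist m A B + hausdorff_dist m B C"
      using closed_nonemptyD[OF cn[OF A]] closed_nonemptyD[OF cn[OF B]] closed_nonemptyD[OF cn[OF C]]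
      by (intro hausdorff_dist_triangle)
    note fin = hausdorff_dist_finite[OF A B] hausdorff_dist_finite[OF B C]
    have "enn2real (hausdorff_dist m A C)
        \<le> enn2real (hausdorff_dist m A B + hausdorff_dist m B C)"
      using t fin by (intro enn2real_mono) auto
    also have "\<dots> = enn2real (hausdorff_dist m A B) + enn2real (hausdorff_dist m B C)"
      using fin by (intro enn2real_plus) auto
    finally show "enn2real (hausdorff_dist m A C)
        \<le> enn2real (hausdorff_dist m A B) + enn2real (hausdorff_dist m B C)" .
  }
qed

lemma mspace_hyperspace [simp]: "mspace (hyperspace m) = closed_nonempty m"
  by (simp add: hyperspace_def Metric_space.mspace_metric Metric_space_hyperspace)

lemma mdist_hyperspace:
  "mdist (hyperspace m) = (\<lambda>A B. enn2real (min 1 (hausdorff_dist m A B)))"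
  by (simp add: hyperspace_def Metric_space.mdist_metric Metric_space_hyperspace)

lemma mspace_bounded_hyperspace [simp]:
  "mspace (bounded_hyperspace m) = closed_bounded_nonempty m"
  by (simp add: bounded_hyperspace_def Metric_space.mspace_metric Metric_space_bounded_hyperspace)

lemma mdist_bounded_hyperspace:
  "mdist (bounded_hyperspace m) = (\<lambda>A B. enn2real (hausdorff_dist m A B))"
  by (simp add: bounded_hyperspace_def Metric_space.mdist_metric Metric_space_bounded_hyperspace)

definition closed_isometric_embedding :: "'z metric \<Rightarrow> 'n metric \<Rightarrow> ('z \<Rightarrow> 'n) \<Rightarrow> bool" where
  "closed_isometric_embedding Z N e \<longleftrightarrow>
     (\<forall>x\<in>mspace Z. \<forall>y\<in>mspace Z. mdist N (e x) (e y) = mdist Z x y) \<and>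
     closedin (mtopology_of N) (e ` mspace Z)"

text \<open>
  Absoluteness quantifies over all metric spaces \<open>N\<close>, hence over types, which no single HOL
  formula can do.  Here \<open>N\<close> ranges over the metric spaces with points in
  \<^typ>\<open>('z \<Rightarrow> real) + 'u\<close>, and a theorem that is polymorphic in \<^typ>\<open>'u\<close> covers every metric
  space.  The summand \<^typ>\<open>'z \<Rightarrow> real\<close> keeps the universe large enough whatever \<^typ>\<open>'u\<close> is:
  by the Kuratowski-Wojdyslawski theorem, \<open>Z\<close> is isometric to a closed subset of a convex set of
  real functions on \<open>Z\<close> with a metric given by a norm, and by Dugundji's extension theorem
  retracting (a neighbourhood in) this single space onto \<open>Z\<close> suffices for all other \<open>N\<close>.
  So the truth value does not depend on \<^typ>\<open>'u\<close>.
\<close>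

definition abs_nbhd_retract :: "'u itself \<Rightarrow> 'z metric \<Rightarrow> bool" where
  "abs_nbhd_retract (universe :: 'u itself) (Z :: 'z metric) \<longleftrightarrow>
     (\<forall>(N :: (('z \<Rightarrow> real) + 'u) metric) e. closed_isometric_embedding Z N e \<longrightarrow>
        (\<exists>U. openin (mtopology_of N) U \<and> e ` mspace Z \<subseteq> U \<and>
             e ` mspace Z retract_of_space subtopology (mtopology_of N) U))"

definition abs_retract :: "'u itself \<Rightarrow> 'z metric \<Rightarrow> bool" where
  "abs_retract (universe :: 'u itself) (Z :: 'z metric) \<longleftrightarrow>
     (\<forall>(N :: (('z \<Rightarrow> real) + 'u) metric) e. closed_isometric_embedding Z N e \<longrightarrow>
        e ` mspace Z retract_of_space mtopology_of N)"

end

theory Submission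
  imports Defs "HOL-Library.Ramsey"
begin

text \<open>
  Whether a hyperspace is an absolute (neighbourhood) retract can be read off from chains of points in
  the underlying metric space, and chains do not notice the passage to a dense subset.

  Call \<open>m\<close> locally equichained if for every bounded set \<open>B\<close> and \<open>\<epsilon> > 0\<close> there is \<open>\<delta> > 0\<close> such that for each step size
  \<open>\<eta>\<close> one number of steps of size \<open>\<eta>\<close> suffices to get from any \<open>x\<close> in \<open>B\<close> to any point at distance less than \<open>\<delta>\<close>
  without leaving the \<open>\<epsilon>\<close>-ball around \<open>x\<close>. The space of bounded closed sets is an absolute neighbourhood retract
  if and only if \<open>m\<close> is locally equichained (\<open>bounded_hyperspace_ANR_iff\<close>). It is an absolute retract if and only if
  moreover \<open>m\<close> is nonempty and any bounded set can be chained in the same uniform way inside some bounded set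
  (\<open>bounded_hyperspace_AR_iff\<close>). Moving the points of a chain slightly turns chains of \<open>M\<close> into
  chains of \<open>X\<close> with slightly longer steps, so \<open>X\<close> and \<open>M\<close> satisfy these conditions simultaneously. The
  hyperspace of all closed sets is the hyperspace of bounded sets for the metric capped at 1, so it
  requires no separate argument.

  Necessity. Inside a space that contains a given metric space as a closed subset together with segments between its points,
  a retraction turns segments into paths. Hence nearby points of a neighbourhood retract are joined by small paths. A path of closed sets
  traces chains, with a number of steps that is uniform over the points of the final set. The remaining issue is
  to make \<open>\<delta>\<close> uniform over \<open>B\<close>. For separated sets this is automatic, as paths of sets close to
  a separated set are made of independent pieces. A failure on \<open>B\<close> would show up, by Ramsey's theorem,
  either on a separated set or on clusters shrinking along a separated or a Cauchy sequence, and each case is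
  contradictory (\<open>close_sets_chained_imp_locally_equichained\<close>).

  Sufficiency. Refining chains repeatedly yields for each point \<open>x\<close> an increasing family of sets \<open>g t x\<close> that starts at
  \<open>{x}\<close>, contains the \<open>t\<close>-ball around \<open>x\<close> and is continuous in \<open>t\<close>, uniformly in \<open>x\<close> (\<open>growth\<close>). A retraction onto the
  embedded hyperspace is then given by an explicit formula: a point \<open>z\<close> goes to the closure of a union of
  growths of the closed sets near \<open>z\<close>, where the growth time tends to zero as a set ceases to be near
  (\<open>hyperspace_retraction\<close>).
\<close>

section \<open>Approximation of sets and chains of points\<close>

abbreviation mbounded_of :: "'a metric \<Rightarrow> 'a set \<Rightarrow> bool" where
  "mbounded_of m \<equiv> Metric_space.mbounded (mspace m) (mdist m)"

abbreviation mclosure :: "'a metric \<Rightarrow> 'a set \<Rightarrow> 'a set" where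
  "mclosure m A \<equiv> mtopology_of m closure_of A"

text \<open>
  One half of the statement that the Hausdorff distance of the two sets is below the bound. It makes
  sense for arbitrary sets, which spares taking closures of the finite and countable sets below.
\<close>

definition near_to :: "'a metric \<Rightarrow> real \<Rightarrow> 'a set \<Rightarrow> 'a set \<Rightarrow> bool" where
  "near_to m r A B \<longleftrightarrow> (\<forall>x\<in>A. \<exists>y\<in>B. mdist m x y < r)"

definition nbhd :: "'a metric \<Rightarrow> 'a set \<Rightarrow> real \<Rightarrow> 'a set" where
  "nbhd m A r = (\<Union>a\<in>A. mball_of m a r)"

text \<open>
  Consecutive points may coincide, so \<open>n\<close> acts as an upper bound on the number of steps.
\<close>

definition chain :: "'a metric \<Rightarrow> real \<Rightarrow> nat \<Rightarrow> 'a set \<Rightarrow> 'a \<Rightarrow> 'a \<Rightarrow> bool" where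
  "chain m \<eta> n S x y \<longleftrightarrow> (\<exists>c. c 0 = x \<and> c n = y \<and> (\<forall>i\<le>n. c i \<in> S) \<and>
     (\<forall>i<n. mdist m (c i) (c (Suc i)) < \<eta>))"

lemma mdist_self [simp]: "x \<in> mspace m \<Longrightarrow> mdist m x x = 0"
  by simp

lemma mball_of_subset_mspace: "mball_of m x r \<subseteq> mspace m"
  by auto

lemma nbhd_subset_mspace: "nbhd m A r \<subseteq> mspace m"
  by (auto simp: nbhd_def)

lemma chain_endpoints: "chain m \<eta> n S x y \<Longrightarrow> x \<in> S \<and> y \<in> S"
  unfolding chain_def by force

lemma chain_trans:
  assumes "chain m \<eta> k S x y" "chain m \<eta> n S y z"
  shows "chain m \<eta> (k + n) S x z"
proof -
  obtain c where c: "c 0 = x" "c k = y" "\<forall>i\<le>k. c i \<in> S" "\<forall>i<k. mdist m (c i) (c (Suc i)) < \<eta>"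
    using assms(1) unfolding chain_def by blast
  obtain c' where c': "c' 0 = y" "c' n = z" "\<forall>i\<le>n. c' i \<in> S"
    "\<forall>i<n. mdist m (c' i) (c' (Suc i)) < \<eta>"
    using assms(2) unfolding chain_def by blast
  define b where "b i = (if i \<le> k then c i else c' (i - k))" for i
  have "mdist m (b i) (b (Suc i)) < \<eta>" if "i < k + n" for i
  proof -
    consider "i < k" | "i = k" | "i > k" by linarith
    then show ?thesis
    proof cases
      case 2 then have "0 < n" using that by simp
      then show ?thesis using 2 c c' by (auto simp: b_def)
    next
      case 3
      then have "i - k < n" "Suc i - k = Suc (i - k)" using that by auto
      then show ?thesis using 3 c' by (simp add: b_def)
    qed (use c in \<open>simp add: b_def\<close>)
  qed
  moreover have "b (k + n) = z" using c c' by (cases n) (auto simp: b_def)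
  ultimately show ?thesis
    unfolding chain_def using c c' by (intro exI[of _ b]) (auto simp: b_def)
qed

lemma chain_sym:
  assumes "chain m \<eta> n S x y" shows "chain m \<eta> n S y x"
proof -
  obtain c where c: "c 0 = x" "c n = y" "\<forall>i\<le>n. c i \<in> S" "\<forall>i<n. mdist m (c i) (c (Suc i)) < \<eta>"
    using assms unfolding chain_def by blast
  have "mdist m (c (n - i)) (c (n - Suc i)) < \<eta>" if "i < n" for i
  proof -
    have "n - Suc i < n" "Suc (n - Suc i) = n - i" using that by auto
    then show ?thesis using c(4) by (metis mdist_commute)
  qed
  then show ?thesis unfolding chain_def using c by (intro exI[of _ "\<lambda>i. c (n - i)"]) auto
qed

lemma chain_refl: "\<lbrakk>x \<in> S; S \<subseteq> mspace m; \<eta> > 0\<rbrakk> \<Longrightarrow> chain m \<eta> n S x x"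
  unfolding chain_def by (intro exI[of _ "\<lambda>_. x"]) auto

lemma chain_step: "\<lbrakk>x \<in> S; y \<in> S; mdist m x y < \<eta>\<rbrakk> \<Longrightarrow> chain m \<eta> 1 S x y"
  unfolding chain_def by (intro exI[of _ "\<lambda>i. if i = 0 then x else y"]) auto

lemma chain_weaken:
  "\<lbrakk>chain m \<eta> n S x y; \<eta> \<le> \<eta>'; S \<subseteq> S'\<rbrakk> \<Longrightarrow> chain m \<eta>' n S' x y"
  unfolding chain_def by (erule ex_forward) (auto intro: order_less_le_trans)

lemma chain_lengthen:
  assumes "chain m \<eta> n S x y" "n \<le> n'" "S \<subseteq> mspace m" "\<eta> > 0"
  shows "chain m \<eta> n' S x y"
  using chain_trans[OF assms(1) chain_refl[of y S m \<eta> "n' - n"]] assms chain_endpoints[OF assms(1)]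
  by simp

lemma mdist_le_via:
  assumes "x \<in> mspace m" "y \<in> mspace m" "z \<in> mspace m"
  shows "mdist m x z \<le> mdist m x y + mdist m y z" "mdist m x z \<le> mdist m y x + mdist m y z"
    "mdist m x z \<le> mdist m x y + mdist m z y"
  using mdist_triangle[OF assms] by (simp_all add: mdist_commute)

section \<open>Hausdorff distance\<close>

lemma mbounded_of_iff:
  "mbounded_of m B \<longleftrightarrow> B \<subseteq> mspace m \<and> (\<exists>K. \<forall>x\<in>B. \<forall>y\<in>B. mdist m x y \<le> K)"
  by (simp add: Metric_space.mbounded_alt)

lemma mbounded_of_subset: "\<lbrakk>mbounded_of m T; S \<subseteq> T\<rbrakk> \<Longrightarrow> mbounded_of m S"
  by (meson Metric_space.mbounded_subset Metric_space_mspace_mdist)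

lemma mbounded_of_subset_mspace: "mbounded_of m T \<Longrightarrow> T \<subseteq> mspace m"
  by (simp add: mbounded_of_iff)

lemma mbounded_of_nbhd:
  assumes "mbounded_of m A" shows "mbounded_of m (nbhd m A r)"
proof -
  obtain K where K: "\<forall>x\<in>A. \<forall>y\<in>A. mdist m x y \<le> K" and A: "A \<subseteq> mspace m"
    using assms by (auto simp: mbounded_of_iff)
  have "mdist m x y \<le> r + (K + r)" if xy: "x \<in> nbhd m A r" "y \<in> nbhd m A r" for x y
  proof -
    obtain a b where ab: "a \<in> A" "b \<in> A" "x \<in> mspace m" "y \<in> mspace m"
      "mdist m a x < r" "mdist m b y < r"
      using xy by (auto simp: nbhd_def)
    then have "a \<in> mspace m" "b \<in> mspace m" using A by auto
    then have "mdist m x y \<le> mdist m a x + (mdist m a b + mdist m b y)"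
      using ab(3,4) mdist_le_via(2)[of x m a y] mdist_le_via(1)[of a m b y] by linarith
    moreover have "mdist m a b \<le> K" using K ab by blast
    ultimately show ?thesis using ab by linarith
  qed
  then have "\<forall>x\<in>nbhd m A r. \<forall>y\<in>nbhd m A r. mdist m x y \<le> r + (K + r)" by simp
  then show ?thesis unfolding mbounded_of_iff using nbhd_subset_mspace[of m A r] by auto
qed

lemma in_mclosure:
  "x \<in> mclosure m A \<longleftrightarrow> x \<in> mspace m \<and> (\<forall>r>0. \<exists>y\<in>A. y \<in> mspace m \<and> mdist m x y < r)"
  unfolding mtopology_of_def Metric_space.metric_closure_of[OF Metric_space_mspace_mdist]
  by (auto simp: Metric_space.in_mball[OF Metric_space_mspace_mdist] Bex_def)

lemma mclosure_extensive: "A \<subseteq> mspace m \<Longrightarrow> A \<subseteq> mclosure m A"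
  by (simp add: closure_of_subset)

lemma mclosure_in_hyperspace:
  assumes "mbounded_of m A" "A \<noteq> {}"
  shows "mclosure m A \<in> closed_bounded_nonempty m"
proof -
  have A: "A \<subseteq> mspace m" using assms by (simp add: mbounded_of_iff)
  have "mbounded_of m (mclosure m A)"
    using assms(1) by (simp add: Metric_space.mbounded_closure_of mtopology_of_def)
  then show ?thesis
    using mclosure_extensive[OF A] assms(2)
    by (auto simp: closed_bounded_nonempty_def closed_nonempty_def)
qed

lemma hyperspace_memD:
  assumes "A \<in> closed_bounded_nonempty m"
  shows "A \<subseteq> mspace m" "A \<noteq> {}" "mbounded_of m A" "mclosure m A = A"
proof -
  have A: "closedin (mtopology_of m) A" "A \<noteq> {}" "mbounded_of m A"
    using assms by (auto simp: closed_bounded_nonempty_def closed_nonempty_def)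
  then show "A \<subseteq> mspace m" "A \<noteq> {}" "mbounded_of m A" "mclosure m A = A"
    using closedin_subset[OF A(1)] by (simp_all add: closure_of_closedin)
qed

lemma near_to_if_Hausdorff_less:
  assumes A: "A \<in> closed_bounded_nonempty m" and B: "B \<in> closed_bounded_nonempty m"
    and less: "mdist (bounded_hyperspace m) A B < r"
  shows "near_to m r A B"
  unfolding near_to_def
proof
  fix x assume x: "x \<in> A"
  have "hausdorff_dist m B A < ennreal r"
    using less hausdorff_dist_finite[OF A B]
    by (simp add: mdist_bounded_hyperspace hausdorff_dist_commute[of m B A] enn2real_less_iff)
  then have "point_dist m x B < ennreal r"
    using point_dist_le_hausdorff_dist[OF x, of m B] by (rule le_less_trans[rotated])
  then obtain y where "y \<in> B" "ennreal (mdist m x y) < ennreal r"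
    unfolding point_dist_def by (auto simp: INF_less_iff)
  then show "\<exists>y\<in>B. mdist m x y < r"
    by (auto simp: ennreal_less_iff)
qed

text \<open>
  Stated for closures of arbitrary sets because the joins in the hyperspace are closures of unions.
\<close>

lemma Hausdorff_closures_le:
  assumes A: "mbounded_of m A" "A \<noteq> {}" and B: "mbounded_of m B" "B \<noteq> {}"
    and AB: "near_to m r A B" and BA: "near_to m r B A"
  shows "mdist (bounded_hyperspace m) (mclosure m A) (mclosure m B) \<le> r"
proof -
  have one: "point_dist m x (mclosure m D) \<le> ennreal r"
    if "mbounded_of m C" "mbounded_of m D" and near: "near_to m r C D" and x: "x \<in> mclosure m C" for C D x
  proof (rule ennreal_le_epsilon)
    fix e :: real assume "e > 0"
    have CD: "C \<subseteq> mspace m" "D \<subseteq> mspace m" using that by (auto simp: mbounded_of_iff)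
    obtain c where c: "c \<in> C" "mdist m x c < e" "x \<in> mspace m"
      using x \<open>e > 0\<close> unfolding in_mclosure by auto
    obtain y where y: "y \<in> D" "mdist m c y < r"
      using c near unfolding near_to_def by blast
    have "mdist m x y \<le> r + e"
      using c y CD mdist_triangle[of x m c y] by (auto simp: subset_iff)
    moreover have "r > 0" using y(2) mdist_nonneg[of m c y] by linarith
    ultimately have "ennreal (mdist m x y) \<le> ennreal r + ennreal e"
      using \<open>e > 0\<close> by (simp flip: ennreal_plus)
    moreover have "y \<in> mclosure m D" using y CD mclosure_extensive by blast
    ultimately show "point_dist m x (mclosure m D) \<le> ennreal r + ennreal e"
      unfolding point_dist_def by (meson INF_lower2)
  qed
  have "hausdorff_dist m (mclosure m A) (mclosure m B) \<le> ennreal r"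
    unfolding hausdorff_dist_def
    by (intro max.boundedI SUP_least) (use one assms in blast)+
  moreover have "r \<ge> 0"
  proof -
    obtain x y where "mdist m x y < r" using A(2) AB unfolding near_to_def by blast
    then show ?thesis using mdist_nonneg[of m x y] by linarith
  qed
  ultimately show ?thesis
    by (simp add: mdist_bounded_hyperspace enn2real_leI)
qed

lemma closed_isometric_embeddingD:
  assumes "closed_isometric_embedding Z N e"
  shows "\<lbrakk>x \<in> mspace Z; y \<in> mspace Z\<rbrakk> \<Longrightarrow> mdist N (e x) (e y) = mdist Z x y"
    "closedin (mtopology_of N) (e ` mspace Z)" "e ` mspace Z \<subseteq> mspace N" "inj_on e (mspace Z)"
proof -
  show iso: "mdist N (e x) (e y) = mdist Z x y" if "x \<in> mspace Z" "y \<in> mspace Z" for x y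
    using assms that by (simp add: closed_isometric_embedding_def)
  show "closedin (mtopology_of N) (e ` mspace Z)"
    using assms by (simp add: closed_isometric_embedding_def)
  from closedin_subset[OF this] show eN: "e ` mspace Z \<subseteq> mspace N" by simp
  show "inj_on e (mspace Z)"
  proof (rule inj_onI)
    fix x y assume xy: "x \<in> mspace Z" "y \<in> mspace Z" "e x = e y"
    then have "e y \<in> mspace N" using eN by blast
    then have "mdist Z x y = 0" using iso[of x y] xy by simp
    then show "x = y" using xy by simp
  qed
qed

section \<open>Paths of sets and chains of points\<close>

text \<open>
  All that is used of an absolute neighbourhood retract on the side of necessity: nearby points are
  joined by small paths.
\<close>

definition locally_joinable :: "'z metric \<Rightarrow> bool" where
  "locally_joinable Z \<longleftrightarrow> (\<forall>a\<in>mspace Z. \<forall>\<epsilon>>0. \<exists>\<delta>>0. \<forall>b\<in>mspace Z. \<forall>c\<in>mspace Z.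
     mdist Z a b < \<delta> \<and> mdist Z a c < \<delta> \<longrightarrow>
       (\<exists>\<gamma>. pathin (mtopology_of Z) \<gamma> \<and> \<gamma> 0 = b \<and> \<gamma> 1 = c \<and> (\<forall>t\<in>{0..1}. mdist Z a (\<gamma> t) < \<epsilon>)))"

text \<open>
  The trace that paths between sets close to \<open>A\<close> leave in the underlying space. One \<open>n\<close> serves all points of
  \<open>F\<close> because a path is uniformly continuous.
\<close>

abbreviation chained_around :: "'a metric \<Rightarrow> 'a set \<Rightarrow> real \<Rightarrow> 'a set \<Rightarrow> bool" where
  "chained_around m A \<delta> W \<equiv> (\<forall>E F. E \<subseteq> mspace m \<and> F \<subseteq> mspace m \<and> near_to m \<delta> A E \<and> near_to m \<delta> E A \<and>
     near_to m \<delta> A F \<and> near_to m \<delta> F A \<longrightarrow> (\<forall>\<eta>>0. \<exists>n. \<forall>y\<in>F. \<exists>x\<in>E. chain m \<eta> n W x y))"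

text \<open>
  Here \<open>\<delta>\<close> may depend on \<open>A\<close>. To pass to a \<open>\<delta>\<close> that serves all points of a bounded set is the main
  difficulty on the side of necessity.
\<close>

definition close_sets_chained :: "'a metric \<Rightarrow> bool" where
  "close_sets_chained m \<longleftrightarrow> (\<forall>A. mbounded_of m A \<and> A \<noteq> {} \<longrightarrow>
     (\<forall>\<epsilon>>0. \<exists>\<delta>>0. chained_around m A \<delta> (nbhd m A \<epsilon>)))"

text \<open>
  The order of the quantifiers is what matters: one number \<open>n\<close> of steps, depending on the step
  size alone, serves all pairs of points.
\<close>

definition equireach :: "'a metric \<Rightarrow> 'a set \<Rightarrow> real \<Rightarrow> real \<Rightarrow> bool" where
  "equireach m B r e \<longleftrightarrow> (\<forall>\<eta>>0. \<exists>n. \<forall>x\<in>B. \<forall>y\<in>mspace m. mdist m x y < r \<longrightarrow>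
     chain m \<eta> n (mball_of m x e) x y)"

definition equichained :: "'a metric \<Rightarrow> 'a set \<Rightarrow> real \<Rightarrow> bool" where
  "equichained m S \<epsilon> \<longleftrightarrow> (\<exists>\<delta>>0. equireach m S \<delta> \<epsilon>)"

definition locally_equichained :: "'a metric \<Rightarrow> bool" where
  "locally_equichained m \<longleftrightarrow> (\<forall>B. mbounded_of m B \<longrightarrow> (\<forall>\<epsilon>>0. equichained m B \<epsilon>))"

text \<open>
  Divide the unit interval so finely that consecutive sets of the path are \<open>\<eta>\<close>-close. Any point of the
  last set can then be traced back to the first one with one step per subinterval.
\<close>

lemma path_of_sets_yields_chains:
  assumes \<gamma>: "pathin (mtopology_of (bounded_hyperspace m)) \<gamma>"
    and W: "\<And>t. t \<in> {0..1} \<Longrightarrow> \<gamma> t \<subseteq> W" and \<eta>: "\<eta> > 0"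
  shows "\<exists>n. \<forall>y\<in>\<gamma> 1. \<exists>x\<in>\<gamma> 0. chain m \<eta> n W x y"
proof -
  let ?I = "submetric euclidean_metric {0..1::real}"
  have "uniformly_continuous_map ?I (bounded_hyperspace m) \<gamma>"
    using \<gamma> by (intro continuous_imp_uniformly_continuous_map)
      (simp add: mtopology_of_submetric pathin_def compact_space_subtopology)
  then obtain \<delta> where mem: "\<And>t. t \<in> {0..1} \<Longrightarrow> \<gamma> t \<in> closed_bounded_nonempty m" and "\<delta> > 0"
    and \<delta>: "\<And>s t. \<lbrakk>s \<in> {0..1}; t \<in> {0..1}; dist s t < \<delta>\<rbrakk> \<Longrightarrow> mdist (bounded_hyperspace m) (\<gamma> s) (\<gamma> t) < \<eta>"
    using \<eta> unfolding uniformly_continuous_map_def by (auto simp: Pi_iff)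
  obtain n where n: "n > 0" "1 / real n < \<delta>"
    using \<open>\<delta> > 0\<close> by (metis nat_approx_posE of_nat_0_less_iff zero_less_Suc)
  have "k \<le> n \<Longrightarrow> \<forall>y\<in>\<gamma> (k / n). \<exists>x\<in>\<gamma> 0. chain m \<eta> k W x y" for k
  proof (induction k)
    case 0
    then show ?case using W[of 0] by (auto simp: chain_def intro!: exI[of _ "\<lambda>_. _"])
  next
    case (Suc k)
    have kn: "real k / n \<in> {0..1}" "real (Suc k) / n \<in> {0..1}" using Suc.prems n by auto
    have "dist (real (Suc k) / n) (real k / n) < \<delta>"
      using n by (simp add: dist_real_def diff_divide_distrib[symmetric])
    then have "near_to m \<eta> (\<gamma> (Suc k / n)) (\<gamma> (k / n))"
      using kn by (intro near_to_if_Hausdorff_less mem \<delta>) auto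
    show ?case
    proof
      fix y assume y: "y \<in> \<gamma> (real (Suc k) / n)"
      then obtain z where z: "z \<in> \<gamma> (k / n)" "mdist m y z < \<eta>"
        using \<open>near_to m \<eta> _ _\<close> unfolding near_to_def by blast
      obtain x where "x \<in> \<gamma> 0" "chain m \<eta> k W x z" using Suc z by auto
      moreover have "chain m \<eta> 1 W z y"
        using z y W[OF kn(1)] W[OF kn(2)] by (intro chain_step) (auto simp: mdist_commute)
      ultimately show "\<exists>x\<in>\<gamma> 0. chain m \<eta> (Suc k) W x y"
        using chain_trans by (metis Suc_eq_plus1)
    qed
  qed
  from this[of n] show ?thesis using n by auto
qed

lemma near_to_bounded:
  assumes "mbounded_of m A" "near_to m r E A" "E \<subseteq> mspace m" shows "E \<subseteq> nbhd m A r" "mbounded_of m E"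
proof -
  show "E \<subseteq> nbhd m A r"
    using assms mbounded_of_subset_mspace[OF assms(1)]
    unfolding near_to_def nbhd_def by (fastforce simp: mdist_commute)
  then show "mbounded_of m E"
    using mbounded_of_nbhd[OF assms(1)] mbounded_of_subset by blast
qed

lemma nbhd_mono: "r \<le> s \<Longrightarrow> nbhd m A r \<subseteq> nbhd m A s"
  by (fastforce simp: nbhd_def)

lemma nbhd_closure_subset:
  assumes "near_to m r E (mclosure m A)" "A \<subseteq> mspace m" "E \<subseteq> mspace m"
  shows "E \<subseteq> nbhd m A r"
proof
  fix u assume u: "u \<in> E"
  then obtain a where a: "a \<in> mclosure m A" "mdist m u a < r"
    using assms(1) unfolding near_to_def by blast
  then have "r - mdist m u a > 0" by simp
  then obtain b where b: "b \<in> A" "mdist m a b < r - mdist m u a" and "a \<in> mspace m"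
    using a(1) unfolding in_mclosure by blast
  moreover have "u \<in> mspace m" "b \<in> mspace m" using u b assms by auto
  ultimately have "mdist m u b < r"
    using mdist_le_via(1)[of u m a b] by auto
  then show "u \<in> nbhd m A r"
    using b u assms by (auto simp: nbhd_def mdist_commute)
qed

lemma locally_joinable_hyperspace_close_sets_chained:
  assumes joinable: "locally_joinable (bounded_hyperspace m)"
  shows "close_sets_chained m"
  unfolding close_sets_chained_def
proof (intro allI impI, elim conjE)
  fix A and \<epsilon> :: real assume A: "mbounded_of m A" "A \<noteq> {}" and "\<epsilon> > 0"
  have Am: "A \<subseteq> mspace m" using A by (simp add: mbounded_of_iff)
  obtain \<delta> where "\<delta> > 0" and \<delta>: "\<And>B C. \<lbrakk>B \<in> closed_bounded_nonempty m; C \<in> closed_bounded_nonempty m;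
     mdist (bounded_hyperspace m) (mclosure m A) B < \<delta>; mdist (bounded_hyperspace m) (mclosure m A) C < \<delta>\<rbrakk>
     \<Longrightarrow> \<exists>\<gamma>. pathin (mtopology_of (bounded_hyperspace m)) \<gamma> \<and> \<gamma> 0 = B \<and> \<gamma> 1 = C \<and>
       (\<forall>t\<in>{0..1}. mdist (bounded_hyperspace m) (mclosure m A) (\<gamma> t) < \<epsilon>)"
    using joinable[unfolded locally_joinable_def mspace_bounded_hyperspace, rule_format,
        OF mclosure_in_hyperspace[OF A] \<open>\<epsilon> > 0\<close>] by (elim exE conjE) blast
  show "\<exists>\<delta>>0. chained_around m A \<delta> (nbhd m A \<epsilon>)"
  proof (intro exI[of _ "min (\<delta>/2) \<epsilon>"] conjI allI impI, goal_cases)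
    case 1 then show ?case using \<open>\<delta> > 0\<close> \<open>\<epsilon> > 0\<close> by simp
  next
    case (2 E F \<eta>)
    let ?r = "min (\<delta>/2) \<epsilon>"
    have closure: "mclosure m G \<in> closed_bounded_nonempty m"
      "mdist (bounded_hyperspace m) (mclosure m A) (mclosure m G) < \<delta>"
      if "near_to m ?r A G" "near_to m ?r G A" "G \<subseteq> mspace m" for G
    proof -
      have G: "mbounded_of m G" "G \<noteq> {}"
        using near_to_bounded[OF A(1) that(2,3)] that(1) A(2) by (auto simp: near_to_def)
      then show "mclosure m G \<in> closed_bounded_nonempty m" by (rule mclosure_in_hyperspace)
      show "mdist (bounded_hyperspace m) (mclosure m A) (mclosure m G) < \<delta>"
        using Hausdorff_closures_le[OF A G that(1,2)] \<open>\<delta> > 0\<close> by simp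
    qed
    obtain \<gamma> where \<gamma>: "pathin (mtopology_of (bounded_hyperspace m)) \<gamma>" "\<gamma> 0 = mclosure m E" "\<gamma> 1 = mclosure m F"
       "\<forall>t\<in>{0..1}. mdist (bounded_hyperspace m) (mclosure m A) (\<gamma> t) < \<epsilon>"
      using \<delta>[OF closure(1)[of E] closure(1)[of F] closure(2)[of E] closure(2)[of F]] 2 by auto
    have "\<gamma> t \<subseteq> nbhd m A \<epsilon>" if t: "t \<in> {0..1}" for t
    proof -
      have mem: "\<gamma> t \<in> closed_bounded_nonempty m"
        using \<gamma>(1) t unfolding pathin_def continuous_map_def by (auto simp: Pi_iff)
      then have "near_to m \<epsilon> (\<gamma> t) (mclosure m A)"
        using \<gamma>(4) t mclosure_in_hyperspace[OF A]
        by (intro near_to_if_Hausdorff_less) (auto simp: mdist_commute)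
      then show ?thesis using nbhd_closure_subset Am hyperspace_memD(1)[OF mem] by blast
    qed
    then obtain n where n: "\<forall>y\<in>mclosure m F. \<exists>x\<in>mclosure m E. chain m \<eta> n (nbhd m A \<epsilon>) x y"
      using path_of_sets_yields_chains[OF \<gamma>(1) _ \<open>\<eta> > 0\<close>, of "nbhd m A \<epsilon>"] \<gamma>(2,3) by metis
    have E: "E \<subseteq> nbhd m A \<epsilon>"
      using near_to_bounded(1)[OF A(1), of ?r E] 2 nbhd_mono[of ?r \<epsilon> m A] by auto
    have "\<exists>x\<in>E. chain m \<eta> (1 + n) (nbhd m A \<epsilon>) x y" if "y \<in> F" for y
    proof -
      have "y \<in> mclosure m F" using that 2 mclosure_extensive by blast
      then obtain x where x: "x \<in> mclosure m E" "chain m \<eta> n (nbhd m A \<epsilon>) x y" using n by blast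
      then obtain x' where x': "x' \<in> E" "mdist m x x' < \<eta>"
        using \<open>\<eta> > 0\<close> unfolding in_mclosure by blast
      then have "chain m \<eta> 1 (nbhd m A \<epsilon>) x' x"
        using E chain_endpoints[OF x(2)] by (intro chain_step) (auto simp: mdist_commute)
      then show ?thesis using chain_trans[OF _ x(2)] x'(1) by blast
    qed
    then show ?case by blast
  qed
qed

text \<open>
  For a separated set \<open>S\<close> the uniformity is immediate. Apply the chain condition to \<open>S\<close> and to the
  union of the \<open>\<delta>\<close>-balls around its points. Chains that stay close to \<open>S\<close> with steps short against the
  separation never change from one ball to another, so the chain ending near \<open>x\<close> also starts at \<open>x\<close>.
\<close>

lemma separated_sets_equichained:
  assumes chained: "close_sets_chained m" and S: "mbounded_of m S"
    and sep: "\<And>x y. \<lbrakk>x \<in> S; y \<in> S; x \<noteq> y\<rbrakk> \<Longrightarrow> r \<le> mdist m x y" and "r > 0" "\<epsilon> > 0"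
  shows "equichained m S \<epsilon>"
proof (cases "S = {}")
  case False
  define e where "e = min \<epsilon> (r/4)"
  have "e > 0" using assms by (simp add: e_def)
  have Sm: "S \<subseteq> mspace m" using S by (simp add: mbounded_of_iff)
  obtain \<delta>0 where "\<delta>0 > 0" and \<delta>0: "chained_around m S \<delta>0 (nbhd m S e)"
    using chained[unfolded close_sets_chained_def, rule_format, OF conjI, OF S False \<open>e > 0\<close>]
    by (elim exE conjE) rule
  define \<delta> where "\<delta> = min \<delta>0 (r/4)"
  have "\<delta> > 0" using \<open>\<delta>0 > 0\<close> \<open>r > 0\<close> by (simp add: \<delta>_def)
  let ?F = "nbhd m S \<delta>"
  have "near_to m \<delta>0 S S" using Sm \<open>\<delta>0 > 0\<close> by (force simp: near_to_def)
  moreover have "near_to m \<delta>0 S ?F"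
    using Sm \<open>\<delta>0 > 0\<close> \<open>\<delta> > 0\<close> by (force simp: near_to_def nbhd_def)
  moreover have "near_to m \<delta>0 ?F S"
    unfolding near_to_def nbhd_def by (clarsimp simp: \<delta>_def) (metis mdist_commute)
  ultimately have reach: "\<forall>\<eta>>0. \<exists>n. \<forall>y\<in>?F. \<exists>x\<in>S. chain m \<eta> n (nbhd m S e) x y"
    using Sm nbhd_subset_mspace[of m S \<delta>] \<delta>0[THEN spec[of _ S], THEN spec[of _ "nbhd m S \<delta>"]] by blast
  \<comment> \<open>steps shorter than r/4 cannot leave the ball around a point of S\<close>
  have stay: "chain m \<eta> n (mball_of m x e) x y"
    if c: "chain m \<eta> n (nbhd m S e) x y" and x: "x \<in> S" and "\<eta> \<le> r/4" for x y \<eta> n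
  proof -
    obtain c where c: "c 0 = x" "c n = y" "\<forall>i\<le>n. c i \<in> nbhd m S e"
      "\<forall>i<n. mdist m (c i) (c (Suc i)) < \<eta>"
      using c unfolding chain_def by blast
    have "i \<le> n \<Longrightarrow> c i \<in> mball_of m x e" for i
    proof (induction i)
      case 0 then show ?case using c x Sm \<open>e > 0\<close> by auto
    next
      case (Suc i)
      then obtain x' where x': "x' \<in> S" "c (Suc i) \<in> mball_of m x' e"
        using c(3) by (auto simp: nbhd_def)
      have "mdist m (c i) (c (Suc i)) < \<eta>" using c(4) Suc.prems by auto
      then have "mdist m (c i) (c (Suc i)) < r/4" using \<open>\<eta> \<le> r/4\<close> by linarith
      moreover have "mdist m x (c i) < r/4" "mdist m x' (c (Suc i)) < r/4"
        using Suc x' by (auto simp: e_def)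
      ultimately have "mdist m x x' < r"
        using Suc x' mdist_le_via(3)[of x m "c (Suc i)" x'] mdist_le_via(1)[of x m "c i" "c (Suc i)"]
          \<open>r > 0\<close> by auto
      then have "x' = x" using sep[of x x'] x x' by force
      then show ?case using x' by simp
    qed
    then show ?thesis unfolding chain_def using c by blast
  qed
  show ?thesis unfolding equichained_def equireach_def
  proof (intro exI[of _ \<delta>] conjI allI impI \<open>\<delta> > 0\<close>)
    fix \<eta> :: real assume "\<eta> > 0"
    then have "min \<eta> (r/4) > 0" using \<open>r > 0\<close> by simp
    then obtain n where n: "\<forall>y\<in>?F. \<exists>x\<in>S. chain m (min \<eta> (r/4)) n (nbhd m S e) x y"
      using reach by blast
    have "chain m \<eta> n (mball_of m x \<epsilon>) x y" if "x \<in> S" "y \<in> mspace m" "mdist m x y < \<delta>" for x y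
    proof -
      have "y \<in> ?F" using that Sm by (auto simp: nbhd_def)
      then obtain x' where x': "x' \<in> S" "chain m (min \<eta> (r/4)) n (nbhd m S e) x' y" using n by blast
      then have ch: "chain m (min \<eta> (r/4)) n (mball_of m x' e) x' y" by (intro stay) auto
      then have "mdist m x' y < r/4" using chain_endpoints[OF ch] by (auto simp: e_def)
      moreover have "mdist m x y < r/4" using that by (simp add: \<delta>_def)
      ultimately have "mdist m x x' < r"
        using mdist_le_via(3)[of x m y x'] that x' subsetD[OF Sm] \<open>r > 0\<close> by force
      then have "x' = x" using sep[of x x'] that x' by force
      then show ?thesis
        using chain_weaken[OF ch, of \<eta> "mball_of m x \<epsilon>"] by (simp add: e_def subset_iff)
    qed
    then show "\<exists>n. \<forall>x\<in>S. \<forall>y\<in>mspace m. mdist m x y < \<delta> \<longrightarrow> chain m \<eta> n (mball_of m x \<epsilon>) x y"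
      by blast
  qed
qed (auto simp: equichained_def equireach_def intro: exI[of _ 1])

text \<open>
  The first case in the proof by contradiction that equichainedness holds on bounded sets. Row \<open>k\<close>
  lists pairs at distance below \<open>1 / (k + 1)\<close> that need more and more steps of size \<open>\<eta> k\<close>. If infinitely
  many rows have infinite parts that are separated by the same \<open>\<rho>\<close>, a diagonal choice meets
  every such row infinitely often and is still separated by \<open>\<rho> / 2\<close>, since a point can be too close to at most
  one entry of a separated row. This contradicts \<open>separated_sets_equichained\<close>.
\<close>

lemma no_bad_separated_rows:
  assumes chained: "close_sets_chained m" and B: "mbounded_of m B" and "\<epsilon> > 0" "\<rho> > 0"
    and x: "\<And>k n. x k n \<in> B" and y: "\<And>k n. y k n \<in> mspace m"
    and close: "\<And>k n. mdist m (x k n) (y k n) < 1 / (real k + 1)" and \<eta>: "\<And>k. \<eta> k > 0"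
    and bad: "\<And>k n. \<not> chain m (\<eta> k) n (mball_of m (x k n) \<epsilon>) (x k n) (y k n)"
    and K: "infinite K" and I: "\<And>k. k \<in> K \<Longrightarrow> infinite (I k)"
    and sep: "\<And>k i j. \<lbrakk>k \<in> K; i \<in> I k; j \<in> I k; i \<noteq> j\<rbrakk> \<Longrightarrow> \<rho> \<le> mdist m (x k i) (x k j)"
  shows False
proof -
  have Bm: "B \<subseteq> mspace m" using B by (simp add: mbounded_of_iff)
  \<comment> \<open>task number \<open>j\<close> encodes a row and a lower bound on the index of the entry to be chosen from it\<close>
  define row where "row j = enumerate K (fst (prod_decode j))" for j
  define P where "P f j n \<longleftrightarrow> n \<in> I (row j) \<and> snd (prod_decode j) \<le> n \<and>
      (\<forall>i<j. \<rho> / 2 \<le> mdist m (x (row j) n) (x (row i) (f i)))" for f j n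
  have row: "row j \<in> K" for j unfolding row_def using K by (rule enumerate_in_set)
  have "\<exists>n. P f j n" for f j
  proof -
    define T where "T i = {n \<in> I (row j). mdist m (x (row j) n) (x (row i) (f i)) < \<rho> / 2}" for i
    have "finite (T i)" for i
    proof (cases "T i = {}")
      case False
      then obtain n where n: "n \<in> T i" by blast
      have "n' = n" if "n' \<in> T i" for n'
      proof (rule ccontr)
        assume "n' \<noteq> n"
        then have "\<rho> \<le> mdist m (x (row j) n') (x (row j) n)"
          using sep[OF row] n that by (auto simp: T_def)
        moreover have "mdist m (x (row j) n') (x (row j) n) < \<rho>"
          using n that mdist_le_via(3)[of "x (row j) n'" m "x (row i) (f i)" "x (row j) n"] x Bm
          by (auto simp: T_def subset_iff)
        ultimately show False by simp
      qed
      then have "T i \<subseteq> {n}" by blast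
      then show ?thesis using finite_subset by blast
    qed simp
    then have "finite ((\<Union>i<j. T i) \<union> {..<snd (prod_decode j)})" by blast
    then have "I (row j) - ((\<Union>i<j. T i) \<union> {..<snd (prod_decode j)}) \<noteq> {}"
      using I[OF row] by (metis Diff_infinite_finite infinite_imp_nonempty)
    then show ?thesis by (auto simp: P_def T_def not_less)
  qed
  then have "\<exists>f. \<forall>j. P f j (f j)"
    by (intro dependent_wellorder_choice) (auto simp: P_def)
  then obtain f where f: "\<And>j. P f j (f j)" by blast
  define S where "S = range (\<lambda>j. x (row j) (f j))"
  have far: "\<rho> / 2 \<le> mdist m (x (row i) (f i)) (x (row j) (f j))" if "i \<noteq> j" for i j
  proof (cases "i < j")
    case True
    then show ?thesis using f[of j] unfolding P_def by (metis mdist_commute)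
  next
    case False
    then show ?thesis using f[of i] that unfolding P_def by (metis linorder_neqE_nat)
  qed
  have "equichained m S \<epsilon>"
  proof (rule separated_sets_equichained[OF chained, where r = "\<rho>/2"])
    show "mbounded_of m S" using B by (rule mbounded_of_subset) (auto simp: S_def x)
    fix a b assume "a \<in> S" "b \<in> S" "a \<noteq> b"
    then obtain i j where "a = x (row i) (f i)" "b = x (row j) (f j)" "i \<noteq> j" unfolding S_def by blast
    then show "\<rho> / 2 \<le> mdist m a b" using far by simp
  qed (use assms in auto)
  then obtain \<delta> where "\<delta> > 0" and \<delta>: "\<And>\<eta>. \<eta> > 0 \<Longrightarrow> \<exists>n. \<forall>x\<in>S. \<forall>y\<in>mspace m. mdist m x y < \<delta> \<longrightarrow>
     chain m \<eta> n (mball_of m x \<epsilon>) x y" unfolding equichained_def equireach_def by blast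
  obtain N where N: "1 / (real N + 1) < \<delta>"
    using \<open>\<delta> > 0\<close> nat_approx_posE by (metis of_nat_Suc add.commute)
  define k where "k = enumerate K N"
  have "N \<le> k" using K by (simp add: k_def le_enumerate)
  then have k: "1 / (real k + 1) < \<delta>"
    using N by (smt (verit) frac_le of_nat_mono of_nat_0_le_iff)
  obtain n where n: "\<forall>x\<in>S. \<forall>y\<in>mspace m. mdist m x y < \<delta> \<longrightarrow> chain m (\<eta> k) n (mball_of m x \<epsilon>) x y"
    using \<delta>[OF \<eta>] by blast
  define j where "j = prod_encode (N, n)"
  have j: "row j = k" "n \<le> f j" using f[of j] by (auto simp: row_def k_def j_def P_def)
  have "x k (f j) \<in> S" using j by (auto simp: S_def)
  moreover have "mdist m (x k (f j)) (y k (f j)) < \<delta>" using close[of k "f j"] k by simp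
  ultimately have "chain m (\<eta> k) n (mball_of m (x k (f j)) \<epsilon>) (x k (f j)) (y k (f j))"
    using n y by blast
  then have "chain m (\<eta> k) (f j) (mball_of m (x k (f j)) \<epsilon>) (x k (f j)) (y k (f j))"
    using j(2) mball_of_subset_mspace \<eta> by (rule chain_lengthen)
  then show False using bad by blast
qed

text \<open>
  The second case: shrinking clusters \<open>V j\<close> around a Cauchy sequence \<open>p\<close> with no common bound on
  the number of steps of size \<open>\<eta> j\<close> within \<open>V j\<close>. At step size \<open>\<eta> j\<close> the sequence \<open>p\<close> is essentially
  finite, because its tail is one cluster. Adding \<open>V j\<close> to the set of all \<open>p i\<close> is a small change,
  so every point of \<open>V j\<close> is a bounded number of steps away from these finitely many points. Therefore
  some \<open>v j\<close> in \<open>V j\<close> cannot be chained to the tail at all; otherwise the lengths would be bounded.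
  Along a sparse subsequence the points \<open>v j\<close> are then pairwise not chained at the step sizes that
  belong to them, although removing one late \<open>v j\<close> from the set of all of them is a small change.
\<close>

lemma no_bad_Cauchy_clusters:
  fixes p :: "nat \<Rightarrow> 'a"
  assumes chained: "close_sets_chained m" and "\<epsilon> > 0"
    and p: "\<And>i. p i \<in> mspace m" "\<And>i j. mdist m (p i) (p j) < \<epsilon> / 8"
    and Cauchy: "\<And>e. e > 0 \<Longrightarrow> \<exists>L. \<forall>i\<ge>L. \<forall>j\<ge>L. mdist m (p i) (p j) < e"
    and V: "\<And>j. V j \<subseteq> mball_of m (p j) (r j)"
    and r: "\<And>j. r j \<le> \<epsilon> / 8" "\<And>e. e > 0 \<Longrightarrow> \<exists>L. \<forall>j\<ge>L. r j < e"
    and \<eta>: "\<And>j. \<eta> j > 0" "\<And>i j. i \<le> j \<Longrightarrow> \<eta> j \<le> \<eta> i"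
    and bad: "\<And>j n. \<exists>v\<in>V j. \<exists>w\<in>V j. \<not> chain m (\<eta> j) n (mball_of m (p 0) (\<epsilon> / 2)) v w"
  shows False
proof -
  let ?W = "mball_of m (p 0) (\<epsilon> / 2)"
  have Wm: "?W \<subseteq> mspace m" by auto
  have Vp: "v \<in> mspace m" "mdist m (p j) v < r j" "mdist m (p 0) v < \<epsilon> / 4" if "v \<in> V j" for v j
  proof -
    show 1: "v \<in> mspace m" "mdist m (p j) v < r j" using V[of j] that by auto
    show "mdist m (p 0) v < \<epsilon> / 4"
      using mdist_le_via(1)[OF p(1)[of 0] p(1)[of j] 1(1)] 1 r(1)[of j] p(2)[of 0 j] by linarith
  qed
  have pW: "p i \<in> ?W" for i using p(1)[of 0] p(1)[of i] p(2)[of 0 i] \<open>\<epsilon> > 0\<close> by auto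
  have VW: "v \<in> ?W" if "v \<in> V j" for v j
    using Vp[OF that] p(1)[of 0] \<open>\<epsilon> > 0\<close> by auto
  have nbhdW: "nbhd m A (\<epsilon> / 8) \<subseteq> ?W" if A: "\<And>a. a \<in> A \<Longrightarrow> a \<in> mspace m \<and> mdist m (p 0) a < \<epsilon> / 4" for A
  proof
    fix u assume "u \<in> nbhd m A (\<epsilon> / 8)"
    then obtain a where "a \<in> A" "u \<in> mspace m" "mdist m a u < \<epsilon> / 8" by (auto simp: nbhd_def)
    then show "u \<in> ?W"
      using A[of a] mdist_le_via(1)[of "p 0" m a u] p(1)[of 0] \<open>\<epsilon> > 0\<close> by auto
  qed
  have boundedW: "mbounded_of m A" if "A \<subseteq> ?W" for A
    using that by (metis Metric_space.mbounded_mball Metric_space_mspace_mdist mball_of_def mbounded_of_subset)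
  have cluster: "\<exists>\<delta>>0. chained_around m A \<delta> ?W"
    if A: "\<And>a. a \<in> A \<Longrightarrow> a \<in> mspace m \<and> mdist m (p 0) a < \<epsilon> / 4" and "A \<noteq> {}" for A
  proof -
    have "A \<subseteq> ?W" using A p(1)[of 0] \<open>\<epsilon> > 0\<close> by fastforce
    then have *: "mbounded_of m A" by (rule boundedW)
    obtain \<delta> where "\<delta> > 0" and \<delta>: "chained_around m A \<delta> (nbhd m A (\<epsilon>/8))"
      using chained[unfolded close_sets_chained_def, rule_format, OF conjI, OF * \<open>A \<noteq> {}\<close>, of "\<epsilon>/8"] \<open>\<epsilon> > 0\<close>
      by auto
    show ?thesis
    proof (intro exI[of _ \<delta>] conjI allI impI, rule \<open>\<delta> > 0\<close>, goal_cases)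
      case (1 E F \<eta>)
      then obtain n where "\<forall>y\<in>F. \<exists>x\<in>E. chain m \<eta> n (nbhd m A (\<epsilon>/8)) x y" using \<delta> by blast
      then show ?case using chain_weaken[OF _ order_refl nbhdW[OF A]] by meson
    qed
  qed

  obtain L where L: "\<And>j i l. \<lbrakk>L j \<le> i; L j \<le> l\<rbrakk> \<Longrightarrow> mdist m (p i) (p l) < \<eta> j"
    using Cauchy[OF \<eta>(1)] by metis
  \<comment> \<open>for late \<open>j\<close> some point of \<open>V j\<close> is not chained to the tail of \<open>p\<close> at step size \<open>\<eta> j\<close>\<close>
  have "\<exists>j0. \<forall>j\<ge>j0. \<exists>v\<in>V j. \<forall>l\<ge>L j. \<forall>n. \<not> chain m (\<eta> j) n ?W v (p l)"
  proof -
    have pc: "a \<in> mspace m \<and> mdist m (p 0) a < \<epsilon> / 4" if a: "a \<in> range p" for a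
    proof -
      obtain i where "a = p i" using a by blast
      then show ?thesis using p(1)[of i] p(2)[of 0 i] \<open>\<epsilon> > 0\<close> by auto
    qed
    obtain \<delta> where "\<delta> > 0" and \<delta>: "chained_around m (range p) \<delta> ?W"
      using cluster[OF pc] by blast
    obtain j0 where j0: "\<And>j. j0 \<le> j \<Longrightarrow> r j < \<delta>" using r(2)[OF \<open>\<delta> > 0\<close>] by blast
    have "\<exists>v\<in>V j. \<forall>l\<ge>L j. \<forall>n. \<not> chain m (\<eta> j) n ?W v (p l)" if "j0 \<le> j" for j
    proof (rule ccontr)
      assume "\<not> ?thesis"
      then have reach: "\<exists>l\<ge>L j. \<exists>n. chain m (\<eta> j) n ?W v (p l)" if "v \<in> V j" for v
        using that by blast
      have "near_to m \<delta> (range p) (range p)"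
        unfolding near_to_def by (intro ballI rev_bexI) (use p(1) \<open>\<delta> > 0\<close> in auto)
      moreover have "near_to m \<delta> (V j) (range p)"
        unfolding near_to_def
      proof (intro ballI rev_bexI)
        show "mdist m v (p j) < \<delta>" if "v \<in> V j" for v
          using Vp(2)[OF that] j0[OF \<open>j0 \<le> j\<close>] by (simp add: mdist_commute)
      qed blast
      ultimately have "near_to m \<delta> (range p) (range p)" "near_to m \<delta> (range p \<union> V j) (range p)"
        "near_to m \<delta> (range p) (range p \<union> V j)"
        unfolding near_to_def by blast+
      moreover have "range p \<union> V j \<subseteq> mspace m" "range p \<subseteq> mspace m" using p(1) Vp(1) by auto
      ultimately obtain n where n: "\<forall>y\<in>range p \<union> V j. \<exists>x\<in>range p. chain m (\<eta> j) n ?W x y"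
        using \<delta>[rule_format, OF _ \<eta>(1)] by meson
      let ?a = "p (L j)"
      have tail: "chain m (\<eta> j) 1 ?W (p l) ?a" if "L j \<le> l" for l
        using L[OF that order_refl] pW by (intro chain_step)
      define k where "k i = (SOME n. chain m (\<eta> j) n ?W (p i) ?a)" for i
      have k: "chain m (\<eta> j) (k i) ?W (p i) ?a" if "chain m (\<eta> j) n ?W (p i) ?a" for i n
        unfolding k_def using that by (rule someI)
      define N where "N = Max (insert 1 (k ` {..L j}))"
      have kN: "k i \<le> N" if "i \<le> L j" for i unfolding N_def using that by (intro Max_ge) auto
      have "1 \<le> N" unfolding N_def by (intro Max_ge) auto
      have all: "chain m (\<eta> j) (N + n) ?W ?a v" if v: "v \<in> V j" for v
      proof -
        obtain i where i: "chain m (\<eta> j) n ?W (p i) v" using n v by blast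
        have "chain m (\<eta> j) N ?W (p i) ?a"
        proof (cases "L j \<le> i")
          case True
          then show ?thesis using chain_lengthen[OF tail \<open>1 \<le> N\<close> Wm \<eta>(1)] by blast
        next
          case False
          obtain l n' where "L j \<le> l" "chain m (\<eta> j) n' ?W v (p l)" using reach[OF v] by blast
          then have "chain m (\<eta> j) (n + n' + 1) ?W (p i) ?a"
            using chain_trans[OF chain_trans[OF i] tail] by blast
          then show ?thesis using k kN[of i] False chain_lengthen[OF _ _ Wm \<eta>(1)] by (meson nat_le_linear)
        qed
        then show ?thesis using chain_trans[OF chain_sym i] by blast
      qed
      then have "chain m (\<eta> j) (N + n + (N + n)) ?W v w" if "v \<in> V j" "w \<in> V j" for v w
        using that chain_trans chain_sym by metis
      then show False using bad[where j = j and n = "N + n + (N + n)"] by blast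
    qed
    then show ?thesis by blast
  qed
  then obtain j0 v where v: "\<And>j. j0 \<le> j \<Longrightarrow> v j \<in> V j"
    and isolated: "\<And>j l n. \<lbrakk>j0 \<le> j; L j \<le> l\<rbrakk> \<Longrightarrow> \<not> chain m (\<eta> j) n ?W (v j) (p l)"
    by metis
  obtain h0 where h0: "\<And>j l. h0 j \<le> l \<Longrightarrow> r l < \<eta> j" using r(2)[OF \<eta>(1)] by metis
  define h where "h j = max (Suc j) (max (h0 j) (L j))" for j
  \<comment> \<open>a subsequence so sparse that later points are within one step of the tail at all earlier step sizes\<close>
  define s where "s = rec_nat j0 (\<lambda>_. h)"
  have s_Suc: "s (Suc i) = h (s i)" for i by (simp add: s_def)
  have s_mono: "strict_mono s" unfolding strict_mono_Suc_iff s_Suc h_def by (simp add: less_max_iff_disj)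
  have s_ge: "j0 \<le> s i" "i \<le> s i" for i
  proof -
    show "j0 \<le> s i" by (induction i) (auto simp: s_Suc h_def, simp add: s_def)
    show "i \<le> s i" using s_mono by (rule strict_mono_imp_increasing)
  qed
  have s_h: "h (s i) \<le> s l" if "i < l" for i l
    using that s_mono by (metis Suc_leI s_Suc strict_mono_less_eq)
  define A where "A = range (\<lambda>i. v (s i))"
  have Ac: "a \<in> mspace m \<and> mdist m (p 0) a < \<epsilon> / 4" if "a \<in> A" for a
    using that Vp v s_ge(1) unfolding A_def by blast
  obtain \<delta> where "\<delta> > 0" and \<delta>: "chained_around m A \<delta> ?W"
    using cluster[OF Ac] unfolding A_def by blast
  obtain N1 where N1: "\<And>i j. \<lbrakk>N1 \<le> i; N1 \<le> j\<rbrakk> \<Longrightarrow> mdist m (p i) (p j) < \<delta> / 3"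
    using Cauchy[of "\<delta>/3"] \<open>\<delta> > 0\<close> by auto
  obtain N2 where N2: "\<And>j. N2 \<le> j \<Longrightarrow> r j < \<delta> / 3"
    using r(2)[of "\<delta>/3"] \<open>\<delta> > 0\<close> by auto
  define i where "i = max N1 N2"
  have vs: "v (s l) \<in> V (s l)" for l using v s_ge by blast
  have big: "N1 \<le> s i" "N1 \<le> s (Suc i)" "N2 \<le> s i" "N2 \<le> s (Suc i)"
    using s_ge(2)[of i] s_ge(2)[of "Suc i"] unfolding i_def by auto
  have move: "mdist m (v (s i)) (v (s (Suc i))) < \<delta>"
    using mdist_le_via(2)[OF Vp(1)[OF vs[of i]] p(1)[of "s i"] Vp(1)[OF vs[of "Suc i"]]]
      mdist_le_via(1)[OF p(1)[of "s i"] p(1)[of "s (Suc i)"] Vp(1)[OF vs[of "Suc i"]]]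
      Vp(2)[OF vs[of i]] Vp(2)[OF vs[of "Suc i"]] N1[OF big(1,2)] N2[OF big(3)] N2[OF big(4)]
    by linarith
  \<comment> \<open>removing \<open>v (s i)\<close> is a small change, since \<open>v (s (Suc i))\<close> is close to it\<close>
  let ?E = "{v (s l) |l. l \<noteq> i}"
  have self: "mdist m (v (s l)) (v (s l)) < \<delta>" for l using Vp(1)[OF vs] \<open>\<delta> > 0\<close> by simp
  have "near_to m \<delta> A ?E"
    unfolding near_to_def
  proof
    fix a assume "a \<in> A"
    then obtain l where l: "a = v (s l)" unfolding A_def by blast
    show "\<exists>y\<in>?E. mdist m a y < \<delta>"
    proof (cases "l = i")
      case True
      then show ?thesis using l move by (intro bexI[of _ "v (s (Suc i))"]) auto
    next
      case False
      then show ?thesis using l self by (intro bexI[of _ a]) auto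
    qed
  qed
  moreover have "near_to m \<delta> ?E A" "near_to m \<delta> A A"
    using self unfolding near_to_def A_def by blast+
  moreover have "?E \<subseteq> mspace m" "A \<subseteq> mspace m" using Vp(1)[OF vs] by (auto simp: A_def)
  ultimately obtain n where n: "\<forall>y\<in>A. \<exists>x\<in>?E. chain m (\<eta> (s i)) n ?W x y"
    using \<delta>[rule_format, OF _ \<eta>(1)] by meson
  have "v (s i) \<in> A" by (auto simp: A_def)
  then obtain l where l: "l \<noteq> i" "chain m (\<eta> (s i)) n ?W (v (s l)) (v (s i))" using n by blast
  have drop: "chain m (\<eta> (s a)) 1 ?W (v (s b)) (p (s b))" if "a < b" for a b
  proof (rule chain_step)
    have "r (s b) < \<eta> (s a)" using s_h[OF that] by (intro h0) (simp add: h_def)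
    then show "mdist m (v (s b)) (p (s b)) < \<eta> (s a)"
      using Vp(2)[OF vs[of b]] by (simp add: mdist_commute)
  qed (use VW vs pW in auto)
  consider "i < l" | "l < i" using l by linarith
  then show False
  proof cases
    case 1
    then have "L (s i) \<le> s l" using s_h[OF 1] by (simp add: h_def)
    moreover have "chain m (\<eta> (s i)) (n + 1) ?W (v (s i)) (p (s l))"
      using chain_trans[OF chain_sym[OF l(2)] drop[OF 1]] .
    ultimately show False using isolated[OF s_ge(1)] by blast
  next
    case 2
    then have "L (s l) \<le> s i" using s_h[OF 2] by (simp add: h_def)
    moreover have "\<eta> (s i) \<le> \<eta> (s l)" using 2 s_mono by (intro \<eta>(2)) (simp add: strict_mono_less_eq)
    then have "chain m (\<eta> (s l)) n ?W (v (s l)) (v (s i))" using chain_weaken[OF l(2) _ order_refl] by simp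
    then have "chain m (\<eta> (s l)) (n + 1) ?W (v (s l)) (p (s i))" using drop[OF 2] by (rule chain_trans)
    ultimately show False using isolated[OF s_ge(1)] by blast
  qed
qed

lemma Ramsey_dichotomy:
  fixes d :: "nat \<Rightarrow> nat \<Rightarrow> real"
  assumes "\<And>i j. d i j = d j i" "\<And>i. d i i < \<rho>"
  obtains I where "infinite I" "\<And>i j. \<lbrakk>i \<in> I; j \<in> I; i \<noteq> j\<rbrakk> \<Longrightarrow> \<rho> \<le> d i j"
  | I where "infinite I" "\<And>i j. \<lbrakk>i \<in> I; j \<in> I\<rbrakk> \<Longrightarrow> d i j < \<rho>"
proof -
  define f :: "nat set \<Rightarrow> nat" where "f X = (if \<exists>i\<in>X. \<exists>j\<in>X. \<rho> \<le> d i j then 1 else 0)" for X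
  have f: "f {i, j} = (if \<rho> \<le> d i j then 1 else 0)" for i j
    using assms by (auto simp: f_def not_le[symmetric])
  obtain I t where I: "infinite I" "\<And>i j. \<lbrakk>i \<in> I; j \<in> I; i \<noteq> j\<rbrakk> \<Longrightarrow> f {i, j} = t"
  proof -
    have "f X < 2" for X by (simp add: f_def)
    then show ?thesis using Ramsey2[of "UNIV :: nat set" f 2] that by auto
  qed
  show ?thesis
  proof (cases "t = 1")
    case True
    then have "\<rho> \<le> d i j" if "i \<in> I" "j \<in> I" "i \<noteq> j" for i j
      using I(2)[OF that] f[of i j] by (metis zero_neq_one)
    then show ?thesis using that(1) I(1) by blast
  next
    case False
    then have "d i j < \<rho>" if "i \<in> I" "j \<in> I" for i j
      using I(2)[of i j] that assms(2)[of i] f[of i j] by (metis not_le)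
    then show ?thesis using that(2) I(1) by blast
  qed
qed

text \<open>
  The centres \<open>p j\<close> have either a Cauchy subsequence or an infinite separated subset. In the latter case
  this subset is equichained with some radius \<open>\<delta>\<close>, and the clusters around all but finitely many of its points lie in
  the \<open>\<delta>\<close>-balls around them.
\<close>

lemma no_bad_clusters:
  fixes p :: "nat \<Rightarrow> 'a"
  assumes chained: "close_sets_chained m" and "\<epsilon> > 0" and B: "mbounded_of m B"
    and p: "\<And>i. p i \<in> B"
    and V: "\<And>j. V j \<subseteq> mball_of m (p j) (r j)"
    and r: "\<And>j. r j \<le> \<epsilon> / 8" "\<And>e. e > 0 \<Longrightarrow> \<exists>L. \<forall>j\<ge>L. r j < e"
    and \<eta>: "\<And>j. \<eta> j > 0"
    and bad: "\<And>j n. \<exists>v\<in>V j. \<exists>w\<in>V j. \<not> chain m (\<eta> j) n (mball_of m (p j) \<epsilon>) v w"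
  shows False
proof -
  interpret Metric_space "mspace m" "mdist m" by (rule Metric_space_mspace_mdist)
  have pm: "p i \<in> mspace m" for i using p B by (auto simp: mbounded_of_iff)
  show False
  proof (cases "mtotally_bounded (range p)")
    case True
    then obtain s where s: "strict_mono s" "MCauchy (p \<circ> s)"
      unfolding mtotally_bounded_sequentially by blast
    have Cauchy: "\<exists>L. \<forall>i\<ge>L. \<forall>j\<ge>L. mdist m (p (s i)) (p (s j)) < e" if "e > 0" for e
      using s(2) that unfolding MCauchy_def by (auto simp: o_def)
    obtain L where L: "\<And>i j. \<lbrakk>L \<le> i; L \<le> j\<rbrakk> \<Longrightarrow> mdist m (p (s i)) (p (s j)) < \<epsilon> / 8"
      using Cauchy[of "\<epsilon>/8"] \<open>\<epsilon> > 0\<close> by auto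
    define t where "t i = s (i + L)" for i
    have t: "i \<le> t i" for i
      using strict_mono_imp_increasing[OF s(1), of "i + L"] by (simp add: t_def)
    \<comment> \<open>smaller step sizes only make chains longer, so the step sizes may be assumed to decrease\<close>
    define \<eta>' where "\<eta>' j = Min ((\<lambda>i. \<eta> (t i)) ` {..j})" for j
    have \<eta>'_le: "\<eta>' j \<le> \<eta> (t j)" for j unfolding \<eta>'_def by (intro Min_le) auto
    show False
    proof (rule no_bad_Cauchy_clusters[OF chained \<open>\<epsilon> > 0\<close>, where p = "\<lambda>i. p (t i)" and V = "\<lambda>j. V (t j)"
          and r = "\<lambda>j. r (t j)" and \<eta> = \<eta>'])
      show "mdist m (p (t i)) (p (t j)) < \<epsilon> / 8" for i j unfolding t_def by (intro L) auto
      show "\<exists>L. \<forall>i\<ge>L. \<forall>j\<ge>L. mdist m (p (t i)) (p (t j)) < e" if "e > 0" for e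
        using Cauchy[OF that] unfolding t_def by (meson trans_le_add1)
      show "\<exists>L. \<forall>j\<ge>L. r (t j) < e" if "e > 0" for e
        using r(2)[OF that] t order_trans by meson
      show "\<eta>' j > 0" for j unfolding \<eta>'_def using \<eta> by auto
      show "\<eta>' j \<le> \<eta>' i" if "i \<le> j" for i j
        unfolding \<eta>'_def using that by (intro Min_antimono) auto
      fix j n
      obtain v w where vw: "v \<in> V (t j)" "w \<in> V (t j)" "\<not> chain m (\<eta> (t j)) n (mball_of m (p (t j)) \<epsilon>) v w"
        using bad by blast
      have "mdist m (p (t j)) (p (t 0)) < \<epsilon> / 8" unfolding t_def by (intro L) auto
      note near = this
      have "mball_of m (p (t 0)) (\<epsilon> / 2) \<subseteq> mball_of m (p (t j)) \<epsilon>"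
      proof
        fix u assume "u \<in> mball_of m (p (t 0)) (\<epsilon> / 2)"
        then show "u \<in> mball_of m (p (t j)) \<epsilon>"
          using near pm mdist_le_via(1)[OF pm[of "t j"] pm[of "t 0"], of u] \<open>\<epsilon> > 0\<close> by auto
      qed
      then have "\<not> chain m (\<eta>' j) n (mball_of m (p (t 0)) (\<epsilon> / 2)) v w"
        using vw(3) chain_weaken[OF _ \<eta>'_le] by metis
      then show "\<exists>v\<in>V (t j). \<exists>w\<in>V (t j). \<not> chain m (\<eta>' j) n (mball_of m (p (t 0)) (\<epsilon> / 2)) v w"
        using vw by blast
    qed (use pm V r in auto)
  next
    case False
    then obtain \<rho> where "\<rho> > 0" and no_net: "\<not> (\<exists>K. finite K \<and> K \<subseteq> range p \<and> range p \<subseteq> (\<Union>x\<in>K. mball x \<rho>))"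
      unfolding mtotally_bounded_def not_all not_imp by (elim exE conjE)
    have \<rho>: "\<not> range p \<subseteq> (\<Union>x\<in>K. mball x \<rho>)" if "finite K" "K \<subseteq> range p" for K
      using no_net that by simp
    have next_point: "\<exists>j. \<forall>l<i. \<rho> \<le> mdist m (p (f l)) (p j)" for f :: "nat \<Rightarrow> nat" and i
    proof -
      define U where "U = (\<Union>x\<in>(\<lambda>l. p (f l)) ` {..<i}. mball x \<rho>)"
      have "\<not> range p \<subseteq> U" unfolding U_def by (rule \<rho>) auto
      then obtain j where "p j \<notin> U" by blast
      then have "\<forall>l<i. p j \<notin> mball (p (f l)) \<rho>" unfolding U_def by blast
      then show ?thesis using pm by (intro exI[of _ j]) (simp add: not_less)
    qed
    have "\<exists>f. \<forall>i::nat. \<forall>l<i. \<rho> \<le> mdist m (p (f l)) (p (f i))"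
    proof (rule dependent_wellorder_choice[where P = "\<lambda>f i j. \<forall>l<i. \<rho> \<le> mdist m (p (f l)) (p j)"])
      show "\<exists>j. \<forall>l<i. \<rho> \<le> mdist m (p (f l)) (p j)" for i and f :: "nat \<Rightarrow> nat"
        by (rule next_point)
    qed simp
    then obtain f where f0: "\<forall>i::nat. \<forall>l<i. \<rho> \<le> mdist m (p (f l)) (p (f i))" ..
    have f: "\<rho> \<le> mdist m (p (f l)) (p (f i))" if "l < i" for i l using f0 that by simp
    have sep: "\<rho> \<le> mdist m (p (f i)) (p (f j))" if "i \<noteq> j" for i j
      using f that by (metis linorder_neqE_nat mdist_commute)
    have "inj f"
    proof (rule injI)
      fix i j assume "f i = f j"
      then show "i = j" using sep[of i j] pm \<open>\<rho> > 0\<close> by force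
    qed
    define S where "S = range (\<lambda>i. p (f i))"
    have "equichained m S \<epsilon>"
    proof (rule separated_sets_equichained[OF chained, where r = \<rho>])
      show "mbounded_of m S" using B by (rule mbounded_of_subset) (auto simp: S_def p)
      fix a b assume "a \<in> S" "b \<in> S" "a \<noteq> b"
      then obtain i j where "a = p (f i)" "b = p (f j)" "i \<noteq> j" unfolding S_def by blast
      then show "\<rho> \<le> mdist m a b" using sep by simp
    qed fact+
    then obtain \<delta> where "\<delta> > 0" and \<delta>: "\<And>\<eta>. \<eta> > 0 \<Longrightarrow> \<exists>n. \<forall>x\<in>S. \<forall>y\<in>mspace m. mdist m x y < \<delta> \<longrightarrow>
       chain m \<eta> n (mball_of m x \<epsilon>) x y" unfolding equichained_def equireach_def by blast
    obtain N where N: "\<And>j. N \<le> j \<Longrightarrow> r j < \<delta>" using r(2)[OF \<open>\<delta> > 0\<close>] by blast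
    have "infinite (range f)" using \<open>inj f\<close> by (rule range_inj_infinite)
    then obtain i where i: "N \<le> f i" by (metis infinite_nat_iff_unbounded_le imageE)
    obtain n where n: "\<forall>x\<in>S. \<forall>y\<in>mspace m. mdist m x y < \<delta> \<longrightarrow>
       chain m (\<eta> (f i)) n (mball_of m x \<epsilon>) x y" using \<delta>[OF \<eta>] by blast
    have "chain m (\<eta> (f i)) n (mball_of m (p (f i)) \<epsilon>) (p (f i)) v" if "v \<in> V (f i)" for v
    proof -
      have "p (f i) \<in> S" by (simp add: S_def)
      then show ?thesis using n V[of "f i"] that N[OF i] by (auto dest!: subsetD)
    qed
    then have "chain m (\<eta> (f i)) (n + n) (mball_of m (p (f i)) \<epsilon>) v w"
      if "v \<in> V (f i)" "w \<in> V (f i)" for v w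
      using that chain_trans chain_sym by metis
    then show False using bad[of "f i" "n + n"] by blast
  qed
qed

text \<open>
  Suppose that \<open>B\<close> is not equichained. This produces the rows of bad pairs. By Ramsey's theorem
  each row has, for each \<open>\<rho>\<close>, an infinite part that is separated by \<open>\<rho>\<close> or has diameter at
  most \<open>\<rho>\<close>. Either one \<open>\<rho>\<close> gives separated parts for infinitely many rows, or late rows have parts of
  arbitrarily small diameter, which form shrinking clusters.
\<close>

lemma close_sets_chained_imp_locally_equichained:
  assumes chained: "close_sets_chained m"
  shows "locally_equichained m"
  unfolding locally_equichained_def
proof (intro allI impI, rule ccontr)
  fix B and \<epsilon> :: real
  assume B: "mbounded_of m B" and "\<epsilon> > 0" and not: "\<not> equichained m B \<epsilon>"
  have Bm: "B \<subseteq> mspace m" using B by (simp add: mbounded_of_iff)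
  have "\<exists>\<eta>>0. \<forall>n. \<exists>x\<in>B. \<exists>y\<in>mspace m. mdist m x y < \<delta> \<and> \<not> chain m \<eta> n (mball_of m x \<epsilon>) x y"
    if "\<delta> > 0" for \<delta>
    using not[unfolded equichained_def equireach_def not_ex, rule_format, of \<delta>] that by simp
  then have "\<exists>\<eta>>0. \<forall>n. \<exists>x\<in>B. \<exists>y\<in>mspace m. mdist m x y < 1 / (real k + 1) \<and>
     \<not> chain m \<eta> n (mball_of m x \<epsilon>) x y" for k by simp
  then obtain \<eta> where \<eta>: "\<And>k. \<eta> k > 0" and "\<And>k n. \<exists>x\<in>B. \<exists>y\<in>mspace m. mdist m x y < 1 / (real k + 1) \<and>
     \<not> chain m (\<eta> k) n (mball_of m x \<epsilon>) x y" by metis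
  then obtain x y where x: "\<And>k n. x k n \<in> B" and y: "\<And>k n. y k n \<in> mspace m"
    and close: "\<And>k n. mdist m (x k n) (y k n) < 1 / (real k + 1)"
    and bad: "\<And>k n. \<not> chain m (\<eta> k) n (mball_of m (x k n) \<epsilon>) (x k n) (y k n)" by metis
  have xm: "x k n \<in> mspace m" for k n using x Bm by blast
  define K where "K \<rho> = {k. \<exists>I. infinite I \<and> (\<forall>i\<in>I. \<forall>j\<in>I. i \<noteq> j \<longrightarrow> \<rho> \<le> mdist m (x k i) (x k j))}" for \<rho>
  have K: "finite (K \<rho>)" if "\<rho> > 0" for \<rho>
  proof (rule ccontr)
    assume inf: "infinite (K \<rho>)"
    have "\<forall>k\<in>K \<rho>. \<exists>I. infinite I \<and> (\<forall>i\<in>I. \<forall>j\<in>I. i \<noteq> j \<longrightarrow> \<rho> \<le> mdist m (x k i) (x k j))"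
      by (simp add: K_def)
    then obtain I where "\<forall>k\<in>K \<rho>. infinite (I k) \<and> (\<forall>i\<in>I k. \<forall>j\<in>I k. i \<noteq> j \<longrightarrow> \<rho> \<le> mdist m (x k i) (x k j))"
      by (rule bchoice[THEN exE])
    then show False
      using no_bad_separated_rows[OF chained B \<open>\<epsilon> > 0\<close> that x y close \<eta> bad inf, of I] by blast
  qed
  have tight: "\<exists>k\<ge>N. \<exists>I. infinite I \<and> (\<forall>i\<in>I. \<forall>j\<in>I. mdist m (x k i) (x k j) < \<rho>)" if "\<rho> > 0" for N \<rho>
  proof -
    obtain k where k: "N \<le> k" "k \<notin> K \<rho>"
      using K[OF \<open>\<rho> > 0\<close>] by (metis finite_nat_set_iff_bounded_le nat_le_linear not_less_eq_eq)
    show ?thesis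
    proof (rule Ramsey_dichotomy[of "\<lambda>i j. mdist m (x k i) (x k j)" \<rho>])
      show "mdist m (x k i) (x k i) < \<rho>" for i using xm that by simp
      show "mdist m (x k i) (x k j) = mdist m (x k j) (x k i)" for i j by (rule mdist_commute)
    next
      fix I assume "infinite I" "\<And>i j. \<lbrakk>i \<in> I; j \<in> I; i \<noteq> j\<rbrakk> \<Longrightarrow> \<rho> \<le> mdist m (x k i) (x k j)"
      then have "k \<in> K \<rho>" unfolding K_def by blast
      then show ?thesis using k by simp
    next
      fix I assume "infinite I" "\<And>i j. \<lbrakk>i \<in> I; j \<in> I\<rbrakk> \<Longrightarrow> mdist m (x k i) (x k j) < \<rho>"
      then show ?thesis using k by blast
    qed
  qed
  \<comment> \<open>the offset \<open>J\<close> makes all clusters small against \<open>\<epsilon>\<close>\<close>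
  obtain J :: nat where J: "1 / (real J + 1) \<le> \<epsilon> / 32"
    using \<open>\<epsilon> > 0\<close> nat_approx_posE[of "\<epsilon>/32"] by (metis of_nat_Suc add.commute divide_pos_pos less_imp_le zero_less_numeral)
  define r where "r j = 2 / (real (j + J) + 1)" for j
  have r_pos: "r j > 0" for j by (simp add: r_def)
  obtain \<kappa> I where \<kappa>: "\<And>j. j + J \<le> \<kappa> j" and I: "\<And>j. infinite (I j)"
    and tightI: "\<And>j a b. \<lbrakk>a \<in> I j; b \<in> I j\<rbrakk> \<Longrightarrow> mdist m (x (\<kappa> j) a) (x (\<kappa> j) b) < r j / 2"
  proof -
    have "\<exists>k I. j + J \<le> k \<and> infinite I \<and> (\<forall>a\<in>I. \<forall>b\<in>I. mdist m (x k a) (x k b) < r j / 2)" for j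
      using tight[of "r j / 2" "j + J"] r_pos[of j] by auto
    then show ?thesis using that by metis
  qed
  define p where "p j = x (\<kappa> j) (LEAST a. a \<in> I j)" for j
  have least: "(LEAST a. a \<in> I j) \<in> I j" for j
    using I[of j] by (metis LeastI infinite_imp_nonempty ex_in_conv)
  define V where "V j = x (\<kappa> j) ` I j \<union> y (\<kappa> j) ` I j" for j
  have xp: "mdist m (p j) (x (\<kappa> j) a) < r j / 2" if "a \<in> I j" for a j
    unfolding p_def by (rule tightI[OF least that])
  have r_small: "r j \<le> \<epsilon> / 16" for j
  proof -
    have "1 / (real (j + J) + 1) \<le> 1 / (real J + 1)" by (intro divide_left_mono) auto
    then show ?thesis using J by (simp add: r_def)
  qed
  show False
  proof (rule no_bad_clusters[OF chained _ B, where p = p and V = V and r = r and \<eta> = "\<lambda>j. \<eta> (\<kappa> j)" and \<epsilon> = "\<epsilon>/2"])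
    show "V j \<subseteq> mball_of m (p j) (r j)" for j
    proof
      fix v assume "v \<in> V j"
      then obtain a where a: "a \<in> I j" "v = x (\<kappa> j) a \<or> v = y (\<kappa> j) a" by (auto simp: V_def)
      have "1 / (real (\<kappa> j) + 1) \<le> r j / 2"
        using \<kappa>[of j] unfolding r_def by (simp add: field_simps)
      then have "mdist m (x (\<kappa> j) a) (y (\<kappa> j) a) < r j / 2" using close[of "\<kappa> j" a] by linarith
      moreover have pm: "p j \<in> mspace m" unfolding p_def by (rule xm)
      ultimately show "v \<in> mball_of m (p j) (r j)"
        using xp[OF a(1)] a(2) xm[of "\<kappa> j" a] y[of "\<kappa> j" a] r_pos[of j]
          mdist_le_via(1)[OF pm xm[of "\<kappa> j" a] y[of "\<kappa> j" a]] by auto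
    qed
    show "\<exists>L. \<forall>j\<ge>L. r j < e" if e: "e > 0" for e
    proof -
      obtain N where "1 / (real (Suc N)) < e / 2" using e by (metis half_gt_zero nat_approx_posE)
      then have "r j < e" if "N \<le> j" for j
      proof -
        have "1 / (real (j + J) + 1) \<le> 1 / real (Suc N)" using that by (intro divide_left_mono) auto
        then show ?thesis using \<open>1 / (real (Suc N)) < e / 2\<close> by (simp add: r_def)
      qed
      then show ?thesis by blast
    qed
    show "\<exists>v\<in>V j. \<exists>w\<in>V j. \<not> chain m (\<eta> (\<kappa> j)) n (mball_of m (p j) (\<epsilon> / 2)) v w" for j n
    proof -
      obtain a where a: "a \<in> I j" "n \<le> a" using I[of j] by (meson infinite_nat_iff_unbounded_le)
      have pm: "p j \<in> mspace m" unfolding p_def by (rule xm)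
      have "mball_of m (p j) (\<epsilon> / 2) \<subseteq> mball_of m (x (\<kappa> j) a) \<epsilon>"
      proof
        fix u assume "u \<in> mball_of m (p j) (\<epsilon> / 2)"
        then show "u \<in> mball_of m (x (\<kappa> j) a) \<epsilon>"
          using mdist_le_via(2)[OF xm[of "\<kappa> j" a] pm, of u] xp[OF a(1)] r_small[of j] xm \<open>\<epsilon> > 0\<close> by auto
      qed
      then have "\<not> chain m (\<eta> (\<kappa> j)) n (mball_of m (p j) (\<epsilon> / 2)) (x (\<kappa> j) a) (y (\<kappa> j) a)"
        using bad[of "\<kappa> j" a] chain_lengthen[OF _ a(2) mball_of_subset_mspace \<eta>]
          chain_weaken[OF _ order_refl] by meson
      then show ?thesis using a(1) by (auto simp: V_def)
    qed
  qed (use \<open>\<epsilon> > 0\<close> x r_small \<eta> in \<open>auto simp: p_def\<close>)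
qed

section \<open>Growing points to balls\<close>

text \<open>
  \<open>n j\<close> is the number of pieces into which a step of level \<open>j\<close> is divided, and \<open>ch j u v\<close> the chain that
  replaces the step from \<open>u\<close> to \<open>v\<close>. Index \<open>i\<close> at level \<open>j\<close> stands for the time \<open>i / (n0 * n 0 * ... * n (j - 1))\<close>,
  where \<open>n0\<close> is the length of the chain \<open>c\<close>.
\<close>

primrec subdivide :: "(nat \<Rightarrow> nat) \<Rightarrow> (nat \<Rightarrow> 'a \<Rightarrow> 'a \<Rightarrow> nat \<Rightarrow> 'a) \<Rightarrow> (nat \<Rightarrow> 'a) \<Rightarrow> nat \<Rightarrow> nat \<Rightarrow> 'a" where
  "subdivide n ch c 0 = c"
| "subdivide n ch c (Suc j) = (\<lambda>i. ch j (subdivide n ch c j (i div n j))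
     (subdivide n ch c j (Suc (i div n j))) (i mod n j))"

text \<open>
  A substitute for paths, which need not exist in an incomplete space. Each \<open>y\<close> in the \<open>r\<close>-ball is
  joined to \<open>x\<close> by a chain, whose steps are replaced by shorter chains again and again. The balls
  containing the replacements have summable radii, and the numbers of pieces are the same for all pairs. So the
  points reached up to time \<open>t\<close> form a set \<open>G t x\<close> that varies with \<open>t\<close> at a rate independent of \<open>x\<close>.
\<close>

lemma growth_of_fixed_radius:
  fixes m :: "'a metric"
  assumes lec: "locally_equichained m" and B: "mbounded_of m B"
    and reach: "equireach m B r e" and "e < e'" "r > 0"
  obtains G :: "real \<Rightarrow> 'a \<Rightarrow> 'a set"
  where "\<And>x. x \<in> B \<Longrightarrow> G 0 x = {x}" "\<And>t x. x \<in> B \<Longrightarrow> G t x \<subseteq> mball_of m x e'"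
    "\<And>x y. \<lbrakk>x \<in> B; y \<in> mspace m; mdist m x y < r\<rbrakk> \<Longrightarrow> y \<in> G 1 x"
    "\<And>s t x. s \<le> t \<Longrightarrow> G s x \<subseteq> G t x"
    "\<And>\<xi>. \<xi> > 0 \<Longrightarrow> \<exists>\<sigma>>0. \<forall>x\<in>B. \<forall>s t. 0 \<le> s \<and> s \<le> t \<and> t - s \<le> \<sigma> \<longrightarrow> near_to m \<xi> (G t x) (G s x)"
proof -
  define \<theta> where "\<theta> = e' - e"
  have "\<theta> > 0" using \<open>e < e'\<close> by (simp add: \<theta>_def)
  define w where "w j = \<theta> / 4 * (1/2) ^ j" for j :: nat
  have w: "w j > 0" for j using \<open>\<theta> > 0\<close> by (simp add: w_def)
  have Bm: "B \<subseteq> mspace m" using B by (simp add: mbounded_of_iff)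
  define C where "C = nbhd m B e'"
  have C: "mbounded_of m C" unfolding C_def using B by (rule mbounded_of_nbhd)
  have "equichained m C (w j)" for j
    using lec C w unfolding locally_equichained_def by blast
  then obtain \<delta> where \<delta>: "\<And>j. \<delta> j > 0" and \<delta>_reach: "\<And>j \<eta>. \<eta> > 0 \<Longrightarrow>
      \<exists>n. \<forall>x\<in>C. \<forall>y\<in>mspace m. mdist m x y < \<delta> j \<longrightarrow> chain m \<eta> n (mball_of m x (w j)) x y"
    unfolding equichained_def equireach_def by metis
  define \<eta> where "\<eta> j = min (\<delta> j) (w j)" for j
  have \<eta>: "\<eta> j > 0" for j using \<delta> w by (simp add: \<eta>_def)
  \<comment> \<open>block lengths are made positive so that subdivision indices can be divided by them\<close>
  have positive: "\<exists>n>0. \<forall>x\<in>T. \<forall>y\<in>mspace m. mdist m x y < s \<longrightarrow> chain m h n (mball_of m x b) x y"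
    if "\<exists>n. \<forall>x\<in>T. \<forall>y\<in>mspace m. mdist m x y < s \<longrightarrow> chain m h n (mball_of m x b) x y" "h > 0"
    for T s h b
    using that chain_lengthen[OF _ _ mball_of_subset_mspace, of m h _ _ b] by (metis le_SucI order_refl zero_less_Suc)
  have "\<exists>n>0. \<forall>u\<in>C. \<forall>v\<in>mspace m. mdist m u v < \<delta> j \<longrightarrow>
      chain m (\<eta> (Suc j)) n (mball_of m u (w j)) u v" for j
    by (rule positive[OF \<delta>_reach[OF \<eta>] \<eta>])
  then obtain n where n: "\<And>j. n j > 0"
    and n_chain: "\<And>j u v. \<lbrakk>u \<in> C; v \<in> mspace m; mdist m u v < \<delta> j\<rbrakk> \<Longrightarrow>
      chain m (\<eta> (Suc j)) (n j) (mball_of m u (w j)) u v" by metis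
  obtain n0 where "n0 > 0" and n0: "\<And>x y. \<lbrakk>x \<in> B; y \<in> mspace m; mdist m x y < r\<rbrakk> \<Longrightarrow>
      chain m (\<eta> 0) n0 (mball_of m x e) x y"
    using positive[of B r "\<eta> 0" e] reach \<eta> unfolding equireach_def by metis
  define ch where "ch j u v = (SOME c. c 0 = u \<and> c (n j) = v \<and> (\<forall>i\<le>n j. c i \<in> mball_of m u (w j)) \<and>
      (\<forall>i<n j. mdist m (c i) (c (Suc i)) < \<eta> (Suc j)))" for j u v
  have ch: "ch j u v 0 = u" "ch j u v (n j) = v" "\<And>i. i \<le> n j \<Longrightarrow> ch j u v i \<in> mball_of m u (w j)"
    "\<And>i. i < n j \<Longrightarrow> mdist m (ch j u v i) (ch j u v (Suc i)) < \<eta> (Suc j)"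
    if "u \<in> C" "v \<in> mspace m" "mdist m u v < \<eta> j" for j u v
  proof -
    have "mdist m u v < \<delta> j" using that by (simp add: \<eta>_def)
    from n_chain[OF that(1,2) this] have *: "ch j u v 0 = u \<and> ch j u v (n j) = v \<and>
       (\<forall>i\<le>n j. ch j u v i \<in> mball_of m u (w j)) \<and>
      (\<forall>i<n j. mdist m (ch j u v i) (ch j u v (Suc i)) < \<eta> (Suc j))"
      unfolding chain_def ch_def by (rule someI_ex)
    then show "ch j u v 0 = u" "ch j u v (n j) = v" "\<And>i. i \<le> n j \<Longrightarrow> ch j u v i \<in> mball_of m u (w j)"
      "\<And>i. i < n j \<Longrightarrow> mdist m (ch j u v i) (ch j u v (Suc i)) < \<eta> (Suc j)"
      by auto
  qed
  define c0 where "c0 x y = (SOME c. c 0 = x \<and> c n0 = y \<and> (\<forall>i\<le>n0. c i \<in> mball_of m x e) \<and>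
      (\<forall>i<n0. mdist m (c i) (c (Suc i)) < \<eta> 0))" for x y
  define q where "q x y = subdivide n ch (\<lambda>i. c0 x y (min i n0))" for x y
  define N where "N = rec_nat n0 (\<lambda>j k. k * n j)"
  have N_Suc: "N (Suc j) = N j * n j" and N_0: "N 0 = n0" for j by (simp_all add: N_def)
  have N_pos: "N j > 0" for j by (induction j) (simp_all add: N_Suc N_0 n \<open>n0 > 0\<close>)
  have q_Suc: "q x y (Suc j) i = ch j (q x y j (i div n j)) (q x y j (Suc (i div n j))) (i mod n j)" for x y j i
    by (simp add: q_def)
  have q: "mdist m x (q x y j i) < e + \<theta> / 2 * (1 - (1/2)^j) \<and> q x y j i \<in> mspace m \<and>
      mdist m (q x y j i) (q x y j (Suc i)) < \<eta> j \<and> q x y j 0 = x \<and> q x y j (N j) = y"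
    if x: "x \<in> B" and y: "y \<in> mspace m" "mdist m x y < r" for x y j i
  proof (induction j arbitrary: i)
    case 0
    have c0: "c0 x y 0 = x \<and> c0 x y n0 = y \<and> (\<forall>i\<le>n0. c0 x y i \<in> mball_of m x e) \<and>
      (\<forall>i<n0. mdist m (c0 x y i) (c0 x y (Suc i)) < \<eta> 0)"
      using n0[OF that] unfolding chain_def c0_def by (rule someI_ex)
    have "mdist m (c0 x y (min i n0)) (c0 x y (min (Suc i) n0)) < \<eta> 0"
      using c0 \<eta>[of 0] y(1) by (cases "i < n0") (auto simp: min_def Suc_le_eq)
    then show ?case using c0 by (auto simp: q_def N_0)
  next
    case (Suc j)
    let ?a = "i div n j" and ?r = "i mod n j"
    have r: "?r < n j" using n by simp
    have half: "\<theta> / 2 * (1 - (1/2)^j) < \<theta>"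
    proof -
      have "(1/2::real)^j > 0" by simp
      then have "\<theta> / 2 * (1 - (1/2)^j) \<le> \<theta> / 2 * 1" using \<open>\<theta> > 0\<close> by (intro mult_left_mono) auto
      then show ?thesis using \<open>\<theta> > 0\<close> by linarith
    qed
    have inC: "q x y j a \<in> C" for a
      using Suc[of a] x Bm half unfolding C_def nbhd_def \<theta>_def by (fastforce simp: \<theta>_def)
    have ch': "ch j (q x y j a) (q x y j (Suc a)) 0 = q x y j a"
      "ch j (q x y j a) (q x y j (Suc a)) (n j) = q x y j (Suc a)"
      "\<And>i. i \<le> n j \<Longrightarrow> ch j (q x y j a) (q x y j (Suc a)) i \<in> mball_of m (q x y j a) (w j)"
      "\<And>i. i < n j \<Longrightarrow> mdist m (ch j (q x y j a) (q x y j (Suc a)) i) (ch j (q x y j a) (q x y j (Suc a)) (Suc i)) < \<eta> (Suc j)" for a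
      using ch[OF inC[of a], of "q x y j (Suc a)"] Suc[of a] Suc[of "Suc a"] by blast+
    have mem: "q x y (Suc j) i \<in> mball_of m (q x y j ?a) (w j)"
      unfolding q_Suc using r by (intro ch'(3)) simp
    have "mdist m x (q x y (Suc j) i) < e + \<theta> / 2 * (1 - (1/2)^Suc j)"
    proof -
      have "mdist m x (q x y (Suc j) i) < (e + \<theta> / 2 * (1 - (1/2)^j)) + w j"
        using mem Suc[of ?a] mdist_le_via(1)[of x m "q x y j ?a" "q x y (Suc j) i"] x Bm by fastforce
      also have "\<dots> = e + \<theta> / 2 * (1 - (1/2)^Suc j)" by (simp add: w_def field_simps)
      finally show ?thesis .
    qed
    moreover have "mdist m (q x y (Suc j) i) (q x y (Suc j) (Suc i)) < \<eta> (Suc j)"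
    proof (cases "Suc ?r = n j")
      case True
      then have "Suc i div n j = Suc ?a" "Suc i mod n j = 0" by (simp_all add: div_Suc mod_Suc)
      then have "q x y (Suc j) (Suc i) = q x y j (Suc ?a)" unfolding q_Suc using ch'(1) by simp
      also have "\<dots> = ch j (q x y j ?a) (q x y j (Suc ?a)) (Suc ?r)" using ch'(2) True by simp
      finally show ?thesis unfolding q_Suc using ch'(4)[OF r] by simp
    next
      case False
      then have "Suc i div n j = ?a" "Suc i mod n j = Suc ?r" by (simp_all add: div_Suc mod_Suc)
      then show ?thesis unfolding q_Suc using ch'(4)[OF r] by simp
    qed
    moreover have "q x y (Suc j) 0 = x" unfolding q_Suc using ch'(1)[of 0] Suc[of 0] by simp
    moreover have "q x y (Suc j) (N (Suc j)) = y"
      unfolding q_Suc N_Suc using ch'(1)[of "N j"] Suc[of 0] n[of j] by simp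
    ultimately show ?case using mem by simp
  qed
  have w_telescope: "\<theta> / 2 * (1/2)^j - \<theta> / 2 * (1/2)^Suc j = w j" for j
    by (simp add: w_def field_simps)
  have inC: "q x y j a \<in> C" "q x y j a \<in> mball_of m x e'" if "x \<in> B" "y \<in> mspace m" "mdist m x y < r" for x y j a
  proof -
    have "(1/2::real)^j > 0" by simp
    then have "\<theta> / 2 * (1 - (1/2)^j) \<le> \<theta> / 2 * 1" using \<open>\<theta> > 0\<close> by (intro mult_left_mono) auto
    moreover have "e' = e + \<theta>" by (simp add: \<theta>_def)
    moreover have "mdist m x (q x y j a) < e + \<theta> / 2 * (1 - (1/2)^j)" using q[OF that] by blast
    ultimately have "mdist m x (q x y j a) < e'" using \<open>\<theta> > 0\<close> by linarith
    then show "q x y j a \<in> mball_of m x e'" using q[OF that, of j a] that(1) Bm by auto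
    then show "q x y j a \<in> C" using that(1) by (auto simp: C_def nbhd_def)
  qed
  have q_refine: "mdist m (q x y (Suc j) i) (q x y j (i div n j)) < w j" "q x y (Suc j) (i * n j) = q x y j i"
    if "x \<in> B" "y \<in> mspace m" "mdist m x y < r" for x y j i
  proof -
    have "i mod n j < n j" using n by simp
    then have "q x y (Suc j) i \<in> mball_of m (q x y j (i div n j)) (w j)"
      unfolding q_Suc using q[OF that] inC[OF that] by (intro ch(3)) auto
    then show "mdist m (q x y (Suc j) i) (q x y j (i div n j)) < w j" by (simp add: mdist_commute)
    show "q x y (Suc j) (i * n j) = q x y j i"
      unfolding q_Suc using q[OF that] inC[OF that] n[of j] ch(1) by simp
  qed
  \<comment> \<open>every point of the k-th subdivision has a nearby point of the j-th one with no later time\<close>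
  have ancestor: "\<exists>i'. i' * N k \<le> i * N j \<and> mdist m (q x y k i) (q x y j i') \<le> \<theta> / 2 * (1/2)^j"
    if xy: "x \<in> B" "y \<in> mspace m" "mdist m x y < r" for x y j k i
  proof (cases "k \<le> j")
    case True
    have "\<exists>i'. i' * N k = i * N j \<and> q x y k i = q x y j i'"
      using True
    proof (induction j rule: dec_induct)
      case (step j)
      then obtain i' where "i' * N k = i * N j" "q x y k i = q x y j i'" by blast
      then show ?case using q_refine(2)[OF xy, of j i']
        by (intro exI[of _ "i' * n j"]) (simp add: N_Suc algebra_simps)
    qed blast
    then obtain i' where "i' * N k = i * N j" "q x y k i = q x y j i'" by blast
    moreover have "q x y j i' \<in> mspace m" using q[OF xy] by blast
    ultimately show ?thesis using \<open>\<theta> > 0\<close> by (intro exI[of _ i']) simp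
  next
    case False
    then have "j \<le> k" by simp
    then have "\<exists>i'. i' * N k \<le> i * N j \<and> mdist m (q x y k i) (q x y j i') \<le> \<theta> / 2 * (1/2)^j - \<theta> / 2 * (1/2)^k"
    proof (induction k arbitrary: i rule: dec_induct)
      case base
      then show ?case using q[OF xy] by (intro exI[of _ i]) auto
    next
      case (step k)
      obtain i' where i': "i' * N k \<le> i div n k * N j"
        "mdist m (q x y k (i div n k)) (q x y j i') \<le> \<theta> / 2 * (1/2)^j - \<theta> / 2 * (1/2)^k"
        using step.IH by blast
      have "i' * N (Suc k) \<le> i div n k * n k * N j"
        using mult_le_mono1[OF i'(1), of "n k"] by (simp add: N_Suc algebra_simps)
      also have "\<dots> \<le> i * N j" by (intro mult_le_mono1) simp
      finally have "i' * N (Suc k) \<le> i * N j" .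
      moreover have "mdist m (q x y (Suc k) i) (q x y j i') \<le> \<theta> / 2 * (1/2)^j - \<theta> / 2 * (1/2)^Suc k"
        using mdist_le_via(1)[of "q x y (Suc k) i" m "q x y k (i div n k)" "q x y j i'"] q[OF xy]
          q_refine(1)[OF xy, of k i] i'(2) w_telescope[of k] by force
      ultimately show ?case by blast
    qed
    moreover have "\<theta> / 2 * (1/2)^k > 0" using \<open>\<theta> > 0\<close> by simp
    ultimately show ?thesis by (smt (verit))
  qed
  define G where "G t x = {q x y j i |y j i. y \<in> mspace m \<and> mdist m x y < r \<and> real i \<le> t * real (N j)}"
    for t :: real and x
  show ?thesis
  proof (rule that[of G])
    fix x assume x: "x \<in> B"
    have "q x y j i = x" if "y \<in> mspace m" "mdist m x y < r" "real i \<le> 0 * N j" for y j i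
      using q[OF x that(1,2), of j 0] that(3) by simp
    moreover have "q x x 0 0 = x" "x \<in> mspace m" using q[OF x, of x 0 0] x Bm \<open>r > 0\<close> by auto
    ultimately show "G 0 x = {x}"
      unfolding G_def using \<open>r > 0\<close> by (auto intro!: exI[of _ x] exI[of _ "0::nat"])
  next
    fix t x assume "x \<in> B"
    then show "G t x \<subseteq> mball_of m x e'" unfolding G_def using inC(2) by blast
  next
    fix x y assume "x \<in> B" "y \<in> mspace m" "mdist m x y < r"
    moreover from this have "q x y 0 (N 0) = y" using q by blast
    ultimately show "y \<in> G 1 x" unfolding G_def
      by (intro CollectI exI[of _ y] exI[of _ "0::nat"] exI[of _ "N 0"]) simp
  next
    fix s t x assume "(s::real) \<le> t"
    then have "s * N j \<le> t * N j" for j by (intro mult_right_mono) auto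
    then show "G s x \<subseteq> G t x" unfolding G_def using order_trans by blast
  next
    fix \<xi> :: real assume "\<xi> > 0"
    obtain j where j: "(1/2::real)^j < \<xi> / \<theta>"
      using real_arch_pow_inv[of "\<xi> / \<theta>" "1/2"] \<open>\<xi> > 0\<close> \<open>\<theta> > 0\<close> by auto
    have small: "\<theta> / 2 * (1/2)^j + \<eta> j < \<xi>"
    proof -
      have "\<eta> j \<le> \<theta> / 4 * (1/2)^j" by (simp add: \<eta>_def w_def)
      moreover have "\<theta> * (1/2)^j < \<xi>" using j \<open>\<theta> > 0\<close> by (simp add: field_simps)
      moreover have "\<theta> * (1/2)^j > 0" using \<open>\<theta> > 0\<close> by simp
      ultimately show ?thesis by linarith
    qed
    show "\<exists>\<sigma>>0. \<forall>x\<in>B. \<forall>s t. 0 \<le> s \<and> s \<le> t \<and> t - s \<le> \<sigma> \<longrightarrow> near_to m \<xi> (G t x) (G s x)"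
    proof (intro exI[of _ "1 / N j"] conjI ballI allI impI)
      show "1 / real (N j) > 0" using N_pos by simp
    next
      fix x s t assume x: "x \<in> B" and st: "0 \<le> s \<and> s \<le> t \<and> t - s \<le> 1 / real (N j)"
      show "near_to m \<xi> (G t x) (G s x)"
        unfolding near_to_def
      proof
        fix u assume "u \<in> G t x"
        then obtain y k i where y: "y \<in> mspace m" "mdist m x y < r" and i: "real i \<le> t * N k" and u: "u = q x y k i"
          unfolding G_def by blast
        note xy = x y
        obtain i' where i': "i' * N k \<le> i * N j" "mdist m u (q x y j i') \<le> \<theta> / 2 * (1/2)^j"
          using ancestor[OF xy] u by blast
        have "real i' * N k \<le> real i * N j" using i'(1) by (metis of_nat_le_iff of_nat_mult)
        also have "\<dots> \<le> t * N k * N j" using i by (intro mult_right_mono) auto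
        finally have "real i' \<le> t * N j" using N_pos[of k] by (simp add: field_simps)
        moreover have "t * N j - s * N j \<le> 1"
          using st N_pos[of j] mult_right_mono[of "t - s" "1 / N j" "N j"] by (simp add: left_diff_distrib)
        ultimately have "real (i' - 1) \<le> s * N j" using st by (cases i') auto
        then have "q x y j (i' - 1) \<in> G s x" unfolding G_def using y by blast
        moreover have "mdist m u (q x y j (i' - 1)) < \<xi>"
        proof (cases i')
          case 0
          then show ?thesis using i'(2) small \<eta>[of j] by simp
        next
          case (Suc a)
          then show ?thesis
            using i'(2) small q[OF xy, of j a] mdist_le_via(3)[of u m "q x y j i'" "q x y j a"]
              q[OF xy, of j i'] q[OF xy, of k i] u by auto
        qed
        ultimately show "\<exists>v\<in>G s x. mdist m u v < \<xi>" by blast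
      qed
    qed
  qed
qed

lemma equireach_mono:
  assumes "equireach m B r e" "r' \<le> r" "B' \<subseteq> B" "e \<le> e'"
  shows "equireach m B' r' e'"
  unfolding equireach_def
proof (intro allI impI)
  fix \<eta> :: real assume "\<eta> > 0"
  then obtain n where n: "\<forall>x\<in>B. \<forall>y\<in>mspace m. mdist m x y < r \<longrightarrow> chain m \<eta> n (mball_of m x e) x y"
    using assms(1) unfolding equireach_def by blast
  have "mball_of m x e \<subseteq> mball_of m x e'" for x using assms(4) by auto
  then have "\<forall>x\<in>B'. \<forall>y\<in>mspace m. mdist m x y < r' \<longrightarrow> chain m \<eta> n (mball_of m x e') x y"
    using n assms(2,3) by (meson chain_weaken order_refl order_less_le_trans subsetD)
  then show "\<exists>n. \<forall>x\<in>B'. \<forall>y\<in>mspace m. mdist m x y < r' \<longrightarrow> chain m \<eta> n (mball_of m x e') x y" ..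
qed

lemma powr2_floor_log:
  fixes t :: real assumes "t > 0"
  obtains k :: int where "2 powr k \<le> t" "t < 2 * 2 powr k"
proof
  have "2 powr \<lfloor>log 2 t\<rfloor> \<le> 2 powr log 2 t" by (intro powr_mono) auto
  then show "2 powr \<lfloor>log 2 t\<rfloor> \<le> t" using assms by simp
  have "2 powr log 2 t < 2 powr (1 + \<lfloor>log 2 t\<rfloor>)" by (intro powr_less_mono) linarith+
  then show "t < 2 * 2 powr \<lfloor>log 2 t\<rfloor>" using assms by (simp add: powr_add)
qed

text \<open>
  The set \<open>g t x\<close> grows from \<open>{x}\<close> and contains the \<open>t\<close>-ball around \<open>x\<close> as long as the chain condition permits,
  which is where \<open>equireach\<close> enters. Its modulus of continuity in \<open>t\<close> is common to all \<open>x\<close> in \<open>B\<close>; this is what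
  makes unions over infinitely many points and sets continuous.
\<close>

definition growth_on :: "'a metric \<Rightarrow> 'a set \<Rightarrow> (real \<Rightarrow> 'a \<Rightarrow> 'a set) \<Rightarrow> bool" where
  "growth_on m B g \<longleftrightarrow> (\<forall>x\<in>B. g 0 x = {x}) \<and> (\<forall>s t x. s \<le> t \<longrightarrow> g s x \<subseteq> g t x) \<and>
    (\<forall>t r e x y. 0 < t \<and> equireach m B r e \<and> 2 * t \<le> r \<and> x \<in> B \<and> y \<in> mspace m \<and> mdist m x y < t \<longrightarrow> y \<in> g t x) \<and>
    (\<forall>\<tau>. \<exists>e. \<forall>x\<in>B. \<forall>t\<le>\<tau>. g t x \<subseteq> mball_of m x e) \<and>
    (\<forall>\<tau> \<xi>. 0 < \<xi> \<longrightarrow> (\<exists>\<sigma>>0. \<forall>x\<in>B. \<forall>s t. 0 \<le> s \<and> s \<le> t \<and> t \<le> \<tau> \<and> t - s \<le> \<sigma> \<longrightarrow>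
       near_to m \<xi> (g t x) (g s x)))"

lemma growth_onD:
  assumes "growth_on m B g"
  shows "x \<in> B \<Longrightarrow> g 0 x = {x}" "s \<le> t \<Longrightarrow> g s x \<subseteq> g t x"
    "\<lbrakk>0 < t; equireach m B r e; 2 * t \<le> r; x \<in> B; y \<in> mspace m; mdist m x y < t\<rbrakk> \<Longrightarrow> y \<in> g t x"
    "\<exists>e. \<forall>x\<in>B. \<forall>t\<le>\<tau>. g t x \<subseteq> mball_of m x e"
    "\<xi> > 0 \<Longrightarrow> \<exists>\<sigma>>0. \<forall>x\<in>B. \<forall>s t. 0 \<le> s \<and> s \<le> t \<and> t \<le> \<tau> \<and> t - s \<le> \<sigma> \<longrightarrow> near_to m \<xi> (g t x) (g s x)"
proof -
  note c = assms[unfolded growth_on_def]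
  show "x \<in> B \<Longrightarrow> g 0 x = {x}" using c[THEN conjunct1] by blast
  show "s \<le> t \<Longrightarrow> g s x \<subseteq> g t x" using c[THEN conjunct2, THEN conjunct1] by simp
  show "\<lbrakk>0 < t; equireach m B r e; 2 * t \<le> r; x \<in> B; y \<in> mspace m; mdist m x y < t\<rbrakk> \<Longrightarrow> y \<in> g t x"
    by (rule c[THEN conjunct2, THEN conjunct2, THEN conjunct1, rule_format, of t r e]) simp
  show "\<exists>e. \<forall>x\<in>B. \<forall>t\<le>\<tau>. g t x \<subseteq> mball_of m x e"
    by (rule c[THEN conjunct2, THEN conjunct2, THEN conjunct2, THEN conjunct1, THEN spec])
  show "\<xi> > 0 \<Longrightarrow> \<exists>\<sigma>>0. \<forall>x\<in>B. \<forall>s t. 0 \<le> s \<and> s \<le> t \<and> t \<le> \<tau> \<and> t - s \<le> \<sigma> \<longrightarrow> near_to m \<xi> (g t x) (g s x)"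
    by (rule c[THEN conjunct2, THEN conjunct2, THEN conjunct2, THEN conjunct2, rule_format])
qed

text \<open>
  Superpose growths of fixed radii \<open>2 * 2 powr k\<close> for all integers \<open>k\<close>, the \<open>k\<close>-th starting at time \<open>2 powr (k - 1)\<close> and
  complete at time \<open>2 powr k\<close>. For small \<open>k\<close> they move little, by local equichainedness, and for large \<open>k\<close>
  they have not started yet. So in a bounded range of times only finitely many \<open>k\<close> matter.
\<close>

lemma growth:
  fixes m :: "'a metric"
  assumes lec: "locally_equichained m" and B: "mbounded_of m B"
  shows "\<exists>g. growth_on m B g"
proof -
  have Bm: "B \<subseteq> mspace m" using B by (simp add: mbounded_of_iff)
  define \<rho> :: "int \<Rightarrow> real" where "\<rho> k = 2 powr k" for k
  have \<rho>: "\<rho> k > 0" "\<rho> (k - 1) = \<rho> k / 2" for k by (simp_all add: \<rho>_def powr_diff)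
  have \<rho>_mono: "\<rho> k \<le> \<rho> l \<longleftrightarrow> k \<le> l" for k l by (simp add: \<rho>_def)
  have \<rho>_large: "\<exists>k. \<tau> \<le> \<rho> (k - 1)" for \<tau>
  proof -
    have "max 1 \<tau> > 0" by simp
    then obtain k :: int where "max 1 \<tau> < 2 * 2 powr k" by (rule powr2_floor_log)
    then have "max 1 \<tau> < 2 * \<rho> k" by (simp add: \<rho>_def)
    then have "\<tau> \<le> \<rho> (k + 2 - 1)" using \<rho>(2)[of "k + 1"] by (simp add: add.commute)
    then show ?thesis by blast
  qed
  \<comment> \<open>the tightest radius containing the chains of level k, up to an error that vanishes as k decreases\<close>
  have "\<exists>E>0. ((\<exists>e. equireach m B (2 * \<rho> k) e) \<longrightarrow> equireach m B (2 * \<rho> k) E) \<and>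
      (\<forall>e>0. equireach m B (2 * \<rho> k) e \<longrightarrow> E \<le> e + \<rho> k) \<and> ((\<nexists>e. equireach m B (2 * \<rho> k) e) \<longrightarrow> E = \<rho> k)" for k
  proof (cases "\<exists>e. equireach m B (2 * \<rho> k) e")
    case True
    define S where "S = {e. e > 0 \<and> equireach m B (2 * \<rho> k) e}"
    obtain e where "equireach m B (2 * \<rho> k) e" using True by blast
    then have "max 1 e \<in> S" unfolding S_def using equireach_mono[of m B _ e] by simp
    moreover have "bdd_below S" unfolding S_def by (auto intro: bdd_belowI[of _ 0])
    ultimately obtain E where "E \<in> S" "E < Inf S + \<rho> k"
      using cInf_lessD[of S "Inf S + \<rho> k"] \<rho>(1)[of k] by auto
    moreover have "Inf S \<le> e" if "e \<in> S" for e using \<open>bdd_below S\<close> that by (rule cInf_lower[rotated])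
    ultimately show ?thesis using True unfolding S_def by fastforce
  next
    case False
    then show ?thesis using \<rho>(1)[of k] by (intro exI[of _ "\<rho> k"]) auto
  qed
  then obtain E where E: "\<And>k. E k > 0" "\<And>k e. equireach m B (2 * \<rho> k) e \<Longrightarrow> equireach m B (2 * \<rho> k) (E k)"
    "\<And>k e. \<lbrakk>e > 0; equireach m B (2 * \<rho> k) e\<rbrakk> \<Longrightarrow> E k \<le> e + \<rho> k"
    "\<And>k. (\<nexists>e. equireach m B (2 * \<rho> k) e) \<Longrightarrow> E k = \<rho> k"
    by metis
  define D where "D k = E k + \<rho> k" for k
  have D_small: "\<exists>K. \<forall>k\<le>K. D k \<le> \<xi>" if \<xi>: "\<xi> > 0" for \<xi>
  proof -
    have "equichained m B (\<xi> / 2)" using lec B \<xi> unfolding locally_equichained_def by simp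
    then obtain \<delta> where "\<delta> > 0" and \<delta>: "equireach m B \<delta> (\<xi> / 2)"
      unfolding equichained_def by blast
    have "min (\<xi> / 4) (\<delta> / 2) > 0" using \<xi> \<open>\<delta> > 0\<close> by simp
    then obtain K :: int where K: "2 powr K \<le> min (\<xi> / 4) (\<delta> / 2)" by (rule powr2_floor_log)
    have "D k \<le> \<xi>" if "k \<le> K" for k
    proof -
      have k: "\<rho> k \<le> \<xi> / 4" "2 * \<rho> k \<le> \<delta>" using K \<rho>_mono[of k K] that unfolding \<rho>_def by linarith+
      then have "equireach m B (2 * \<rho> k) (\<xi> / 2)" using equireach_mono[OF \<delta>] by simp
      then have "E k \<le> \<xi> / 2 + \<rho> k" using E(3) \<xi> by simp
      then show ?thesis using k by (simp add: D_def)
    qed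
    then show ?thesis by blast
  qed
  define level where "level k G \<longleftrightarrow> (\<forall>x\<in>B. G 0 x = {x}) \<and> (\<forall>x\<in>B. \<forall>t. G t x \<subseteq> mball_of m x (D k)) \<and>
     (\<forall>e. equireach m B (2 * \<rho> k) e \<longrightarrow> (\<forall>x\<in>B. \<forall>y\<in>mspace m. mdist m x y < 2 * \<rho> k \<longrightarrow> y \<in> G 1 x)) \<and>
     (\<forall>x s t. s \<le> t \<longrightarrow> G s x \<subseteq> G t x) \<and>
     (\<forall>\<xi>>0. \<exists>\<sigma>>0. \<forall>x\<in>B. \<forall>s t. 0 \<le> s \<and> s \<le> t \<and> t - s \<le> \<sigma> \<longrightarrow> near_to m \<xi> (G t x) (G s x))"
    for k and G :: "real \<Rightarrow> 'a \<Rightarrow> 'a set"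
  have "\<exists>G. level k G" for k
  proof (cases "\<exists>e. equireach m B (2 * \<rho> k) e")
    case True
    then have reach: "equireach m B (2 * \<rho> k) (E k)" using E(2) by blast
    have "E k < D k" using \<rho>(1)[of k] by (simp add: D_def)
    have "2 * \<rho> k > 0" using \<rho>(1) by simp
    show ?thesis
    proof (rule growth_of_fixed_radius[OF lec B reach \<open>E k < D k\<close> \<open>2 * \<rho> k > 0\<close>], goal_cases)
      case (1 G)
      show ?case unfolding level_def by (intro exI[of _ G] conjI allI ballI impI; rule 1; assumption)
    qed
  next
    case False
    have "D k > 0" using E(1)[of k] \<rho>(1)[of k] by (simp add: D_def)
    then show ?thesis
      using False Bm unfolding level_def by (intro exI[of _ "\<lambda>t x. {x}"]) (auto simp: near_to_def subset_iff intro!: exI[of _ 1])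
  qed
  then have "\<exists>G. \<forall>k. level k (G k)" by (intro choice allI)
  then obtain G where level: "\<And>k. level k (G k)" by blast
  note level' = level[unfolded level_def]
  note G0 = level'[THEN conjunct1, rule_format]
    and G_ball = level'[THEN conjunct2, THEN conjunct1, rule_format]
    and G_covers = level'[THEN conjunct2, THEN conjunct2, THEN conjunct1, rule_format]
    and G_mono = level'[THEN conjunct2, THEN conjunct2, THEN conjunct2, THEN conjunct1, rule_format]
    and G_equi = level'[THEN conjunct2, THEN conjunct2, THEN conjunct2, THEN conjunct2, rule_format]
  define h where "h k t = max 0 (min 1 (t / \<rho> (k - 1) - 1))" for k t
  have h_mono: "h k s \<le> h k t" if "s \<le> t" for k s t
    using divide_right_mono[OF that, of "\<rho> (k - 1)"] \<rho>(1)[of "k - 1"] by (auto simp: h_def)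
  have h_0: "h k t = 0" if "t \<le> \<rho> (k - 1)" for k t
    using that \<rho>(1)[of "k - 1"] by (simp add: h_def divide_le_eq)
  have h_1: "h k t = 1" if "\<rho> k \<le> t" for k t
    using that \<rho>[of k] by (simp add: h_def field_simps)
  have h_diff: "h k t - h k s \<le> (t - s) / \<rho> (k - 1)" if "s \<le> t" for k s t
  proof -
    have "s / \<rho> (k - 1) \<le> t / \<rho> (k - 1)" using that \<rho>(1)[of "k - 1"] by (simp add: divide_right_mono)
    then show ?thesis by (auto simp: h_def diff_divide_distrib)
  qed
  define g where "g t x = (\<Union>k. G k (h k t) x)" for t x
  have g_self: "x \<in> g t x" if "x \<in> B" for t x
  proof -
    have "x \<in> G 0 0 x" using G0 that by simp
    moreover have "0 \<le> h 0 t" by (simp add: h_def)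
    ultimately have "x \<in> G 0 (h 0 t) x" using G_mono by blast
    then show ?thesis unfolding g_def by blast
  qed
  show ?thesis
    unfolding growth_on_def
  proof (intro exI[of _ g] conjI allI ballI impI)
    fix x assume "x \<in> B"
    moreover have "h k 0 = 0" for k using \<rho>(1)[of "k - 1"] by (intro h_0) simp
    ultimately show "g 0 x = {x}" unfolding g_def using G0 by simp
  next
    fix s t x assume "(s::real) \<le> t"
    then show "g s x \<subseteq> g t x" unfolding g_def by (intro UN_mono G_mono h_mono order_refl)
  next
    fix t r e x y
    assume "0 < t \<and> equireach m B r e \<and> 2 * t \<le> r \<and> x \<in> B \<and> y \<in> mspace m \<and> mdist m x y < t"
    then have t: "0 < t" and reach: "equireach m B r e" "2 * t \<le> r"
      and xy: "x \<in> B" "y \<in> mspace m" "mdist m x y < t" by simp_all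
    obtain k where k: "\<rho> k \<le> t" "t < 2 * \<rho> k" unfolding \<rho>_def using powr2_floor_log[OF t] .
    have "equireach m B (2 * \<rho> k) e" using reach k by (intro equireach_mono[OF reach(1)]) auto
    then have "y \<in> G k 1 x" using xy k by (intro G_covers) auto
    then show "y \<in> g t x" unfolding g_def using h_1[OF k(1)] by (metis UNIV_I UN_I)
  next
    fix \<tau> :: real
    obtain K0 where K0: "\<And>k. k \<le> K0 \<Longrightarrow> D k \<le> 1" using D_small[of 1] by auto
    obtain K1 where K1: "\<tau> \<le> \<rho> (K1 - 1)"
      using \<rho>_large by blast
    define e where "e = Max (insert 1 (D ` {K0..K1}))"
    have e: "D k \<le> e" if "k \<in> {K0..K1}" for k unfolding e_def by (rule Max_ge) (use that in auto)
    have "1 \<le> e" unfolding e_def by (rule Max_ge) auto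
    have "g t x \<subseteq> mball_of m x e" if "x \<in> B" "t \<le> \<tau>" for x t
      unfolding g_def
    proof (rule UN_least)
      fix k
      consider "k \<le> K0" | "k \<in> {K0..K1}" | "k > K1" by force
      then show "G k (h k t) x \<subseteq> mball_of m x e"
      proof cases
        case 3
        then have "\<rho> (K1 - 1) \<le> \<rho> (k - 1)" using \<rho>_mono by simp
        then have "h k t = 0" using that K1 by (intro h_0) linarith
        then show ?thesis using G0[OF that(1)] that(1) Bm \<open>1 \<le> e\<close> by auto
      qed (use G_ball[OF that(1), of k "h k t"] K0 e \<open>1 \<le> e\<close> in fastforce)+
    qed
    then show "\<exists>e. \<forall>x\<in>B. \<forall>t\<le>\<tau>. g t x \<subseteq> mball_of m x e" by blast
  next
    fix \<tau> \<xi> :: real assume \<xi>: "\<xi> > 0"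
    obtain K0 where K0: "\<And>k. k \<le> K0 \<Longrightarrow> D k \<le> \<xi>" using D_small[OF \<xi>] by auto
    obtain K1 where K1: "\<tau> \<le> \<rho> (K1 - 1)"
      using \<rho>_large by blast
    obtain \<sigma> where \<sigma>: "\<And>k. \<sigma> k > 0" and \<sigma>_near: "\<And>k x s t. \<lbrakk>x \<in> B; 0 \<le> s; s \<le> t; t - s \<le> \<sigma> k\<rbrakk> \<Longrightarrow> near_to m \<xi> (G k t x) (G k s x)"
      using G_equi[OF \<xi>] by metis
    define \<sigma>' where "\<sigma>' = Min (insert 1 ((\<lambda>k. \<sigma> k * \<rho> (k - 1)) ` {K0..K1}))"
    have "\<sigma>' > 0" unfolding \<sigma>'_def using \<sigma> \<rho>(1) by auto
    have \<sigma>': "\<sigma>' \<le> \<sigma> k * \<rho> (k - 1)" if "k \<in> {K0..K1}" for k unfolding \<sigma>'_def using that by (intro Min_le) auto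
    have "near_to m \<xi> (g t x) (g s x)" if x: "x \<in> B" and st: "0 \<le> s" "s \<le> t" "t \<le> \<tau>" "t - s \<le> \<sigma>'" for x s t
      unfolding near_to_def
    proof
      fix y assume "y \<in> g t x"
      then obtain k where k: "y \<in> G k (h k t) x" unfolding g_def by blast
      consider "k \<le> K0" | "k \<in> {K0..K1}" | "k > K1" by force
      then show "\<exists>u\<in>g s x. mdist m y u < \<xi>"
      proof cases
        case 1
        then have "mdist m y x < \<xi>" using k G_ball[OF x, of k "h k t"] K0[of k] by (auto simp: mdist_commute)
        then show ?thesis using g_self[OF x] by blast
      next
        case 2
        have "h k t - h k s \<le> \<sigma> k"
          using h_diff[OF st(2), of k] st(4) \<sigma>'[OF 2] \<rho>(1)[of "k - 1"]
          by (meson divide_right_mono less_imp_le order_trans pos_divide_le_eq)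
        moreover have "0 \<le> h k s" by (simp add: h_def)
        ultimately have "near_to m \<xi> (G k (h k t) x) (G k (h k s) x)"
          using h_mono[OF st(2)] by (intro \<sigma>_near x)
        then show ?thesis using k unfolding near_to_def g_def by blast
      next
        case 3
        then have "\<rho> (K1 - 1) \<le> \<rho> (k - 1)" using \<rho>_mono by simp
        then have "h k t = 0" using st K1 by (intro h_0) linarith
        then have "y = x" using k G0[OF x] by simp
        then show ?thesis using g_self[OF x] x Bm \<xi> by (intro bexI[of _ x]) auto
      qed
    qed
    then show "\<exists>\<sigma>>0. \<forall>x\<in>B. \<forall>s t. 0 \<le> s \<and> s \<le> t \<and> t \<le> \<tau> \<and> t - s \<le> \<sigma> \<longrightarrow> near_to m \<xi> (g t x) (g s x)"
      using \<open>\<sigma>' > 0\<close> by blast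
  qed
qed

section \<open>Retractions onto the hyperspace\<close>

definition setdist_in :: "'n metric \<Rightarrow> 'n set \<Rightarrow> 'n \<Rightarrow> real" where
  "setdist_in N S z = (INF s\<in>S. mdist N z s)"

definition integer_radius :: "'a metric \<Rightarrow> 'a \<Rightarrow> 'a set \<Rightarrow> nat" where
  "integer_radius m x0 A = (LEAST R. A \<subseteq> mcball_of m x0 (real R))"

text \<open>
  What paths between arbitrary bounded closed sets require of the points. The chains must stay in one bounded set
  because the sets on a path of bounded sets have a bounded union.
\<close>

definition boundedly_chained :: "'a metric \<Rightarrow> bool" where
  "boundedly_chained m \<longleftrightarrow> (\<forall>B. mbounded_of m B \<longrightarrow>
     (\<exists>B'. mbounded_of m B' \<and> (\<forall>\<eta>>0. \<exists>n. \<forall>x\<in>B. \<forall>y\<in>B. chain m \<eta> n B' x y)))"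

lemma setdist_in_bdd: "bdd_below (mdist N z ` S)"
  by (intro bdd_belowI[of _ 0]) auto

lemma setdist_in_le: "s \<in> S \<Longrightarrow> setdist_in N S z \<le> mdist N z s"
  unfolding setdist_in_def by (rule cINF_lower[OF setdist_in_bdd])

lemma setdist_in_nonneg: "S \<noteq> {} \<Longrightarrow> 0 \<le> setdist_in N S z"
  unfolding setdist_in_def by (rule cINF_greatest) auto

lemma setdist_in_approx:
  assumes "S \<noteq> {}" "setdist_in N S z < c" obtains s where "s \<in> S" "mdist N z s < c"
  using assms unfolding setdist_in_def by (auto simp: cINF_less_iff[OF _ setdist_in_bdd])

lemma setdist_in_Lipschitz:
  assumes "S \<noteq> {}" "S \<subseteq> mspace N" "z \<in> mspace N" "w \<in> mspace N"
  shows "setdist_in N S z \<le> setdist_in N S w + mdist N z w"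
proof (rule field_le_epsilon)
  fix e :: real assume "e > 0"
  then obtain s where s: "s \<in> S" "mdist N w s < setdist_in N S w + e"
    using setdist_in_approx[OF assms(1), of N w "setdist_in N S w + e"] by auto
  have "setdist_in N S z \<le> mdist N z s" using s(1) by (rule setdist_in_le)
  also have "\<dots> \<le> mdist N z w + mdist N w s" using s assms by (intro mdist_triangle) auto
  finally show "setdist_in N S z \<le> setdist_in N S w + mdist N z w + e" using s by simp
qed

lemma setdist_in_pos:
  assumes "closedin (mtopology_of N) S" "S \<noteq> {}" "z \<in> mspace N" "z \<notin> S"
  shows "0 < setdist_in N S z"
proof -
  interpret Metric_space "mspace N" "mdist N" by (rule Metric_space_mspace_mdist)
  obtain r where r: "r > 0" "disjnt S (mball z r)"
    using assms unfolding mtopology_of_def closedin_metric by blast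
  have "S \<subseteq> mspace N" using closedin_subset[OF assms(1)] by simp
  then have "r \<le> mdist N z s" if "s \<in> S" for s
    using r that assms(3) by (force simp: disjnt_iff not_less[symmetric])
  then have "r \<le> setdist_in N S z" unfolding setdist_in_def using assms(2) by (intro cINF_greatest)
  then show ?thesis using r by simp
qed

lemma integer_radius:
  assumes "A \<in> closed_bounded_nonempty m" "x0 \<in> mspace m"
  shows "A \<subseteq> mcball_of m x0 (integer_radius m x0 A)"
  unfolding integer_radius_def
proof (rule LeastI_ex)
  obtain K a where K: "\<forall>x\<in>A. \<forall>y\<in>A. mdist m x y \<le> K" and a: "a \<in> A" and A: "A \<subseteq> mspace m"
    using hyperspace_memD[OF assms(1)] unfolding mbounded_of_iff by blast
  obtain R :: nat where R: "mdist m x0 a + K \<le> real R" using real_arch_simple by blast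
  have "y \<in> mcball_of m x0 (real R)" if "y \<in> A" for y
    using mdist_le_via(1)[of x0 m a y] K a A that R assms(2) by fastforce
  then show "\<exists>R. A \<subseteq> mcball_of m x0 (real R)" by blast
qed

lemma integer_radius_near:
  assumes A: "A \<in> closed_bounded_nonempty m" and B: "B \<in> closed_bounded_nonempty m" and "x0 \<in> mspace m"
    and H: "mdist (bounded_hyperspace m) A B < real n"
  shows "integer_radius m x0 A \<le> integer_radius m x0 B + n"
  unfolding integer_radius_def[of m x0 A]
proof (rule Least_le, rule subsetI)
  fix y assume y: "y \<in> A"
  then obtain b where b: "b \<in> B" "mdist m y b < real n"
    using near_to_if_Hausdorff_less[OF A B H] unfolding near_to_def by blast
  have "mdist m x0 b \<le> integer_radius m x0 B" "b \<in> mspace m" using integer_radius[OF B assms(3)] b by auto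
  then show "y \<in> mcball_of m x0 (real (integer_radius m x0 B + n))"
    using mdist_le_via(3)[of x0 m b y] b y hyperspace_memD(1)[OF A] assms(3) by auto
qed

lemma mbounded_of_mcball: "mbounded_of m (mcball_of m x r)"
  by (simp add: Metric_space.mbounded_mcball mcball_of_def)

text \<open>
  A variant of Dugundji's extension formula in which joins replace convex combinations. With \<open>D z\<close> the distance
  of \<open>z\<close> to the embedded hyperspace, \<open>z\<close> is sent to the closure of the union of the sets grown for the
  time \<open>8 * (2 * D z - d)\<close> from all closed sets \<open>a\<close> at distance \<open>d < 2 * D z\<close> from \<open>z\<close>.

  When \<open>a\<close> drops out of this union its growth time has decreased to zero, so it contributes just \<open>a\<close>.
  At that moment \<open>a\<close> is already covered, namely by the growth of any \<open>k\<close> at distance less than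
  \<open>7/5 * D z\<close>, whose growth time exceeds the distance of \<open>a\<close> and \<open>k\<close>. Hence nothing jumps, and since all
  growths near \<open>z\<close> have a common modulus of continuity, the map is continuous off the hyperspace
  although infinitely many sets contribute. Near an embedded set \<open>A\<close> all contributing sets
  are close to \<open>A\<close> and grow for a short time only, which gives continuity there.
\<close>

lemma hyperspace_retraction:
  fixes m :: "'a metric" and N :: "'n metric"
  assumes lec: "locally_equichained m" and emb: "closed_isometric_embedding (bounded_hyperspace m) N e"
    and x0: "x0 \<in> mspace m" and U: "U \<subseteq> mspace N" "e ` closed_bounded_nonempty m \<subseteq> U"
    and reach: "\<And>z a. \<lbrakk>z \<in> U - e ` closed_bounded_nonempty m; a \<in> closed_bounded_nonempty m;
       mdist N z (e a) < 2 * setdist_in N (e ` closed_bounded_nonempty m) z\<rbrakk> \<Longrightarrow>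
       \<exists>E. equireach m (mcball_of m x0 (integer_radius m x0 a)) (16 * setdist_in N (e ` closed_bounded_nonempty m) z) E"
  shows "e ` closed_bounded_nonempty m retract_of_space subtopology (mtopology_of N) U"
proof -
  define Y where "Y = closed_bounded_nonempty m"
  define S where "S = e ` Y"
  define H where "H = mdist (bounded_hyperspace m)"
  define D where "D = setdist_in N S"
  define R where "R = integer_radius m x0"
  define K where "K n = mcball_of m x0 (real n)" for n
  note emb' = closed_isometric_embeddingD[OF emb, unfolded mspace_bounded_hyperspace]
  have iso: "mdist N (e a) (e b) = H a b" if "a \<in> Y" "b \<in> Y" for a b
    using emb'(1) that by (simp add: H_def Y_def)
  have closedS: "closedin (mtopology_of N) S" and SN: "S \<subseteq> mspace N"
    using emb'(2,3) by (simp_all add: S_def Y_def)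
  have eN: "e a \<in> mspace N" if "a \<in> Y" for a using that SN unfolding S_def by blast
  have "mclosure m {x0} \<in> Y" unfolding Y_def
    using x0 by (intro mclosure_in_hyperspace) (auto simp: mbounded_of_iff)
  then have "Y \<noteq> {}" and Sne: "S \<noteq> {}" unfolding S_def by auto
  have zN: "z \<in> mspace N" if "z \<in> U" for z using that U by blast
  have D_le: "D z \<le> mdist N z (e a)" if "a \<in> Y" for z a
    using that unfolding D_def S_def by (intro setdist_in_le) simp
  have D_Lip: "D z \<le> D w + mdist N z w" if "z \<in> U" "w \<in> U" for z w
    unfolding D_def using that zN by (intro setdist_in_Lipschitz Sne SN)
  have D_pos: "0 < D z" if "z \<in> U" "z \<notin> S" for z
    unfolding D_def using that zN by (intro setdist_in_pos closedS Sne) auto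
  have D_approx: "\<exists>a\<in>Y. mdist N z (e a) < c" if "D z < c" for z c
    using setdist_in_approx[OF Sne, of N z c] that unfolding D_def S_def by blast
  have K_bdd: "mbounded_of m (K n)" for n unfolding K_def by (rule mbounded_of_mcball)
  have aK: "a \<subseteq> K (R a)" if "a \<in> Y" for a
    using integer_radius[of a m, OF _ x0] that unfolding K_def R_def Y_def by simp
  have R_near: "R a \<le> R b + n" if "a \<in> Y" "b \<in> Y" "H a b < real n" for a b n
    using that x0 unfolding R_def Y_def H_def by (intro integer_radius_near)
  have near: "near_to m r a b" if "a \<in> Y" "b \<in> Y" "H a b < r" for a b r
    using that unfolding Y_def H_def by (intro near_to_if_Hausdorff_less)
  have H_commute: "H a b = H b a" for a b unfolding H_def by (rule mdist_commute)
  have H_via: "H a b \<le> mdist N z (e a) + mdist N z (e b)" if "a \<in> Y" "b \<in> Y" "z \<in> U" for a b z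
    using mdist_le_via(2)[of "e a" N z "e b"] eN zN that iso by auto
  have H_via2: "H a b \<le> mdist N z (e a) + mdist N z w + mdist N w (e b)"
    if "a \<in> Y" "b \<in> Y" "z \<in> U" "w \<in> U" for a b z w
    using H_via[OF that(1-3)] mdist_le_via(1)[of z N w "e b"] eN zN that by force
  have Ym: "a \<subseteq> mspace m" "a \<noteq> {}" "mbounded_of m a" "mclosure m a = a" if "a \<in> Y" for a
    using hyperspace_memD[of a m] that unfolding Y_def by auto
  have "\<exists>g. growth_on m (K n) g" for n by (rule growth[OF lec K_bdd])
  then have "\<exists>g. \<forall>n. growth_on m (K n) (g n)" by (intro choice allI)
  then obtain g where g: "\<And>n. growth_on m (K n) (g n)" by blast
  note g_0 = growth_onD(1)[OF g] and g_mono = growth_onD(2)[OF g] and g_covers = growth_onD(3)[OF g]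
    and g_bdd = growth_onD(4)[OF g] and g_equi = growth_onD(5)[OF g]
  have modulus: "\<exists>\<sigma>>0. \<forall>n\<le>n0. \<forall>x\<in>K n. \<forall>s t. 0 \<le> s \<and> s \<le> t \<and> t \<le> \<tau> \<and> t - s \<le> \<sigma> \<longrightarrow>
      near_to m \<xi> (g n t x) (g n s x)" if \<xi>: "\<xi> > 0" for n0 \<tau> \<xi>
  proof -
    obtain \<sigma> where \<sigma>: "\<And>n. \<sigma> n > 0" and \<sigma>_near: "\<And>n. \<forall>x\<in>K n. \<forall>s t. 0 \<le> s \<and> s \<le> t \<and> t \<le> \<tau> \<and> t - s \<le> \<sigma> n \<longrightarrow>
      near_to m \<xi> (g n t x) (g n s x)"
      using g_equi[OF \<xi>, where \<tau> = \<tau>] by metis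
    define \<sigma>' where "\<sigma>' = Min (\<sigma> ` {..n0})"
    have "\<sigma>' > 0" unfolding \<sigma>'_def using \<sigma> by auto
    moreover have "\<sigma>' \<le> \<sigma> n" if "n \<le> n0" for n unfolding \<sigma>'_def using that by (intro Min_le) auto
    ultimately show ?thesis using \<sigma>_near by (intro exI[of _ \<sigma>']) (meson order_trans)
  qed
  define T where "T a z = 8 * max 0 (2 * D z - mdist N z (e a))" for a z
  have T_nonneg: "0 \<le> T a z" for a z by (simp add: T_def)
  have T_le: "T a z \<le> 8 * D z" if "a \<in> Y" "z \<in> U" for a z
    using D_le[OF that(1), of z] setdist_in_nonneg[OF Sne, of N z] unfolding T_def D_def by simp
  have T_Lip: "T a z \<le> T a w + 24 * mdist N z w" if "a \<in> Y" "z \<in> U" "w \<in> U" for a z w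
  proof -
    have "2 * D z - mdist N z (e a) \<le> (2 * D w - mdist N w (e a)) + 3 * mdist N z w"
      using D_Lip[OF that(2,3)] mdist_le_via(2)[of w N z "e a"] eN[OF that(1)] zN that(2,3) by simp
    then have "max 0 (2 * D z - mdist N z (e a)) \<le> max 0 (2 * D w - mdist N w (e a)) + 3 * mdist N z w"
      using mdist_nonneg[of N z w] by linarith
    moreover have "8 * u \<le> 8 * v + 24 * h" if "u \<le> v + 3 * h" for u v h :: real using that by simp
    ultimately show ?thesis unfolding T_def by blast
  qed
  define F where "F z = \<Union>{g (R a) (T a z) x |a x. a \<in> Y \<and> mdist N z (e a) < 2 * D z \<and> x \<in> a}" for z
  have F_grow: "g (R a) (T a z) x \<subseteq> F z" if "a \<in> Y" "mdist N z (e a) < 2 * D z" "x \<in> a" for a x z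
    using that unfolding F_def by blast
  have F_self: "a \<subseteq> F z" if "a \<in> Y" "mdist N z (e a) < 2 * D z" for a z
  proof
    fix x assume "x \<in> a"
    then have "x \<in> g (R a) 0 x" using g_0 aK that by blast
    then have "x \<in> g (R a) (T a z) x" using g_mono[OF T_nonneg] by blast
    then show "x \<in> F z" using F_grow that \<open>x \<in> a\<close> by blast
  qed
  have absorb: "a \<subseteq> F z"
    if a: "a \<in> Y" and k: "k \<in> Y" and z: "z \<in> U" "z \<notin> S" and active: "mdist N z (e k) < 2 * D z" and less: "H a k < T k z" for a k z
  proof
    fix x assume x: "x \<in> a"
    then obtain u where u: "u \<in> k" "mdist m u x < T k z"
      using near[OF a k less] unfolding near_to_def by (metis mdist_commute)
    have "z \<in> U - e ` closed_bounded_nonempty m" using z by (simp add: S_def Y_def)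
    then have "\<exists>E. equireach m (K (R k)) (16 * D z) E"
      using k active unfolding K_def R_def D_def S_def Y_def by (rule reach)
    then obtain E where "equireach m (K (R k)) (16 * D z) E" ..
    moreover have "0 < T k z" using u mdist_nonneg[of m u x] by linarith
    moreover have "2 * T k z \<le> 16 * D z" using T_le[OF k z(1)] by simp
    moreover have "u \<in> K (R k)" using aK[OF k] u by blast
    moreover have "x \<in> mspace m" using Ym(1)[OF a] x by blast
    ultimately have "x \<in> g (R k) (T k z) u" using u by (intro g_covers)
    then show "x \<in> F z" using F_grow[OF k active] u by blast
  qed
  have F_bdd: "mbounded_of m (F z)" and F_ne: "F z \<noteq> {}" if z: "z \<in> U" "z \<notin> S" for z
  proof -
    have "D z < 2 * D z" using D_pos[OF z] by simp
    from D_approx[OF this] obtain k where k: "k \<in> Y" "mdist N z (e k) < 2 * D z" by blast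
    then show "F z \<noteq> {}" using F_self[OF k] Ym(2)[OF k(1)] by blast
    obtain n where n: "4 * D z < real n" using reals_Archimedean2 by blast
    have "\<exists>E. \<forall>n. \<forall>x\<in>K n. \<forall>t\<le>8 * D z. g n t x \<subseteq> mball_of m x (E n)" by (intro choice allI g_bdd)
    then obtain E where E: "\<forall>x\<in>K n. \<forall>t\<le>8 * D z. g n t x \<subseteq> mball_of m x (E n)" for n by blast
    define M where "M = Max (E ` {..R k + n})"
    have "F z \<subseteq> nbhd m (K (R k + n)) M"
    proof
      fix y assume "y \<in> F z"
      then obtain a x where a: "a \<in> Y" "mdist N z (e a) < 2 * D z" "x \<in> a" "y \<in> g (R a) (T a z) x"
        unfolding F_def by blast
      have "H a k < real n" using H_via[OF a(1) k(1) z(1)] a k n by simp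
      then have Ra: "R a \<le> R k + n" using R_near a(1) k(1) by blast
      then have "E (R a) \<le> M" unfolding M_def by (intro Max_ge) auto
      moreover have "x \<in> K (R a)" using aK a by blast
      then have "y \<in> mball_of m x (E (R a))" using E T_le[OF a(1) z(1)] a(4) by blast
      moreover have "x \<in> K (R k + n)" using \<open>x \<in> K (R a)\<close> Ra unfolding K_def by auto
      ultimately show "y \<in> nbhd m (K (R k + n)) M" unfolding nbhd_def by fastforce
    qed
    then show "mbounded_of m (F z)" using mbounded_of_nbhd[OF K_bdd] mbounded_of_subset by blast
  qed
  define r where "r z = (if z \<in> S then z else e (mclosure m (F z)))" for z
  have clF: "mclosure m (F z) \<in> Y" if "z \<in> U" "z \<notin> S" for z
    unfolding Y_def using F_bdd[OF that] F_ne[OF that] by (rule mclosure_in_hyperspace)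
  have rS: "r z \<in> S" if "z \<in> U" for z
    using clF[OF that] unfolding r_def S_def by auto
  have near_S: "\<exists>\<delta>>0. \<forall>w\<in>U. mdist N z w < \<delta> \<longrightarrow> mdist N (r z) (r w) < \<xi>"
    if z: "z \<in> S" and \<xi>: "\<xi> > 0" for z \<xi>
  proof -
    obtain A where A: "A \<in> Y" "z = e A" using z unfolding S_def by blast
    have "\<xi> / 4 > 0" using \<xi> by simp
    from modulus[OF this, of "R A + 1" 1]
    obtain \<sigma> where "\<sigma> > 0" and \<sigma>: "\<forall>n\<le>R A + 1. \<forall>x\<in>K n. \<forall>s t. 0 \<le> s \<and> s \<le> t \<and> t \<le> 1 \<and> t - s \<le> \<sigma> \<longrightarrow>
      near_to m (\<xi> / 4) (g n t x) (g n s x)"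
      by (elim exE conjE)
    define \<delta> where "\<delta> = min (\<xi> / 12) (min (\<sigma> / 8) (1 / 8))"
    have \<delta>: "\<delta> > 0" "12 * \<delta> \<le> \<xi>" "8 * \<delta> \<le> \<sigma>" "8 * \<delta> \<le> 1" using \<xi> \<open>\<sigma> > 0\<close> by (auto simp: \<delta>_def)
    have "mdist N (r z) (r w) < \<xi>" if w: "w \<in> U" "mdist N z w < \<delta>" for w
    proof (cases "w \<in> S")
      case True
      then show ?thesis using z w \<delta> by (simp add: r_def)
    next
      case False
      have wA: "mdist N w (e A) < \<delta>" using w A by (simp add: mdist_commute)
      have Dw: "D w < \<delta>" "0 < D w" using D_le[OF A(1), of w] wA D_pos w False by auto
      have close: "H a A < 3 * \<delta>" if "a \<in> Y" "mdist N w (e a) < 2 * D w" for a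
        using H_via[OF that(1) A(1) w(1)] that(2) wA Dw by simp
      have "D w < 2 * D w" using Dw by simp
      from D_approx[OF this] obtain k where k: "k \<in> Y" "mdist N w (e k) < 2 * D w" by blast
      have "near_to m (\<xi> / 2) A k"
        using close[OF k] \<delta> H_commute by (intro near A k) simp
      then have 1: "near_to m (\<xi> / 2) A (F w)"
        using F_self[OF k] unfolding near_to_def by blast
      have 2: "near_to m (\<xi> / 2) (F w) A"
        unfolding near_to_def
      proof
        fix y assume "y \<in> F w"
        then obtain a x where a: "a \<in> Y" "mdist N w (e a) < 2 * D w" "x \<in> a" "y \<in> g (R a) (T a w) x"
          unfolding F_def by blast
        have "H a A < real 1" using close[OF a(1,2)] \<delta> by simp
        then have Ra: "R a \<le> R A + 1" using R_near a(1) A(1) by blast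
        have x: "x \<in> K (R a)" using aK a by blast
        have t: "T a w \<le> 1" "T a w - 0 \<le> \<sigma>" using T_le[OF a(1) w(1)] Dw \<delta> by auto
        then have "near_to m (\<xi> / 4) (g (R a) (T a w) x) (g (R a) 0 x)"
          using \<sigma> Ra x T_nonneg by blast
        then have yx: "mdist m y x < \<xi> / 4" using a(4) g_0[OF x] unfolding near_to_def by auto
        have "near_to m (\<xi> / 4) a A" using close[OF a(1,2)] \<delta> by (intro near a A) simp
        then obtain u where u: "u \<in> A" "mdist m x u < \<xi> / 4" using a(3) unfolding near_to_def by blast
        have "y \<in> mspace m" using \<open>y \<in> F w\<close> F_bdd[OF w(1) False] mbounded_of_subset_mspace by blast
        then have "mdist m y u < \<xi> / 2"
          using mdist_le_via(1)[of y m x u] yx u Ym[OF a(1)] Ym[OF A(1)] a(3) by force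
        then show "\<exists>u\<in>A. mdist m y u < \<xi> / 2" using u by blast
      qed
      have "H (mclosure m A) (mclosure m (F w)) \<le> \<xi> / 2"
        unfolding H_def using Ym[OF A(1)] F_bdd[OF w(1) False] F_ne[OF w(1) False] 1 2
        by (intro Hausdorff_closures_le)
      then have "mdist N (e A) (e (mclosure m (F w))) \<le> \<xi> / 2"
        using iso[OF A(1) clF[OF w(1) False]] Ym(4)[OF A(1)] by simp
      then show ?thesis using False z A \<xi> by (simp add: r_def)
    qed
    then show ?thesis using \<delta>(1) by blast
  qed
  have near_outside: "\<exists>\<delta>>0. \<forall>w\<in>U. mdist N z w < \<delta> \<longrightarrow> mdist N (r z) (r w) < \<xi>"
    if z: "z \<in> U" "z \<notin> S" and \<xi>: "\<xi> > 0" for z \<xi>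
  proof -
    have Dz: "D z > 0" by (rule D_pos[OF z])
    then have "D z < 3/2 * D z" by simp
    from D_approx[OF this] obtain k0 where k0: "k0 \<in> Y" "mdist N z (e k0) < 3/2 * D z" by blast
    obtain n where n: "8 * D z < real n" using reals_Archimedean2 by blast
    have "\<xi> / 2 > 0" using \<xi> by simp
    from modulus[OF this, of "R k0 + n" "16 * D z"]
    obtain \<sigma> where "\<sigma> > 0" and \<sigma>: "\<forall>i\<le>R k0 + n. \<forall>x\<in>K i. \<forall>s t. 0 \<le> s \<and> s \<le> t \<and> t \<le> 16 * D z \<and> t - s \<le> \<sigma> \<longrightarrow>
      near_to m (\<xi> / 2) (g i t x) (g i s x)"
      by (elim exE conjE)
    define \<delta> where "\<delta> = min (D z / 16) (\<sigma> / 24)"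
    have \<delta>: "\<delta> > 0" "16 * \<delta> \<le> D z" "24 * \<delta> \<le> \<sigma>" using Dz \<open>\<sigma> > 0\<close> by (auto simp: \<delta>_def)
    have one_sided: "near_to m (\<xi> / 2) (F p) (F q)"
      if p: "p \<in> U" "p \<notin> S" and q: "q \<in> U" "q \<notin> S" and pq: "mdist N p q < \<delta>"
        and zp: "mdist N z p < \<delta>" and zq: "mdist N z q < \<delta>" for p q
      unfolding near_to_def
    proof
      fix y assume y: "y \<in> F p"
      then obtain a x where a: "a \<in> Y" "mdist N p (e a) < 2 * D p" "x \<in> a" "y \<in> g (R a) (T a p) x"
        unfolding F_def by blast
      have Dp: "D p \<le> D z + \<delta>" "D z \<le> D q + \<delta>" "D p \<le> D q + \<delta>"
        using D_Lip[OF p(1) z(1)] D_Lip[OF z(1) q(1)] D_Lip[OF p(1) q(1)] zp zq pq by (auto simp: mdist_commute)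
      have "H a k0 \<le> mdist N p (e a) + mdist N p z + mdist N z (e k0)"
        by (rule H_via2[OF a(1) k0(1) p(1) z(1)])
      then have "H a k0 < real n" using a(2) k0(2) zp Dp \<delta> n by (auto simp: mdist_commute)
      then have Ra: "R a \<le> R k0 + n" using R_near a(1) k0(1) by blast
      have x: "x \<in> K (R a)" using aK a by blast
      have ym: "y \<in> mspace m" using y F_bdd[OF p] mbounded_of_subset_mspace by blast
      have Tp: "T a p \<le> 16 * D z" using T_le[OF a(1) p(1)] Dp(1) \<delta> Dz by simp
      have step: "T a p - T a q \<le> \<sigma>" using T_Lip[OF a(1) p(1) q(1)] pq \<delta> by simp
      show "\<exists>u\<in>F q. mdist m y u < \<xi> / 2"
      proof (cases "mdist N q (e a) < 2 * D q")
        case True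
        show ?thesis
        proof (cases "T a p \<le> T a q")
          case True
          then have "y \<in> g (R a) (T a q) x" using a(4) g_mono by blast
          then have "y \<in> F q" using F_grow[OF a(1) \<open>mdist N q (e a) < 2 * D q\<close> a(3)] by blast
          then show ?thesis using ym \<xi> by (intro bexI[of _ y]) auto
        next
          case False
          then have "near_to m (\<xi> / 2) (g (R a) (T a p) x) (g (R a) (T a q) x)"
            using \<sigma>[rule_format, OF Ra x, of "T a q" "T a p"] T_nonneg Tp step by simp
          then show ?thesis
            using a(4) F_grow[OF a(1) True a(3)] unfolding near_to_def by blast
        qed
      next
        case False
        then have "T a q = 0" by (simp add: T_def)
        then have "near_to m (\<xi> / 2) (g (R a) (T a p) x) (g (R a) 0 x)"
          using \<sigma>[rule_format, OF Ra x, of 0 "T a p"] T_nonneg Tp step by simp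
        then have yx: "mdist m y x < \<xi> / 2" using a(4) g_0[OF x] unfolding near_to_def by auto
        have Dq: "D q > 0" by (rule D_pos[OF q])
        then have "D q < 7/5 * D q" by simp
        from D_approx[OF this] obtain k where k: "k \<in> Y" "mdist N q (e k) < 7/5 * D q" by blast
        have "H a k \<le> mdist N p (e a) + mdist N p q + mdist N q (e k)"
          by (rule H_via2[OF a(1) k(1) p(1) q(1)])
        moreover have "24/5 * u < 8 * v" if "w < 7/5 * u" "2 * u - w \<le> v" for u v w :: real
          using that by linarith
        from this[OF k(2) max.cobounded2] have "T k q > 24/5 * D q" unfolding T_def .
        ultimately have "H a k < T k q" using a(2) k(2) pq Dp \<delta> by linarith
        then have "a \<subseteq> F q" using k Dq by (intro absorb[OF a(1) k(1) q]) auto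
        then show ?thesis using yx a(3) by blast
      qed
    qed
    have "mdist N (r z) (r w) < \<xi>" if w: "w \<in> U" "mdist N z w < \<delta>" for w
    proof -
      have "w \<notin> S"
      proof
        assume "w \<in> S"
        then have "D z \<le> mdist N z w" unfolding D_def by (rule setdist_in_le)
        then show False using w \<delta> Dz by linarith
      qed
      have self: "mdist N z z < \<delta>" using zN[OF z(1)] \<delta>(1) by simp
      have "near_to m (\<xi> / 2) (F z) (F w)" "near_to m (\<xi> / 2) (F w) (F z)"
        using one_sided[OF z w(1) \<open>w \<notin> S\<close> w(2) self w(2)] one_sided[OF w(1) \<open>w \<notin> S\<close> z _ w(2) self] w(2)
        by (auto simp: mdist_commute)
      then have "H (mclosure m (F z)) (mclosure m (F w)) \<le> \<xi> / 2"
        unfolding H_def using F_bdd F_ne z w \<open>w \<notin> S\<close> by (intro Hausdorff_closures_le) auto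
      then show ?thesis
        using iso[OF clF[OF z] clF[OF w(1) \<open>w \<notin> S\<close>]] z \<open>w \<notin> S\<close> \<xi> by (simp add: r_def)
    qed
    then show ?thesis using \<delta>(1) by blast
  qed
  have "continuous_map (mtopology_of (submetric N U)) (mtopology_of (submetric N S)) r"
    unfolding mtopology_of_def Metric_space.metric_continuous_map[OF Metric_space_mspace_mdist Metric_space_mspace_mdist]
  proof (intro conjI ballI allI impI)
    show "r ` mspace (submetric N U) \<subseteq> mspace (submetric N S)" using rS SN by auto
    fix z and \<xi> :: real assume z: "z \<in> mspace (submetric N U)" and \<xi>: "\<xi> > 0"
    then have "\<exists>\<delta>>0. \<forall>w\<in>U. mdist N z w < \<delta> \<longrightarrow> mdist N (r z) (r w) < \<xi>"
      using near_S near_outside by (cases "z \<in> S") auto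
    then show "\<exists>\<delta>>0. \<forall>x. x \<in> mspace (submetric N U) \<and> mdist (submetric N U) z x < \<delta> \<longrightarrow>
        mdist (submetric N S) (r z) (r x) < \<xi>" by auto
  qed
  then have "continuous_map (subtopology (mtopology_of N) U) (subtopology (subtopology (mtopology_of N) U) S) r"
    using U(2) by (simp add: mtopology_of_submetric subtopology_subtopology S_def Y_def inf.absorb2)
  moreover have "S \<subseteq> topspace (subtopology (mtopology_of N) U)" using SN U(2) by (auto simp: S_def Y_def)
  moreover have "\<forall>z\<in>S. r z = z" by (simp add: r_def)
  ultimately show ?thesis unfolding retract_of_space_def S_def Y_def by blast
qed

lemma hyperspace_empty_iff: "closed_bounded_nonempty m = {} \<longleftrightarrow> mspace m = {}"
proof
  assume "closed_bounded_nonempty m = {}"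
  moreover have "mclosure m {x} \<in> closed_bounded_nonempty m" if "x \<in> mspace m" for x
    using that by (intro mclosure_in_hyperspace) (auto simp: mbounded_of_iff)
  ultimately show "mspace m = {}" by blast
qed (auto simp: closed_bounded_nonempty_def closed_nonempty_def dest: closedin_subset)

lemma empty_retract_of_space: "topspace X = {} \<Longrightarrow> {} retract_of_space X"
  by (simp add: retract_of_space_def continuous_map_def)

text \<open>
  The hypothesis of \<open>hyperspace_retraction\<close> holds near each embedded set \<open>A\<close>: local equichainedness
  on a ball containing all sets within distance 1 of \<open>A\<close> provides a radius \<open>\<delta> A\<close>, and \<open>U\<close> is built
  from balls around \<open>A\<close> that are small against \<open>\<delta> A\<close>.
\<close>

lemma locally_equichained_imp_abs_nbhd_retract:
  assumes lec: "locally_equichained m"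
  shows "abs_nbhd_retract TYPE('u) (bounded_hyperspace m)"
  unfolding abs_nbhd_retract_def mspace_bounded_hyperspace
proof (intro allI impI)
  fix N :: "(('a set \<Rightarrow> real) + 'u) metric" and e
  assume emb: "closed_isometric_embedding (bounded_hyperspace m) N e"
  let ?Y = "closed_bounded_nonempty m"
  show "\<exists>U. openin (mtopology_of N) U \<and> e ` ?Y \<subseteq> U \<and> e ` ?Y retract_of_space subtopology (mtopology_of N) U"
  proof (cases "mspace m = {}")
    case True
    then have "?Y = {}" by (simp add: hyperspace_empty_iff)
    then show ?thesis by (intro exI[of _ "{}"]) (simp add: empty_retract_of_space)
  next
    case False
    then obtain x0 where x0: "x0 \<in> mspace m" by blast
    define R where "R = integer_radius m x0"
    define S where "S = e ` ?Y"
    note emb' = closed_isometric_embeddingD[OF emb, unfolded mspace_bounded_hyperspace, folded S_def]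
    note iso = emb'(1) and SN = emb'(3)
    have "\<exists>\<delta>>0. equireach m (mcball_of m x0 (real (R a + 1))) \<delta> 1" for a
      using lec mbounded_of_mcball unfolding locally_equichained_def equichained_def by (metis zero_less_one)
    then obtain \<delta> where \<delta>: "\<And>a. \<delta> a > 0" "\<And>a. equireach m (mcball_of m x0 (real (R a + 1))) (\<delta> a) 1" by metis
    define c where "c a = min (1/3) (\<delta> a / 16)" for a
    have c: "c a > 0" "3 * c a \<le> 1" "16 * c a \<le> \<delta> a" for a using \<delta>(1)[of a] by (auto simp: c_def)
    define U where "U = (\<Union>a\<in>?Y. mball_of N (e a) (c a))"
    have "openin (mtopology_of N) U"
      unfolding U_def mball_of_def mtopology_of_def
      by (intro openin_Union) (auto simp: Metric_space.openin_mball)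
    moreover have SU: "S \<subseteq> U"
    proof
      fix s assume s: "s \<in> S"
      then obtain a where "a \<in> ?Y" "s = e a" unfolding S_def by blast
      then show "s \<in> U" using c(1)[of a] s SN unfolding U_def by (intro UN_I[of a]) auto
    qed
    moreover have "S retract_of_space subtopology (mtopology_of N) U"
      unfolding S_def
    proof (rule hyperspace_retraction[OF lec emb x0])
      show "U \<subseteq> mspace N" by (auto simp: U_def)
      show "e ` ?Y \<subseteq> U" using SU by (simp add: S_def)
      fix z a assume z: "z \<in> U - e ` ?Y" and a: "a \<in> ?Y" and active: "mdist N z (e a) < 2 * setdist_in N (e ` ?Y) z"
      obtain A where A: "A \<in> ?Y" "mdist N z (e A) < c A" "z \<in> mspace N"
        using z unfolding U_def by (auto simp: mdist_commute)
      have D: "setdist_in N (e ` ?Y) z \<le> mdist N z (e A)" using A by (intro setdist_in_le) simp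
      have "e a \<in> mspace N" "e A \<in> mspace N" using SN a A unfolding S_def by auto
      then have "mdist (bounded_hyperspace m) a A \<le> mdist N z (e a) + mdist N z (e A)"
        using mdist_le_via(2)[of "e a" N z "e A"] A(3) iso[OF a A(1)] by simp
      then have "mdist (bounded_hyperspace m) a A < real 1" using active D A(2) c(2)[of A] by linarith
      then have "R a \<le> R A + 1" unfolding R_def by (rule integer_radius_near[OF a A(1) x0])
      then have "mcball_of m x0 (R a) \<subseteq> mcball_of m x0 (real (R A + 1))" by auto
      moreover have "16 * setdist_in N (e ` ?Y) z \<le> \<delta> A" using D A(2) c(3)[of A] by linarith
      ultimately show "\<exists>E. equireach m (mcball_of m x0 (integer_radius m x0 a)) (16 * setdist_in N (e ` ?Y) z) E"
        using equireach_mono[OF \<delta>(2)[of A]] unfolding R_def by blast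
    qed
    ultimately show ?thesis unfolding S_def by blast
  qed
qed

lemma boundedly_chained_equireach:
  assumes "boundedly_chained m" "mbounded_of m B"
  shows "\<exists>E. equireach m B r E"
proof -
  let ?C = "B \<union> nbhd m B r"
  have C: "mbounded_of m ?C"
    using assms(2) mbounded_of_nbhd[OF assms(2)] by (simp add: Metric_space.mbounded_Un)
  then obtain B' where B': "mbounded_of m B'" "\<And>\<eta>. \<eta> > 0 \<Longrightarrow> \<exists>n. \<forall>x\<in>?C. \<forall>y\<in>?C. chain m \<eta> n B' x y"
    using assms(1)[unfolded boundedly_chained_def, rule_format, OF C] by (elim exE conjE) simp
  have "mbounded_of m (B \<union> B')" using B'(1) assms(2) by (simp add: Metric_space.mbounded_Un)
  then obtain K where K: "\<And>x y. \<lbrakk>x \<in> B \<union> B'; y \<in> B \<union> B'\<rbrakk> \<Longrightarrow> mdist m x y \<le> K" and "B \<union> B' \<subseteq> mspace m"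
    unfolding mbounded_of_iff by blast
  have ball: "B' \<subseteq> mball_of m x (K + 1)" if "x \<in> B" for x
  proof
    fix y assume "y \<in> B'"
    then show "y \<in> mball_of m x (K + 1)" using K[of x y] that \<open>B \<union> B' \<subseteq> mspace m\<close> by auto
  qed
  have "equireach m B r (K + 1)"
    unfolding equireach_def
  proof (intro allI impI)
    fix \<eta> :: real assume "\<eta> > 0"
    then obtain n where n: "\<forall>x\<in>?C. \<forall>y\<in>?C. chain m \<eta> n B' x y" using B'(2) by blast
    have "chain m \<eta> n (mball_of m x (K + 1)) x y" if "x \<in> B" "y \<in> mspace m" "mdist m x y < r" for x y
    proof -
      have "x \<in> mspace m" using that \<open>B \<union> B' \<subseteq> mspace m\<close> by blast
      then have "y \<in> nbhd m B r" using that unfolding nbhd_def by auto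
      then have "chain m \<eta> n B' x y" using n that(1) by blast
      then show ?thesis using ball[OF that(1)] by (rule chain_weaken[OF _ order_refl])
    qed
    then show "\<exists>n. \<forall>x\<in>B. \<forall>y\<in>mspace m. mdist m x y < r \<longrightarrow> chain m \<eta> n (mball_of m x (K + 1)) x y" by blast
  qed
  then show ?thesis ..
qed

lemma locally_equichained_imp_abs_retract:
  assumes lec: "locally_equichained m" and bc: "boundedly_chained m" and ne: "mspace m \<noteq> {}"
  shows "abs_retract TYPE('u) (bounded_hyperspace m)"
  unfolding abs_retract_def mspace_bounded_hyperspace
proof (intro allI impI)
  fix N :: "(('a set \<Rightarrow> real) + 'u) metric" and e
  assume emb: "closed_isometric_embedding (bounded_hyperspace m) N e"
  obtain x0 where x0: "x0 \<in> mspace m" using ne by blast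
  have "e ` closed_bounded_nonempty m \<subseteq> mspace N"
    using closed_isometric_embeddingD(3)[OF emb] by simp
  then have "e ` closed_bounded_nonempty m retract_of_space subtopology (mtopology_of N) (mspace N)"
    by (intro hyperspace_retraction[OF lec emb x0] boundedly_chained_equireach[OF bc] mbounded_of_mcball) auto
  then show "e ` closed_bounded_nonempty m retract_of_space mtopology_of N"
    by (metis subtopology_topspace topspace_mtopology_of)
qed

section \<open>Dense subsets\<close>

lemma chain_submetric [simp]: "chain (submetric m X) = chain m"
  by (simp add: chain_def fun_eq_iff)

lemma mball_of_submetric: "X \<subseteq> mspace m \<Longrightarrow> x \<in> X \<Longrightarrow> mball_of (submetric m X) x r = X \<inter> mball_of m x r"
  by auto

lemma mbounded_of_submetric: "X \<subseteq> mspace m \<Longrightarrow> mbounded_of (submetric m X) B \<longleftrightarrow> mbounded_of m B \<and> B \<subseteq> X"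
  unfolding mbounded_of_iff by auto

lemma dense_approx:
  assumes "mclosure m X = mspace m" "x \<in> mspace m" "r > 0"
  obtains y where "y \<in> X" "mdist m x y < r"
proof -
  have "x \<in> mclosure m X" using assms by simp
  then obtain y where "y \<in> X" "mdist m x y < r" using \<open>r > 0\<close> unfolding in_mclosure by auto
  then show thesis by (rule that)
qed

text \<open>
  Points that already lie in the dense set stay where they are, so that the end points are kept.
\<close>

lemma chain_into_dense:
  assumes X: "X \<subseteq> mspace m" "mclosure m X = mspace m" and S: "S \<subseteq> mspace m" and "0 < r"
    and c: "chain m \<eta> n S x y" and "x \<in> X" "y \<in> X"
  shows "chain m (r + \<eta> + r) n (X \<inter> nbhd m S r) x y"
proof -
  obtain c where c: "c 0 = x" "c n = y" "\<forall>i\<le>n. c i \<in> S" "\<forall>i<n. mdist m (c i) (c (Suc i)) < \<eta>"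
    using c unfolding chain_def by blast
  have "\<exists>u. u \<in> X \<and> mdist m (c i) u < r \<and> (c i \<in> X \<longrightarrow> u = c i)" if "i \<le> n" for i
  proof (cases "c i \<in> X")
    case True
    then show ?thesis using X(1) \<open>0 < r\<close> by (intro exI[of _ "c i"]) auto
  next
    case False
    then show ?thesis using dense_approx[OF X(2) _ \<open>0 < r\<close>, of "c i"] c(3) S that by blast
  qed
  then obtain b where b: "\<And>i. i \<le> n \<Longrightarrow> b i \<in> X \<and> mdist m (c i) (b i) < r \<and> (c i \<in> X \<longrightarrow> b i = c i)"
    by metis
  have "mdist m (b i) (b (Suc i)) < r + \<eta> + r" if "i < n" for i
  proof -
    have m: "b i \<in> mspace m" "c i \<in> mspace m" "c (Suc i) \<in> mspace m" "b (Suc i) \<in> mspace m"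
      using b[of i] b[of "Suc i"] c(3) that X S by auto
    have "mdist m (b i) (b (Suc i)) \<le> mdist m (c i) (b i) + mdist m (c i) (c (Suc i)) + mdist m (c (Suc i)) (b (Suc i))"
      using mdist_le_via(2)[OF m(1,2,4)] mdist_le_via(1)[OF m(2,3,4)] by linarith
    moreover have "mdist m (c i) (b i) < r" "mdist m (c (Suc i)) (b (Suc i)) < r" "mdist m (c i) (c (Suc i)) < \<eta>"
      using b[of i] b[of "Suc i"] c(4) that by auto
    ultimately show ?thesis by linarith
  qed
  moreover have "b i \<in> X \<inter> nbhd m S r" if "i \<le> n" for i
    using b[OF that] c(3) that S X(1) unfolding nbhd_def by fastforce
  moreover have "b 0 = x" "b n = y" using b[of 0] b[of n] c assms(6,7) by auto
  ultimately show ?thesis unfolding chain_def by (intro exI[of _ b]) simp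
qed

lemma nbhd_mball_subset: "nbhd m (mball_of m x r) s \<subseteq> mball_of m x (r + s)"
proof
  fix u assume "u \<in> nbhd m (mball_of m x r) s"
  then obtain a where "a \<in> mball_of m x r" "u \<in> mball_of m a s" unfolding nbhd_def by blast
  then show "u \<in> mball_of m x (r + s)" using mdist_le_via(1)[of x m a u] by auto
qed

lemma locally_equichained_dense_iff:
  assumes X: "X \<subseteq> mspace m" "mclosure m X = mspace m"
  shows "locally_equichained (submetric m X) \<longleftrightarrow> locally_equichained m"
proof
  assume L: "locally_equichained m"
  show "locally_equichained (submetric m X)"
    unfolding locally_equichained_def
  proof (intro allI impI)
    fix B and \<epsilon> :: real assume B: "mbounded_of (submetric m X) B" and \<epsilon>: "\<epsilon> > 0"
    have BX: "B \<subseteq> X" and "equichained m B (\<epsilon> / 2)"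
      using B \<epsilon> L unfolding locally_equichained_def mbounded_of_submetric[OF X(1)] by simp_all
    then obtain \<delta> where \<delta>: "\<delta> > 0" "\<And>\<eta>. \<eta> > 0 \<Longrightarrow> \<exists>n. \<forall>x\<in>B. \<forall>y\<in>mspace m. mdist m x y < \<delta> \<longrightarrow>
       chain m \<eta> n (mball_of m x (\<epsilon> / 2)) x y" unfolding equichained_def equireach_def by blast
    show "equichained (submetric m X) B \<epsilon>"
      unfolding equichained_def equireach_def
    proof (intro exI[of _ \<delta>] conjI allI impI \<delta>(1))
      fix \<eta> :: real assume "\<eta> > 0"
      \<comment> \<open>moving both ends of a step of size \<open>\<eta> / 3\<close> by \<open>r\<close> gives a step of size \<open>\<eta>\<close>\<close>
      define r where "r = min (\<eta> / 3) (\<epsilon> / 2)"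
      have r: "r > 0" "r + \<eta> / 3 + r \<le> \<eta>" "\<epsilon> / 2 + r \<le> \<epsilon>" using \<open>\<eta> > 0\<close> \<epsilon> by (auto simp: r_def)
      obtain n where n: "\<forall>x\<in>B. \<forall>y\<in>mspace m. mdist m x y < \<delta> \<longrightarrow> chain m (\<eta> / 3) n (mball_of m x (\<epsilon> / 2)) x y"
        using \<delta>(2)[of "\<eta> / 3"] \<open>\<eta> > 0\<close> by auto
      have "chain m \<eta> n (mball_of (submetric m X) x \<epsilon>) x y" if xy: "x \<in> B" "y \<in> X" "mdist m x y < \<delta>" for x y
      proof -
        have "chain m (\<eta> / 3) n (mball_of m x (\<epsilon> / 2)) x y" using n xy X by blast
        then have "chain m (r + \<eta> / 3 + r) n (X \<inter> nbhd m (mball_of m x (\<epsilon> / 2)) r) x y"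
          using xy BX by (intro chain_into_dense[OF X _ r(1)]) auto
        moreover have "mball_of m x (\<epsilon> / 2 + r) \<subseteq> mball_of m x \<epsilon>" using r(3) by auto
        then have "X \<inter> nbhd m (mball_of m x (\<epsilon> / 2)) r \<subseteq> mball_of (submetric m X) x \<epsilon>"
          using nbhd_mball_subset[of m x "\<epsilon> / 2" r] mball_of_submetric[OF X(1), of x] xy BX by blast
        ultimately show ?thesis using r(2) by (intro chain_weaken[where \<eta>' = \<eta>])
      qed
      then show "\<exists>n. \<forall>x\<in>B. \<forall>y\<in>mspace (submetric m X). mdist (submetric m X) x y < \<delta> \<longrightarrow>
          chain (submetric m X) \<eta> n (mball_of (submetric m X) x \<epsilon>) x y" by auto
    qed
  qed
next
  assume L: "locally_equichained (submetric m X)"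
  show "locally_equichained m"
    unfolding locally_equichained_def
  proof (intro allI impI)
    fix B and \<epsilon> :: real assume B: "mbounded_of m B" and \<epsilon>: "\<epsilon> > 0"
    \<comment> \<open>\<open>B\<close> itself may miss \<open>X\<close>, so its points are first moved into this set\<close>
    define B' where "B' = X \<inter> nbhd m B 1"
    have "mbounded_of (submetric m X) B'"
      using mbounded_of_nbhd[OF B, of 1] mbounded_of_subset[of m "nbhd m B 1" B'] X unfolding B'_def mbounded_of_submetric[OF X(1)]
      by simp
    then have "equichained (submetric m X) B' (\<epsilon> / 2)"
      using L \<epsilon> unfolding locally_equichained_def by simp
    then obtain \<delta> where "\<delta> > 0" and \<delta>: "\<And>\<eta>. \<eta> > 0 \<Longrightarrow> \<exists>n. \<forall>x\<in>B'. \<forall>y\<in>X \<inter> mspace m. mdist m x y < \<delta> \<longrightarrow>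
       chain m \<eta> n (mball_of (submetric m X) x (\<epsilon> / 2)) x y" unfolding equichained_def equireach_def by auto
    show "equichained m B \<epsilon>"
      unfolding equichained_def equireach_def
    proof (intro exI[of _ "min (\<delta> / 3) (\<epsilon> / 4)"] conjI allI impI)
      show "min (\<delta> / 3) (\<epsilon> / 4) > 0" using \<open>\<delta> > 0\<close> \<epsilon> by simp
      fix \<eta> :: real assume "\<eta> > 0"
      then obtain n where n: "\<forall>x\<in>B'. \<forall>y\<in>X \<inter> mspace m. mdist m x y < \<delta> \<longrightarrow>
       chain m \<eta> n (mball_of (submetric m X) x (\<epsilon> / 2)) x y" using \<delta> by blast
      define r where "r = min (min \<eta> 1) (min (\<delta> / 3) (\<epsilon> / 4))"
      have r: "r > 0" "r \<le> \<eta>" "r \<le> 1" "r \<le> \<delta> / 3" "r \<le> \<epsilon> / 4" using \<open>\<eta> > 0\<close> \<open>\<delta> > 0\<close> \<epsilon> by (auto simp: r_def)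
      have "chain m \<eta> (1 + n + 1) (mball_of m x \<epsilon>) x y"
        if xy: "x \<in> B" "y \<in> mspace m" "mdist m x y < min (\<delta> / 3) (\<epsilon> / 4)" for x y
      proof -
        have xm: "x \<in> mspace m" using B xy by (auto simp: mbounded_of_iff)
        obtain x' where x': "x' \<in> X" "mdist m x x' < r" using dense_approx[OF X(2) xm r(1)] .
        obtain y' where y': "y' \<in> X" "mdist m y y' < r" using dense_approx[OF X(2) xy(2) r(1)] .
        have m: "x' \<in> mspace m" "y' \<in> mspace m" using x' y' X by auto
        have "x' \<in> B'" using x' xy(1) xm m r(3) unfolding B'_def nbhd_def by fastforce
        moreover have "mdist m x' y' < \<delta>"
          using mdist_le_via(2)[OF m(1) xm m(2)] mdist_le_via(1)[OF xm xy(2) m(2)] x' y' xy(3) r(4) by linarith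
        ultimately have "chain m \<eta> n (mball_of (submetric m X) x' (\<epsilon> / 2)) x' y'" using n y' m by blast
        moreover have "mball_of (submetric m X) x' (\<epsilon> / 2) \<subseteq> mball_of m x \<epsilon>"
        proof
          fix u assume "u \<in> mball_of (submetric m X) x' (\<epsilon> / 2)"
          then show "u \<in> mball_of m x \<epsilon>" using mdist_le_via(1)[OF xm m(1), of u] xm x' r(5) \<epsilon> by auto
        qed
        ultimately have mid: "chain m \<eta> n (mball_of m x \<epsilon>) x' y'" by (rule chain_weaken[OF _ order_refl])
        note ends = chain_endpoints[OF mid]
        have "x \<in> mball_of m x \<epsilon>" "y \<in> mball_of m x \<epsilon>" using xm xy \<epsilon> by auto
        then have "chain m \<eta> 1 (mball_of m x \<epsilon>) x x'" "chain m \<eta> 1 (mball_of m x \<epsilon>) y' y"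
          using ends x' y' r(2) by (auto intro!: chain_step[unfolded One_nat_def] simp: mdist_commute)
        then show ?thesis by (rule chain_trans[OF chain_trans[OF _ mid]])
      qed
      then show "\<exists>n. \<forall>x\<in>B. \<forall>y\<in>mspace m. mdist m x y < min (\<delta> / 3) (\<epsilon> / 4) \<longrightarrow> chain m \<eta> n (mball_of m x \<epsilon>) x y"
        by blast
    qed
  qed
qed

lemma boundedly_chained_dense_iff:
  assumes X: "X \<subseteq> mspace m" "mclosure m X = mspace m"
  shows "boundedly_chained (submetric m X) \<longleftrightarrow> boundedly_chained m"
proof
  assume L: "boundedly_chained m"
  show "boundedly_chained (submetric m X)"
    unfolding boundedly_chained_def
  proof (intro allI impI)
    fix B assume B: "mbounded_of (submetric m X) B"
    then have BX: "B \<subseteq> X" and "mbounded_of m B" unfolding mbounded_of_submetric[OF X(1)] by simp_all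
    then obtain B' where B': "mbounded_of m B'" "\<And>\<eta>. \<eta> > 0 \<Longrightarrow> \<exists>n. \<forall>x\<in>B. \<forall>y\<in>B. chain m \<eta> n B' x y"
      using L[unfolded boundedly_chained_def, rule_format, OF \<open>mbounded_of m B\<close>] by (elim exE conjE) simp
    let ?C = "X \<inter> nbhd m B' 1"
    have "mbounded_of (submetric m X) ?C"
      using mbounded_of_nbhd[OF B'(1), of 1] mbounded_of_subset[of m "nbhd m B' 1" ?C]
      unfolding mbounded_of_submetric[OF X(1)] by simp
    moreover have "\<exists>n. \<forall>x\<in>B. \<forall>y\<in>B. chain m \<eta> n ?C x y" if "\<eta> > 0" for \<eta>
    proof -
      define r where "r = min (\<eta> / 3) 1"
      have r: "r > 0" "r + \<eta> / 3 + r \<le> \<eta>" "r \<le> 1" using \<open>\<eta> > 0\<close> by (auto simp: r_def)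
      obtain n where n: "\<forall>x\<in>B. \<forall>y\<in>B. chain m (\<eta> / 3) n B' x y" using B'(2)[of "\<eta> / 3"] \<open>\<eta> > 0\<close> by auto
      have "chain m (r + \<eta> / 3 + r) n (X \<inter> nbhd m B' r) x y" if "x \<in> B" "y \<in> B" for x y
        using that n BX mbounded_of_subset_mspace[OF B'(1)] by (intro chain_into_dense[OF X _ r(1)]) auto
      then show ?thesis using chain_weaken[OF _ r(2)] nbhd_mono[OF r(3), of m B'] by (meson Int_mono order_refl)
    qed
    ultimately show "\<exists>B'. mbounded_of (submetric m X) B' \<and>
        (\<forall>\<eta>>0. \<exists>n. \<forall>x\<in>B. \<forall>y\<in>B. chain (submetric m X) \<eta> n B' x y)" by auto
  qed
next
  assume L: "boundedly_chained (submetric m X)"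
  show "boundedly_chained m"
    unfolding boundedly_chained_def
  proof (intro allI impI)
    fix B assume B: "mbounded_of m B"
    define C where "C = X \<inter> nbhd m B 1"
    have "mbounded_of (submetric m X) C"
      using mbounded_of_nbhd[OF B, of 1] mbounded_of_subset[of m "nbhd m B 1" C] unfolding C_def mbounded_of_submetric[OF X(1)]
      by simp
    from L[unfolded boundedly_chained_def chain_submetric, rule_format, OF this]
    obtain B' where B': "mbounded_of (submetric m X) B'" "\<And>\<eta>. \<eta> > 0 \<Longrightarrow> \<exists>n. \<forall>x\<in>C. \<forall>y\<in>C. chain m \<eta> n B' x y"
      by (elim exE conjE) simp
    have "mbounded_of m (B \<union> B')" 
      using B B'(1) unfolding mbounded_of_submetric[OF X(1)] by (simp add: Metric_space.mbounded_Un)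
    moreover have "\<exists>n. \<forall>x\<in>B. \<forall>y\<in>B. chain m \<eta> n (B \<union> B') x y" if "\<eta> > 0" for \<eta>
    proof -
      obtain n where n: "\<forall>x\<in>C. \<forall>y\<in>C. chain m \<eta> n B' x y" using B'(2)[OF \<open>\<eta> > 0\<close>] by blast
      have enter: "\<exists>x'\<in>C. mdist m x x' < \<eta>" if x: "x \<in> B" for x
      proof -
        have xm: "x \<in> mspace m" using B x by (auto simp: mbounded_of_iff)
        obtain x' where "x' \<in> X" "mdist m x x' < min \<eta> 1" using dense_approx[OF X(2) xm, of "min \<eta> 1"] \<open>\<eta> > 0\<close> by auto
        then show ?thesis using x xm X(1) unfolding C_def nbhd_def by (intro bexI[of _ x']) auto
      qed
      have "chain m \<eta> (1 + n + 1) (B \<union> B') x y" if xy: "x \<in> B" "y \<in> B" for x y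
      proof -
        obtain x' where x': "x' \<in> C" "mdist m x x' < \<eta>" using enter xy by blast
        obtain y' where y': "y' \<in> C" "mdist m y y' < \<eta>" using enter xy by blast
        have "chain m \<eta> n B' x' y'" using n x' y' by blast
        then have mid: "chain m \<eta> n (B \<union> B') x' y'" by (rule chain_weaken) auto
        have "chain m \<eta> 1 (B \<union> B') x x'" "chain m \<eta> 1 (B \<union> B') y' y"
          using chain_endpoints[OF mid] x' y' xy by (auto intro!: chain_step[unfolded One_nat_def] simp: mdist_commute)
        then show ?thesis by (rule chain_trans[OF chain_trans[OF _ mid]])
      qed
      then show ?thesis by blast
    qed
    ultimately show "\<exists>B'. mbounded_of m B' \<and> (\<forall>\<eta>>0. \<exists>n. \<forall>x\<in>B. \<forall>y\<in>B. chain m \<eta> n B' x y)" by blast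
  qed
qed

section \<open>Paths in absolute neighbourhood retracts\<close>

text \<open>
  The affine combinations of the points \<open>mdist Z b\<close> and \<open>mdist Z c\<close> of Kuratowski's embedding of \<open>Z\<close> into the
  bounded functions on \<open>Z\<close>. Subtracting \<open>mdist Z z0\<close> makes them bounded.
\<close>

definition segment_point :: "'z metric \<Rightarrow> 'z \<Rightarrow> 'z \<Rightarrow> 'z \<Rightarrow> real \<Rightarrow> 'z \<Rightarrow> real" where
  "segment_point Z z0 b c t = (\<lambda>x\<in>mspace Z. (1 - t) * mdist Z b x + t * mdist Z c x - mdist Z z0 x)"

abbreviation bounded_functions :: "'z metric \<Rightarrow> ('z \<Rightarrow> real) metric" where
  "bounded_functions Z \<equiv> funspace (mspace Z) euclidean_metric"

lemma mdist_diff_le: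
  assumes "x \<in> mspace Z" "y \<in> mspace Z" "u \<in> mspace Z"
  shows "\<bar>mdist Z x u - mdist Z y u\<bar> \<le> mdist Z x y"
  using mdist_le_via(1)[OF assms(1,2,3)] mdist_le_via(2)[OF assms(2,1,3)] by linarith

lemma segment_point_bounded:
  assumes "z0 \<in> mspace Z" "b \<in> mspace Z" "c \<in> mspace Z" "t \<in> {0..1}"
  shows "segment_point Z z0 b c t \<in> mspace (bounded_functions Z)"
proof -
  have "\<bar>(1 - t) * mdist Z b x + t * mdist Z c x - mdist Z z0 x\<bar> \<le> mdist Z b z0 + mdist Z c z0"
    if "x \<in> mspace Z" for x
  proof -
    have "(1 - t) * mdist Z b x + t * mdist Z c x - mdist Z z0 x
        = (1 - t) * (mdist Z b x - mdist Z z0 x) + t * (mdist Z c x - mdist Z z0 x)"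
      by (simp add: algebra_simps)
    also have "\<bar>\<dots>\<bar> \<le> \<bar>(1 - t) * (mdist Z b x - mdist Z z0 x)\<bar> + \<bar>t * (mdist Z c x - mdist Z z0 x)\<bar>"
      by (rule abs_triangle_ineq)
    also have "\<dots> \<le> 1 * mdist Z b z0 + 1 * mdist Z c z0"
      unfolding abs_mult using assms that by (intro add_mono mult_mono mdist_diff_le) auto
    finally show ?thesis by simp
  qed
  then have "bounded (segment_point Z z0 b c t ` mspace Z)"
    unfolding bounded_iff by (auto simp: segment_point_def)
  then show ?thesis by (simp add: Met_TC.fspace_def segment_point_def)
qed

lemma bounded_functions_mdist_le:
  assumes "f \<in> mspace (bounded_functions Z)" "g \<in> mspace (bounded_functions Z)" "mspace Z \<noteq> {}"
  shows "mdist (bounded_functions Z) f g \<le> a \<longleftrightarrow> (\<forall>x\<in>mspace Z. \<bar>f x - g x\<bar> \<le> a)"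
  using assms by (simp add: Met_TC.funspace_mdist_le dist_real_def)

lemma segment_point_metric:
  assumes z0: "z0 \<in> mspace Z" and bc: "b \<in> mspace Z" "c \<in> mspace Z" and s: "s \<in> {0..1}" and t: "t \<in> {0..1}"
  shows "a \<in> mspace Z \<Longrightarrow> mdist (bounded_functions Z) (segment_point Z z0 a a 0) (segment_point Z z0 b c t)
      \<le> max (mdist Z a b) (mdist Z a c)"
    "mdist (bounded_functions Z) (segment_point Z z0 b c s) (segment_point Z z0 b c t) \<le> \<bar>s - t\<bar> * mdist Z b c"
    "a \<in> mspace Z \<Longrightarrow> (1 - t) * mdist Z b a + t * mdist Z c a
      \<le> mdist (bounded_functions Z) (segment_point Z z0 a a 0) (segment_point Z z0 b c t)"
proof -
  have ne: "mspace Z \<noteq> {}" using z0 by blast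
  note bdd = segment_point_bounded[OF z0]
  show "mdist (bounded_functions Z) (segment_point Z z0 a a 0) (segment_point Z z0 b c t)
      \<le> max (mdist Z a b) (mdist Z a c)" if a: "a \<in> mspace Z"
  proof -
    have "\<bar>segment_point Z z0 a a 0 x - segment_point Z z0 b c t x\<bar> \<le> max (mdist Z a b) (mdist Z a c)"
      if x: "x \<in> mspace Z" for x
    proof -
      let ?m = "max (mdist Z a b) (mdist Z a c)"
      have "segment_point Z z0 a a 0 x - segment_point Z z0 b c t x
          = (1 - t) * (mdist Z a x - mdist Z b x) + t * (mdist Z a x - mdist Z c x)"
        using x by (simp add: segment_point_def algebra_simps)
      also have "\<bar>\<dots>\<bar> \<le> \<bar>(1 - t) * (mdist Z a x - mdist Z b x)\<bar> + \<bar>t * (mdist Z a x - mdist Z c x)\<bar>"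
        by (rule abs_triangle_ineq)
      also have "\<dots> \<le> (1 - t) * ?m + t * ?m"
        unfolding abs_mult using t mdist_diff_le[OF a bc(1) x] mdist_diff_le[OF a bc(2) x]
        by (intro add_mono mult_mono) auto
      finally show ?thesis by (simp add: algebra_simps)
    qed
    then show ?thesis using bdd a bc t ne by (subst bounded_functions_mdist_le) auto
  qed
  have "\<bar>segment_point Z z0 b c s x - segment_point Z z0 b c t x\<bar> \<le> \<bar>s - t\<bar> * mdist Z b c"
    if x: "x \<in> mspace Z" for x
  proof -
    have "segment_point Z z0 b c s x - segment_point Z z0 b c t x = (s - t) * (mdist Z c x - mdist Z b x)"
      using x by (simp add: segment_point_def algebra_simps)
    then show ?thesis
      using mult_left_mono[OF mdist_diff_le[OF bc(2,1) x], of "\<bar>s - t\<bar>"] by (simp add: abs_mult mdist_commute)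
  qed
  then show "mdist (bounded_functions Z) (segment_point Z z0 b c s) (segment_point Z z0 b c t) \<le> \<bar>s - t\<bar> * mdist Z b c"
    using bdd bc s t ne by (subst bounded_functions_mdist_le) auto
  show "(1 - t) * mdist Z b a + t * mdist Z c a
      \<le> mdist (bounded_functions Z) (segment_point Z z0 a a 0) (segment_point Z z0 b c t)" if a: "a \<in> mspace Z"
  proof -
    have "\<forall>x\<in>mspace Z. \<bar>segment_point Z z0 a a 0 x - segment_point Z z0 b c t x\<bar>
        \<le> mdist (bounded_functions Z) (segment_point Z z0 a a 0) (segment_point Z z0 b c t)"
      using bounded_functions_mdist_le[OF bdd[OF a a, of 0] bdd[OF bc t] ne] by force
    then have "\<bar>segment_point Z z0 a a 0 a - segment_point Z z0 b c t a\<bar>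
        \<le> mdist (bounded_functions Z) (segment_point Z z0 a a 0) (segment_point Z z0 b c t)" using a by blast
    moreover have "segment_point Z z0 a a 0 a - segment_point Z z0 b c t a
        = - ((1 - t) * mdist Z b a + t * mdist Z c a)"
      using a by (simp add: segment_point_def)
    ultimately show ?thesis by linarith
  qed
qed

text \<open>
  The last conjunct says that balls around points of \<open>Z\<close> are convex with respect to the segments.
\<close>

definition joined_by_segments :: "'z metric \<Rightarrow> 'n metric \<Rightarrow> ('z \<Rightarrow> 'n) \<Rightarrow> ('z \<Rightarrow> 'z \<Rightarrow> real \<Rightarrow> 'n) \<Rightarrow> bool" where
  "joined_by_segments Z N e p \<longleftrightarrow> closed_isometric_embedding Z N e \<and>
    (\<forall>b\<in>mspace Z. \<forall>c\<in>mspace Z. p b c 0 = e b \<and> p b c 1 = e c \<and>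
      (\<forall>t\<in>{0..1}. p b c t \<in> mspace N \<and>
        (\<forall>s\<in>{0..1}. mdist N (p b c s) (p b c t) \<le> \<bar>s - t\<bar> * mdist Z b c) \<and>
        (\<forall>a\<in>mspace Z. mdist N (e a) (p b c t) \<le> max (mdist Z a b) (mdist Z a c))))"

lemma joined_by_segmentsD:
  assumes "joined_by_segments Z N e p"
  shows "closed_isometric_embedding Z N e"
    "\<lbrakk>b \<in> mspace Z; c \<in> mspace Z\<rbrakk> \<Longrightarrow> p b c 0 = e b \<and> p b c 1 = e c"
    "\<lbrakk>b \<in> mspace Z; c \<in> mspace Z; t \<in> {0..1}\<rbrakk> \<Longrightarrow> p b c t \<in> mspace N"
    "\<lbrakk>b \<in> mspace Z; c \<in> mspace Z; s \<in> {0..1}; t \<in> {0..1}\<rbrakk> \<Longrightarrow>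
       mdist N (p b c s) (p b c t) \<le> \<bar>s - t\<bar> * mdist Z b c"
    "\<lbrakk>b \<in> mspace Z; c \<in> mspace Z; t \<in> {0..1}; a \<in> mspace Z\<rbrakk> \<Longrightarrow>
       mdist N (e a) (p b c t) \<le> max (mdist Z a b) (mdist Z a c)"
  using assms unfolding joined_by_segments_def by simp_all

text \<open>
  The space consists of all segments between points of Kuratowski's embedding. The embedded \<open>Z\<close> is closed
  in it, as in Wojdyslawski's theorem: if the point at parameter \<open>t\<close> between \<open>b\<close> and \<open>c\<close> is close to \<open>a\<close>,
  evaluation at \<open>a\<close> shows that \<open>(1 - t) * mdist Z b a + t * mdist Z c a\<close> is small, hence also
  \<open>min t (1 - t) * mdist Z b c\<close>.
\<close>

lemma segment_space:
  fixes Z :: "'z metric"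
  assumes "mspace Z \<noteq> {}"
  shows "\<exists>(N :: (('z \<Rightarrow> real) + 'u) metric) e p. joined_by_segments Z N e p"
proof -
  obtain z0 where z0: "z0 \<in> mspace Z" using assms by blast
  define q where "q = segment_point Z z0"
  define P where "P = {q b c t |b c t. b \<in> mspace Z \<and> c \<in> mspace Z \<and> t \<in> {0..1}}"
  define F where "F = bounded_functions Z"
  have PF: "P \<subseteq> mspace F" unfolding P_def F_def q_def using segment_point_bounded[OF z0] by blast
  define N :: "(('z \<Rightarrow> real) + 'u) metric"
    where "N = metric (Inl ` P, \<lambda>f g. mdist F (projl f) (projl g))"
  have "Metric_space (Inl ` P :: (('z \<Rightarrow> real) + 'u) set) (\<lambda>f g. mdist F (projl f) (projl g))"
  proof
    fix f g h :: "('z \<Rightarrow> real) + 'u"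
    show "0 \<le> mdist F (projl f) (projl g)" by simp
    show "mdist F (projl f) (projl g) = mdist F (projl g) (projl f)" by (rule mdist_commute)
    show "(mdist F (projl f) (projl g) = 0) = (f = g)" if "f \<in> Inl ` P" "g \<in> Inl ` P"
      using that PF by (auto simp: subset_iff)
    show "mdist F (projl f) (projl h) \<le> mdist F (projl f) (projl g) + mdist F (projl g) (projl h)"
      if "f \<in> Inl ` P" "g \<in> Inl ` P" "h \<in> Inl ` P"
      using that PF by (auto simp: subset_iff intro!: mdist_triangle)
  qed
  then have N: "mspace N = Inl ` P" "mdist N (Inl f) (Inl g) = mdist F f g" for f g
    unfolding N_def by (simp_all add: Metric_space.mspace_metric Metric_space.mdist_metric)
  define p :: "'z \<Rightarrow> 'z \<Rightarrow> real \<Rightarrow> ('z \<Rightarrow> real) + 'u" where "p b c t = Inl (q b c t)" for b c t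
  define e where "e a = p a a 0" for a
  have pN: "p b c t \<in> mspace N" if "b \<in> mspace Z" "c \<in> mspace Z" "t \<in> {0..1}" for b c t
    using that unfolding N p_def P_def by blast
  have ends: "p b c 0 = e b \<and> p b c 1 = e c" for b c
    by (simp add: p_def e_def q_def segment_point_def fun_eq_iff)
  note metric = segment_point_metric[OF z0, folded q_def F_def]
  have near: "mdist N (e a) (p b c t) \<le> max (mdist Z a b) (mdist Z a c)"
    if "a \<in> mspace Z" "b \<in> mspace Z" "c \<in> mspace Z" "t \<in> {0..1}" for a b c t
    using metric(1)[OF that(2,3,4) that(4,1)] by (simp add: e_def p_def N)
  have far: "(1 - t) * mdist Z b a + t * mdist Z c a \<le> mdist N (e a) (p b c t)"
    if "a \<in> mspace Z" "b \<in> mspace Z" "c \<in> mspace Z" "t \<in> {0..1}" for a b c t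
    using metric(3)[OF that(2,3,4) that(4,1)] by (simp add: e_def p_def N)
  have "closed_isometric_embedding Z N e"
    unfolding closed_isometric_embedding_def
  proof (intro conjI ballI)
    fix x y assume "x \<in> mspace Z" "y \<in> mspace Z"
    then show "mdist N (e x) (e y) = mdist Z x y"
      using near[of x y y 0] far[of x y y 0] ends[of y y] by (simp add: mdist_commute)
  next
    show "closedin (mtopology_of N) (e ` mspace Z)"
      unfolding mtopology_of_def Metric_space.closedin_metric[OF Metric_space_mspace_mdist]
    proof (intro conjI allI impI)
      show "e ` mspace Z \<subseteq> mspace N" using pN by (auto simp: e_def)
      fix f assume f: "f \<in> mspace N - e ` mspace Z"
      then obtain b c t where bct: "b \<in> mspace Z" "c \<in> mspace Z" "t \<in> {0..1}" "f = p b c t"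
        unfolding N P_def p_def by blast
      \<comment> \<open>a segment point outside the embedded space is an interior point of a nontrivial segment\<close>
      have t: "0 < t" "t < 1" using f bct ends[of b c] by (auto simp: less_le)
      have "b \<noteq> c"
      proof
        assume "b = c"
        then have "p b c t = e b" by (simp add: p_def e_def q_def segment_point_def fun_eq_iff algebra_simps)
        then show False using f bct by blast
      qed
      then have pos: "mdist Z b c > 0" using bct mdist_zero[of b Z c] mdist_nonneg[of Z b c] by linarith
      let ?s = "min t (1 - t)"
      have s: "?s > 0" using t by simp
      have "\<not> mdist N f (e a) < ?s * mdist Z b c" if a: "a \<in> mspace Z" for a
      proof -
        have "?s * mdist Z b c \<le> ?s * (mdist Z b a + mdist Z c a)"
          using mdist_le_via(3)[OF bct(1) a bct(2)] s by (intro mult_left_mono) auto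
        also have "\<dots> \<le> (1 - t) * mdist Z b a + t * mdist Z c a"
          unfolding distrib_left by (intro add_mono mult_right_mono) auto
        also have "\<dots> \<le> mdist N f (e a)" using far[OF a bct(1,2,3)] bct(4) by (simp add: mdist_commute)
        finally show ?thesis by simp
      qed
      then have "disjnt (e ` mspace Z) (Metric_space.mball (mspace N) (mdist N) f (?s * mdist Z b c))"
        by (auto simp: disjnt_iff Metric_space.in_mball[OF Metric_space_mspace_mdist])
      then show "\<exists>r>0. disjnt (e ` mspace Z) (Metric_space.mball (mspace N) (mdist N) f r)"
        using s pos by (intro exI[of _ "?s * mdist Z b c"]) simp
    qed
  qed
  moreover have "mdist N (p b c s) (p b c t) \<le> \<bar>s - t\<bar> * mdist Z b c"
    if "b \<in> mspace Z" "c \<in> mspace Z" "s \<in> {0..1}" "t \<in> {0..1}" for b c s t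
    using metric(2)[OF that] by (simp add: p_def N)
  ultimately have "joined_by_segments Z N e p"
    unfolding joined_by_segments_def using pN ends near by simp
  then show ?thesis by blast
qed

lemma retracted_segment_path:
  assumes emb: "closed_isometric_embedding Z N e" and U: "U \<subseteq> mspace N"
    and \<rho>: "continuous_map (subtopology (mtopology_of N) U) (subtopology (mtopology_of N) (e ` mspace Z)) \<rho>"
    and p: "\<And>t. t \<in> {0..1} \<Longrightarrow> p t \<in> U"
    and Lip: "\<And>s t. \<lbrakk>s \<in> {0..1}; t \<in> {0..1}\<rbrakk> \<Longrightarrow> mdist N (p s) (p t) \<le> \<bar>s - t\<bar> * K"
  obtains \<gamma> where "pathin (mtopology_of Z) \<gamma>"
    "\<And>t. t \<in> {0..1} \<Longrightarrow> \<gamma> t \<in> mspace Z \<and> e (\<gamma> t) = \<rho> (p t)"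
proof -
  let ?I = "submetric euclidean_metric {0..1::real}"
  note iso = closed_isometric_embeddingD(1)[OF emb] and eN = closed_isometric_embeddingD(3)[OF emb]
  have "continuous_map (mtopology_of ?I) (mtopology_of (submetric N U)) p"
    unfolding mtopology_of_def Metric_space.metric_continuous_map[OF Metric_space_mspace_mdist Metric_space_mspace_mdist]
  proof (intro conjI ballI allI impI)
    show "p ` mspace ?I \<subseteq> mspace (submetric N U)" using p U by auto
    fix s and \<epsilon> :: real assume s: "s \<in> mspace ?I" and \<epsilon>: "\<epsilon> > 0"
    have "mdist N (p s) (p t) < \<epsilon>" if t: "t \<in> {0..1}" "dist s t < \<epsilon> / (\<bar>K\<bar> + 1)" for t
    proof -
      have "mdist N (p s) (p t) \<le> \<bar>s - t\<bar> * K" using s t by (intro Lip) auto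
      also have "\<dots> \<le> \<bar>s - t\<bar> * (\<bar>K\<bar> + 1)" by (intro mult_left_mono) auto
      also have "\<dots> < \<epsilon>" using t(2) by (simp add: dist_real_def pos_less_divide_eq)
      finally show ?thesis .
    qed
    then show "\<exists>\<delta>>0. \<forall>x. x \<in> mspace ?I \<and> mdist ?I s x < \<delta> \<longrightarrow> mdist (submetric N U) (p s) (p x) < \<epsilon>"
      using \<epsilon> by (intro exI[of _ "\<epsilon> / (\<bar>K\<bar> + 1)"]) simp
  qed
  moreover have "continuous_map (mtopology_of (submetric N U)) (mtopology_of (submetric N (e ` mspace Z))) \<rho>"
    using \<rho> by (simp add: mtopology_of_submetric)
  moreover
  define inv where "inv = (\<lambda>y. SOME x. x \<in> mspace Z \<and> e x = y)"
  have inv: "inv y \<in> mspace Z \<and> e (inv y) = y" if "y \<in> e ` mspace Z" for y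
    unfolding inv_def by (rule someI_ex) (use that in blast)
  have "continuous_map (mtopology_of (submetric N (e ` mspace Z))) (mtopology_of Z) inv"
    unfolding mtopology_of_def Metric_space.metric_continuous_map[OF Metric_space_mspace_mdist Metric_space_mspace_mdist]
  proof (intro conjI ballI allI impI)
    show "inv ` mspace (submetric N (e ` mspace Z)) \<subseteq> mspace Z" using inv by auto
    fix y and \<epsilon> :: real assume y: "y \<in> mspace (submetric N (e ` mspace Z))" and \<epsilon>: "\<epsilon> > 0"
    have "mdist Z (inv y) (inv w) = mdist N y w" if "w \<in> e ` mspace Z" for w
      using iso[of "inv y" "inv w"] inv[of y] inv[OF that] y by auto
    then show "\<exists>\<delta>>0. \<forall>x. x \<in> mspace (submetric N (e ` mspace Z)) \<and> mdist (submetric N (e ` mspace Z)) y x < \<delta> \<longrightarrow>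
        mdist Z (inv y) (inv x) < \<epsilon>" using \<epsilon> by auto
  qed
  ultimately have cont: "continuous_map (mtopology_of ?I) (mtopology_of Z) (inv \<circ> (\<rho> \<circ> p))"
    by (intro continuous_map_compose)
  have "\<rho> (p t) \<in> e ` mspace Z" if "t \<in> {0..1}" for t
    using continuous_map_image_subset_topspace[OF \<rho>] p[OF that] U by (auto simp: image_subset_iff)
  then have "inv (\<rho> (p t)) \<in> mspace Z \<and> e (inv (\<rho> (p t))) = \<rho> (p t)" if "t \<in> {0..1}" for t
    using inv that by blast
  then show ?thesis using cont that[of "inv \<circ> (\<rho> \<circ> p)"] by (simp add: pathin_def mtopology_of_submetric)
qed

text \<open>
  Segments between points close to \<open>a\<close> stay close to \<open>a\<close>; the retraction turns them into paths in \<open>Z\<close>.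
\<close>

lemma abs_nbhd_retract_imp_locally_joinable:
  fixes Z :: "'z metric"
  assumes anr: "abs_nbhd_retract TYPE('u) Z"
  shows "locally_joinable Z"
proof (cases "mspace Z = {}")
  case True
  then show ?thesis by (simp add: locally_joinable_def)
next
  case False
  obtain N :: "(('z \<Rightarrow> real) + 'u) metric" and e p where N: "joined_by_segments Z N e p"
    using segment_space[OF False] by blast
  note emb = joined_by_segmentsD(1)[OF N] and ends = joined_by_segmentsD(2)[OF N]
    and pN = joined_by_segmentsD(3)[OF N] and Lip = joined_by_segmentsD(4)[OF N]
    and near = joined_by_segmentsD(5)[OF N]
  note iso = closed_isometric_embeddingD(1)[OF emb] and eN = closed_isometric_embeddingD(3)[OF emb]
    and inj = inj_onD[OF closed_isometric_embeddingD(4)[OF emb]]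
  obtain U where U: "openin (mtopology_of N) U" "e ` mspace Z \<subseteq> U"
    and ret: "e ` mspace Z retract_of_space subtopology (mtopology_of N) U"
    using anr emb unfolding abs_nbhd_retract_def by meson
  have UN: "U \<subseteq> mspace N" using openin_subset[OF U(1)] by simp
  have UeZ: "U \<inter> e ` mspace Z = e ` mspace Z" using U(2) by blast
  obtain \<rho> where \<rho>: "continuous_map (subtopology (mtopology_of N) U) (subtopology (mtopology_of N) (e ` mspace Z)) \<rho>"
    and \<rho>_id: "\<And>x. x \<in> e ` mspace Z \<Longrightarrow> \<rho> x = x"
    using ret unfolding retract_of_space_def subtopology_subtopology UeZ by blast
  show ?thesis
    unfolding locally_joinable_def
  proof (intro ballI allI impI)
    fix a and \<epsilon> :: real assume a: "a \<in> mspace Z" and \<epsilon>: "\<epsilon> > 0"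
    have "continuous_map (mtopology_of (submetric N U)) (mtopology_of (submetric N (e ` mspace Z))) \<rho>"
      using \<rho> by (simp add: mtopology_of_submetric)
    then have "\<forall>y\<in>mspace (submetric N U). \<forall>\<epsilon>>0. \<exists>\<delta>>0. \<forall>x. x \<in> mspace (submetric N U) \<and> mdist N y x < \<delta> \<longrightarrow>
        mdist N (\<rho> y) (\<rho> x) < \<epsilon>"
      unfolding mtopology_of_def Metric_space.metric_continuous_map[OF Metric_space_mspace_mdist Metric_space_mspace_mdist]
      by simp
    moreover have "e a \<in> mspace (submetric N U)" using a U(2) UN by auto
    ultimately obtain \<delta>1 where "\<delta>1 > 0"
      and \<delta>1_near: "\<forall>x. x \<in> mspace (submetric N U) \<and> mdist N (e a) x < \<delta>1 \<longrightarrow> mdist N (\<rho> (e a)) (\<rho> x) < \<epsilon>"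
      using \<epsilon> by blast
    have \<delta>1: "mdist N (\<rho> (e a)) (\<rho> x) < \<epsilon>" if "x \<in> U" "mdist N (e a) x < \<delta>1" for x
      using \<delta>1_near that UN by auto
    obtain \<delta>2 where \<delta>2: "\<delta>2 > 0" "mball_of N (e a) \<delta>2 \<subseteq> U"
      using U a unfolding mtopology_of_def mball_of_def Metric_space.openin_mtopology[OF Metric_space_mspace_mdist] by blast
    define \<delta> where "\<delta> = min \<delta>1 \<delta>2"
    have "\<exists>\<gamma>. pathin (mtopology_of Z) \<gamma> \<and> \<gamma> 0 = b \<and> \<gamma> 1 = c \<and> (\<forall>t\<in>{0..1}. mdist Z a (\<gamma> t) < \<epsilon>)"
      if b: "b \<in> mspace Z" and c: "c \<in> mspace Z" and close: "mdist Z a b < \<delta> \<and> mdist Z a c < \<delta>" for b c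
    proof -
      have ball: "mdist N (e a) (p b c t) < \<delta>" if "t \<in> {0..1}" for t
        using near[OF b c that a] by (rule le_less_trans) (use close in simp)
      have pU: "p b c t \<in> U" if "t \<in> {0..1}" for t
      proof -
        have "p b c t \<in> mball_of N (e a) \<delta>2" using ball[OF that] pN[OF b c that] eN a by (auto simp: \<delta>_def)
        then show ?thesis using \<delta>2(2) by blast
      qed
      obtain \<gamma> where \<gamma>: "pathin (mtopology_of Z) \<gamma>" "\<And>t. t \<in> {0..1} \<Longrightarrow> \<gamma> t \<in> mspace Z \<and> e (\<gamma> t) = \<rho> (p b c t)"
        using retracted_segment_path[OF emb UN \<rho> pU Lip[OF b c]] by blast
      have "\<gamma> 0 = b" using \<gamma>(2)[of 0] ends[OF b c] \<rho>_id[of "e b"] b by (intro inj) auto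
      moreover have "\<gamma> 1 = c" using \<gamma>(2)[of 1] ends[OF b c] \<rho>_id[of "e c"] c by (intro inj) auto
      moreover have "mdist Z a (\<gamma> t) < \<epsilon>" if t: "t \<in> {0..1}" for t
      proof -
        have "mdist N (\<rho> (e a)) (\<rho> (p b c t)) < \<epsilon>" using ball[OF t] by (intro \<delta>1 pU t) (simp add: \<delta>_def)
        then show ?thesis using \<gamma>(2)[OF t] \<rho>_id[of "e a"] a iso[OF a, of "\<gamma> t"] by auto
      qed
      ultimately show ?thesis using \<gamma>(1) by blast
    qed
    moreover have "\<delta> > 0" using \<open>\<delta>1 > 0\<close> \<delta>2 by (simp add: \<delta>_def)
    ultimately show "\<exists>\<delta>>0. \<forall>b\<in>mspace Z. \<forall>c\<in>mspace Z. mdist Z a b < \<delta> \<and> mdist Z a c < \<delta> \<longrightarrow>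
       (\<exists>\<gamma>. pathin (mtopology_of Z) \<gamma> \<and> \<gamma> 0 = b \<and> \<gamma> 1 = c \<and> (\<forall>t\<in>{0..1}. mdist Z a (\<gamma> t) < \<epsilon>))" by blast
  qed
qed

lemma abs_retract_imp_abs_nbhd_retract:
  assumes "abs_retract TYPE('u) Z" shows "abs_nbhd_retract TYPE('u) Z"
  unfolding abs_nbhd_retract_def
proof (intro allI impI)
  fix N :: "(('a \<Rightarrow> real) + 'u) metric" and e assume emb: "closed_isometric_embedding Z N e"
  then have "e ` mspace Z retract_of_space mtopology_of N" using assms unfolding abs_retract_def by blast
  moreover have "subtopology (mtopology_of N) (mspace N) = mtopology_of N"
    by (metis subtopology_topspace topspace_mtopology_of)
  moreover have "e ` mspace Z \<subseteq> mspace N" using emb by (rule closed_isometric_embeddingD)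
  moreover have "openin (mtopology_of N) (mspace N)" by (metis openin_topspace topspace_mtopology_of)
  ultimately show "\<exists>U. openin (mtopology_of N) U \<and> e ` mspace Z \<subseteq> U \<and>
             e ` mspace Z retract_of_space subtopology (mtopology_of N) U"
    by (intro exI[of _ "mspace N"]) simp
qed

text \<open>
  The empty space is closed in a one-point space, which has no map to it.
\<close>

lemma abs_retract_imp_nonempty:
  fixes Z :: "'z metric"
  assumes ar: "abs_retract TYPE('u) Z" shows "mspace Z \<noteq> {}"
proof
  assume empty: "mspace Z = {}"
  define N :: "(('z \<Rightarrow> real) + 'u) metric" where "N = metric ({Inl (\<lambda>_. 0)}, \<lambda>_ _. 0)"
  have "Metric_space {Inl (\<lambda>_. 0) :: ('z \<Rightarrow> real) + 'u} (\<lambda>_ _. 0)" by unfold_locales auto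
  then have N: "mspace N = {Inl (\<lambda>_. 0)}" unfolding N_def by (rule Metric_space.mspace_metric)
  have "closed_isometric_embedding Z N e" for e by (simp add: closed_isometric_embedding_def empty)
  then have "{} retract_of_space mtopology_of N" using ar empty unfolding abs_retract_def by force
  then obtain r where "continuous_map (mtopology_of N) (subtopology (mtopology_of N) {}) r"
    unfolding retract_of_space_def by blast
  from continuous_map_image_subset_topspace[OF this] have "r ` mspace N \<subseteq> {}" by simp
  then show False by (simp add: N)
qed

lemma abs_retract_imp_joined:
  fixes Z :: "'z metric"
  assumes ar: "abs_retract TYPE('u) Z" and b: "b \<in> mspace Z" and c: "c \<in> mspace Z"
  obtains \<gamma> where "pathin (mtopology_of Z) \<gamma>" "\<gamma> 0 = b" "\<gamma> 1 = c"
proof -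
  have ne: "mspace Z \<noteq> {}" using b by blast
  obtain N :: "(('z \<Rightarrow> real) + 'u) metric" and e p where N: "joined_by_segments Z N e p"
    using segment_space[OF ne] by blast
  note emb = joined_by_segmentsD(1)[OF N] and ends = joined_by_segmentsD(2)[OF N]
    and pN = joined_by_segmentsD(3)[OF N] and Lip = joined_by_segmentsD(4)[OF N]
  note inj = inj_onD[OF closed_isometric_embeddingD(4)[OF emb]]
  obtain \<rho> where \<rho>: "continuous_map (mtopology_of N) (subtopology (mtopology_of N) (e ` mspace Z)) \<rho>"
    and \<rho>_id: "\<And>x. x \<in> e ` mspace Z \<Longrightarrow> \<rho> x = x"
    using ar emb unfolding abs_retract_def retract_of_space_def by meson
  have "subtopology (mtopology_of N) (mspace N) = mtopology_of N"
    by (metis subtopology_topspace topspace_mtopology_of)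
  then have \<rho>': "continuous_map (subtopology (mtopology_of N) (mspace N)) (subtopology (mtopology_of N) (e ` mspace Z)) \<rho>"
    using \<rho> by simp
  obtain \<gamma> where \<gamma>: "pathin (mtopology_of Z) \<gamma>" "\<And>t. t \<in> {0..1} \<Longrightarrow> \<gamma> t \<in> mspace Z \<and> e (\<gamma> t) = \<rho> (p b c t)"
    using retracted_segment_path[OF emb order_refl \<rho>' pN[OF b c] Lip[OF b c]] by blast
  have "\<gamma> 0 = b" using \<gamma>(2)[of 0] ends[OF b c] \<rho>_id[of "e b"] b by (intro inj) auto
  moreover have "\<gamma> 1 = c" using \<gamma>(2)[of 1] ends[OF b c] \<rho>_id[of "e c"] c by (intro inj) auto
  ultimately show ?thesis using that \<gamma>(1) by blast
qed

lemma path_of_sets_bounded: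
  assumes \<gamma>: "pathin (mtopology_of (bounded_hyperspace m)) \<gamma>"
  shows "mbounded_of m (\<Union>t\<in>{0..1}. \<gamma> t)"
proof -
  let ?H = "bounded_hyperspace m"
  have mem: "\<gamma> t \<in> closed_bounded_nonempty m" if "t \<in> {0..1}" for t
    using \<gamma> that unfolding pathin_def continuous_map_def by (auto simp: Pi_iff)
  have "compactin (mtopology_of ?H) (\<gamma> ` {0..1})"
    using \<gamma> unfolding pathin_def by (intro image_compactin[where X = "top_of_set {0..1}"]) (simp_all add: compactin_subtopology)
  then have "mbounded_of ?H (\<gamma> ` {0..1})"
    unfolding mtopology_of_def by (rule Metric_space.compactin_imp_mbounded[OF Metric_space_mspace_mdist])
  then obtain K where "\<forall>A\<in>\<gamma> ` {0..1}. \<forall>B\<in>\<gamma> ` {0..1}. mdist ?H A B \<le> K"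
    unfolding mbounded_of_iff by (elim conjE exE)
  then have K: "mdist ?H (\<gamma> s) (\<gamma> t) \<le> K" if "s \<in> {0..1}" "t \<in> {0..1}" for s t
    using that by simp
  have "(\<Union>t\<in>{0..1}. \<gamma> t) \<subseteq> nbhd m (\<gamma> 0) (K + 1)"
  proof (rule UN_least)
    fix t :: real assume t: "t \<in> {0..1}"
    then have "mdist ?H (\<gamma> t) (\<gamma> 0) < K + 1" using K[of t 0] by simp
    then have "near_to m (K + 1) (\<gamma> t) (\<gamma> 0)" by (intro near_to_if_Hausdorff_less mem t) auto
    then show "\<gamma> t \<subseteq> nbhd m (\<gamma> 0) (K + 1)"
      using near_to_bounded(1) hyperspace_memD[OF mem, of 0] hyperspace_memD(1)[OF mem[OF t]] by simp
  qed
  moreover have "mbounded_of m (\<gamma> 0)" using hyperspace_memD(3)[OF mem, of 0] by simp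
  ultimately show ?thesis using mbounded_of_nbhd mbounded_of_subset by blast
qed

text \<open>
  Follow a path of sets from a single point of \<open>B\<close> to the closure of \<open>B\<close>.
\<close>

lemma abs_retract_imp_boundedly_chained:
  fixes m :: "'a metric"
  assumes ar: "abs_retract TYPE('u) (bounded_hyperspace m)"
  shows "boundedly_chained m"
  unfolding boundedly_chained_def
proof (intro allI impI)
  fix B assume B: "mbounded_of m B"
  show "\<exists>B'. mbounded_of m B' \<and> (\<forall>\<eta>>0. \<exists>n. \<forall>x\<in>B. \<forall>y\<in>B. chain m \<eta> n B' x y)"
  proof (cases "B = {}")
    case True
    then show ?thesis using B by (intro exI[of _ "{}"]) simp
  next
    case False
    have Bm: "B \<subseteq> mspace m" using B by (simp add: mbounded_of_iff)
    obtain x0 where x0: "x0 \<in> B" using False by blast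
    then have "mbounded_of m {x0}" using B by (rule_tac mbounded_of_subset) auto
    then have mem: "mclosure m {x0} \<in> mspace (bounded_hyperspace m)" "mclosure m B \<in> mspace (bounded_hyperspace m)"
      using mclosure_in_hyperspace B False by (simp_all add: mclosure_in_hyperspace)
    obtain \<gamma> where \<gamma>: "pathin (mtopology_of (bounded_hyperspace m)) \<gamma>" "\<gamma> 0 = mclosure m {x0}" "\<gamma> 1 = mclosure m B"
      using abs_retract_imp_joined[OF ar mem] .
    let ?W = "\<Union>t\<in>{0..1}. \<gamma> t"
    have W: "mbounded_of m ?W" by (rule path_of_sets_bounded[OF \<gamma>(1)])
    have "\<exists>n. \<forall>x\<in>B. \<forall>y\<in>B. chain m \<eta> n ?W x y" if \<eta>: "\<eta> > 0" for \<eta>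
    proof -
      obtain n where n: "\<forall>y\<in>\<gamma> 1. \<exists>x\<in>\<gamma> 0. chain m \<eta> n ?W x y"
        using path_of_sets_yields_chains[OF \<gamma>(1) _ \<eta>, of ?W] by blast
      have reach: "chain m \<eta> n ?W x0 y" if "y \<in> B" for y
      proof -
        have "y \<in> \<gamma> 1" using that \<gamma>(3) mclosure_extensive[OF Bm] by blast
        then obtain x where x: "x \<in> mclosure m {x0}" "chain m \<eta> n ?W x y" using n \<gamma>(2) by blast
        have "\<not> 0 < mdist m x x0" using x(1) unfolding in_mclosure by blast
        then have "mdist m x x0 = 0" using mdist_nonneg[of m x x0] by linarith
        moreover have "x \<in> mspace m" "x0 \<in> mspace m" using x(1) x0 Bm unfolding in_mclosure by auto
        ultimately have "x = x0" using mdist_zero[of x m x0] by simp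
        then show ?thesis using x(2) by simp
      qed
      have "chain m \<eta> (n + n) ?W x y" if "x \<in> B" "y \<in> B" for x y
        by (rule chain_trans[OF chain_sym[OF reach[OF that(1)]] reach[OF that(2)]])
      then show ?thesis by blast
    qed
    then show ?thesis using W by blast
  qed
qed

theorem bounded_hyperspace_ANR_iff:
  "abs_nbhd_retract TYPE('u) (bounded_hyperspace m) \<longleftrightarrow> locally_equichained m"
  using abs_nbhd_retract_imp_locally_joinable locally_joinable_hyperspace_close_sets_chained
    close_sets_chained_imp_locally_equichained locally_equichained_imp_abs_nbhd_retract by blast

theorem bounded_hyperspace_AR_iff:
  "abs_retract TYPE('u) (bounded_hyperspace m) \<longleftrightarrow> locally_equichained m \<and> boundedly_chained m \<and> mspace m \<noteq> {}"
proof
  assume ar: "abs_retract TYPE('u) (bounded_hyperspace m)"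
  then have "mspace (bounded_hyperspace m) \<noteq> {}" by (rule abs_retract_imp_nonempty)
  then show "locally_equichained m \<and> boundedly_chained m \<and> mspace m \<noteq> {}"
    using abs_retract_imp_abs_nbhd_retract[OF ar] abs_retract_imp_boundedly_chained[OF ar]
    by (simp add: bounded_hyperspace_ANR_iff hyperspace_empty_iff)
qed (auto intro: locally_equichained_imp_abs_retract)

section \<open>The full hyperspace\<close>

lemma ennreal_min_1: "ennreal (min 1 t) = min 1 (ennreal t)"
  by (cases "t \<le> 1") (auto simp: min_def ennreal_le_1)

lemma point_dist_capped:
  assumes "A \<noteq> {}" shows "point_dist (capped_metric 1 m) x A = min 1 (point_dist m x A)"
  using INF_inf_const1[OF assms, of 1 "\<lambda>a. ennreal (mdist m x a)"]
  by (simp add: point_dist_def capped_metric_mdist ennreal_min_1 inf_min)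

text \<open>
  Capping the metric at 1 caps the Hausdorff distance at 1. As every set is bounded for the
  capped metric, \<open>2\<^sup>X\<close> is the hyperspace of bounded sets of the capped space.
\<close>

lemma hausdorff_dist_capped:
  assumes "A \<noteq> {}" "B \<noteq> {}"
  shows "hausdorff_dist (capped_metric 1 m) A B = min 1 (hausdorff_dist m A B)"
proof -
  have "(SUP x\<in>C. min 1 (f x)) = min 1 (SUP x\<in>C. f x)" for f :: "'a \<Rightarrow> ennreal" and C
    using inf_SUP[of "1::ennreal" f C] by (simp add: inf_min)
  then show ?thesis
    using assms by (simp add: hausdorff_dist_def point_dist_capped min_max_distrib2)
qed

lemma closed_bounded_nonempty_capped:
  "closed_bounded_nonempty (capped_metric 1 m) = closed_nonempty m"
proof -
  have "mbounded_of (capped_metric 1 m) A" if "A \<subseteq> mspace m" for A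
    unfolding mbounded_of_iff using that by (auto simp: mdist_capped intro!: exI[of _ 1])
  then show ?thesis
    unfolding closed_bounded_nonempty_def closed_nonempty_def mtopology_capped_metric
    by (auto dest: closedin_subset)
qed

text \<open>
  Needed because two values of type \<^typ>\<open>'a metric\<close> with the same carrier may differ on pairs outside it.
\<close>

lemma retract_properties_cong:
  assumes "mspace Z = mspace Z'"
    and "\<And>x y. \<lbrakk>x \<in> mspace Z; y \<in> mspace Z\<rbrakk> \<Longrightarrow> mdist Z x y = mdist Z' x y"
  shows "abs_nbhd_retract TYPE('u) Z = abs_nbhd_retract TYPE('u) Z'"
    "abs_retract TYPE('u) Z = abs_retract TYPE('u) Z'"
proof -
  have "closed_isometric_embedding Z N e = closed_isometric_embedding Z' N e" for N :: "(('a \<Rightarrow> real) + 'u) metric" and e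
    using assms by (simp add: closed_isometric_embedding_def)
  then show "abs_nbhd_retract TYPE('u) Z = abs_nbhd_retract TYPE('u) Z'"
    "abs_retract TYPE('u) Z = abs_retract TYPE('u) Z'"
    using assms(1) by (simp_all add: abs_nbhd_retract_def abs_retract_def)
qed

lemma hyperspace_capped:
  "abs_nbhd_retract TYPE('u) (hyperspace m) = abs_nbhd_retract TYPE('u) (bounded_hyperspace (capped_metric 1 m))"
  "abs_retract TYPE('u) (hyperspace m) = abs_retract TYPE('u) (bounded_hyperspace (capped_metric 1 m))"
  by (rule retract_properties_cong;
      auto simp: closed_bounded_nonempty_capped mdist_hyperspace mdist_bounded_hyperspace
        hausdorff_dist_capped closed_nonempty_def)+

lemma capped_submetric: "capped_metric 1 (submetric m X) = submetric (capped_metric 1 m) X"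
proof -
  have "submetric (capped_metric 1 m) X = metric (X \<inter> mspace m, mdist (capped_metric 1 m))"
    by (simp add: submetric_def)
  then show ?thesis by (simp add: capped_metric[of 1 "submetric m X"] capped_metric_mdist)
qed

theorem corollary2:
  fixes M :: "'a metric" and X :: "'a set"
  assumes "X \<subseteq> mspace M" and "mtopology_of M closure_of X = mspace M"
  shows
    "(abs_nbhd_retract TYPE('u) (hyperspace (submetric M X)) \<longleftrightarrow>
        abs_nbhd_retract TYPE('u) (hyperspace M)) \<and>
     (abs_retract TYPE('u) (hyperspace (submetric M X)) \<longleftrightarrow>
        abs_retract TYPE('u) (hyperspace M)) \<and>
     (abs_nbhd_retract TYPE('u) (bounded_hyperspace (submetric M X)) \<longleftrightarrow>
        abs_nbhd_retract TYPE('u) (bounded_hyperspace M)) \<and>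
     (abs_retract TYPE('u) (bounded_hyperspace (submetric M X)) \<longleftrightarrow>
        abs_retract TYPE('u) (bounded_hyperspace M))"
proof -
  have bounded: "abs_nbhd_retract TYPE('u) (bounded_hyperspace (submetric m X)) \<longleftrightarrow>
        abs_nbhd_retract TYPE('u) (bounded_hyperspace m)"
    "abs_retract TYPE('u) (bounded_hyperspace (submetric m X)) \<longleftrightarrow>
        abs_retract TYPE('u) (bounded_hyperspace m)"
    if X: "X \<subseteq> mspace m" "mtopology_of m closure_of X = mspace m" for m :: "'a metric"
  proof -
    have "mspace (submetric m X) = {} \<longleftrightarrow> mspace m = {}"
      using X by (cases "X = {}") auto
    then show "abs_nbhd_retract TYPE('u) (bounded_hyperspace (submetric m X)) \<longleftrightarrow>
        abs_nbhd_retract TYPE('u) (bounded_hyperspace m)"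
      "abs_retract TYPE('u) (bounded_hyperspace (submetric m X)) \<longleftrightarrow>
        abs_retract TYPE('u) (bounded_hyperspace m)"
      unfolding bounded_hyperspace_ANR_iff bounded_hyperspace_AR_iff locally_equichained_dense_iff[OF X]
        boundedly_chained_dense_iff[OF X] by simp_all
  qed
  show ?thesis
    unfolding hyperspace_capped capped_submetric
    using bounded[of M] bounded[of "capped_metric 1 M"] assms by (simp add: mtopology_capped_metric)
qed

end
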